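(* Let $\mathbf{U}_q^-$ be the negative half of the quantum group of type $B_2$, with $J=\{1,2\}$, $(\alpha_1,\alpha_1)=4$, $(\alpha_2,\alpha_2)=2$, $(\alpha_1,\alpha_2)=-2$. Let $\mathbf{h}=(1,2,1,2)$ and $\mathbf{h}'=(2,1,2,1)$ be the two reduced sequences of the longest element of the Weyl group, and let $\mathbf{B}_{\mathbf{h}}=\{b(\mathbf{c},\mathbf{h})\mid \mathbf{c}\in\mathbb{N}^4\}$ and $\mathbf{B}_{\mathbf{h}'}=\{b(\mathbf{c},\mathbf{h}')\mid \mathbf{c}\in\mathbb{N}^4\}$ be the associated bar-invariant bases of $\mathbf{U}_q^-$. Then $\mathbf{B}_{\mathbf{h}}=\mathbf{B}_{\mathbf{h}'}$ as subsets of $\mathbf{U}_q^-$.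
   Context: $\mathbb{N}=\{0,1,2,\dots\}$. Put $[n]=\frac{q^n-q^{-n}}{q-q^{-1}}$, $[m]^!=[1]\cdots[m]$, $[0]^!=1$; $q_1=q^2$, $q_2=q$; $[n]_i$, $[n]_i^!$ are obtained by replacing $q$ by $q_i$. $\mathbf{U}_q^-$ is the associative $\mathbb{Q}(q)$-algebra generated by $f_1,f_2$ with relations $\sum_{k+k'=1-a_{ij}}(-1)^k f_i^{(k)}f_jf_i^{(k')}=0$ for $i\neq j$, where $a_{12}=-1$, $a_{21}=-2$, $f_i^{(n)}=f_i^n/[n]_i^!$. Let $\mathbf{A}=\mathbb{Z}[q,q^{-1}]$, and let ${}_{\mathbf{A}}\mathbf{U}_q^-$ be the $\mathbf{A}$-subalgebra generated by all $f_i^{(n)}$. PBW bases. For a reduced sequence $(j_1,\dots,j_4)$ of the longest Weyl group element, the root vectors are $f_{\beta_k}^{(n)}=T_{j_1}\cdots T_{j_{k-1}}(f_{j_k}^{(n)})$, with $T_i$ the braid group action (Lusztig's $T''_{i,1}$). Explicitly, for $\mathbf{h}=(1,2,1,2)$ the root vectors are, in order, $f_1$; $f_{12}=f_2f_1-q^2f_1f_2$; $f_{122}=f_2^{(2)}f_1-q f_2f_1f_2+q^2f_1f_2^{(2)}$; $f_2$. For $\mathbf{h}'=(2,1,2,1)$ they are, in order, $f_2$; $f'_{122}=f_1f_2^{(2)}-q f_2f_1f_2+q^2f_2^{(2)}f_1$; $f'_{12}=f_1f_2-q^2f_2f_1$; $f_1$. The divided powers are $x^{(n)}=x^n/[n]_1^!$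 for $x=f_1,f_{122},f'_{122}$ and $x^{(n)}=x^n/[n]^!$ for $x=f_2,f_{12},f'_{12}$. For $\mathbf{c}=(a,b,c,d)\in\mathbb{N}^4$ set $L(\mathbf{c},\mathbf{h})=f_1^{(a)}f_{12}^{(b)}f_{122}^{(c)}f_2^{(d)}$ and $L(\mathbf{c},\mathbf{h}')=f_2^{(a)}{f'}_{122}^{(b)}{f'}_{12}^{(c)}f_1^{(d)}$. Each of the two families is an $\mathbf{A}$-basis of ${}_{\mathbf{A}}\mathbf{U}_q^-$ and a $\mathbb{Q}(q)$-basis of $\mathbf{U}_q^-$. The bar involution is the $\mathbb{Q}$-algebra automorphism of $\mathbf{U}_q^-$ with $\overline{q}=q^{-1}$, $\overline{f_i}=f_i$. Order $\mathbb{N}^4$ lexicographically: $\mathbf{c}<\mathbf{c}'$ if at the first index $k$ where they differ, $c_k<c'_k$. For $\mathbf{k}\in\{\mathbf{h},\mathbf{h}'\}$ and $\mathbf{c}\in\mathbb{N}^4$, $b(\mathbf{c},\mathbf{k})$ is the unique element with $\overline{b(\mathbf{c},\mathbf{k})}=b(\mathbf{c},\mathbf{k})$ and $b(\mathbf{c},\mathbf{k})=L(\mathbf{c},\mathbf{k})+\sum_{\mathbf{c}'>\mathbf{c}}p_{\mathbf{c}',\mathbf{c}}L(\mathbf{c}',\mathbf{k})$ with $p_{\mathbf{c}',\mathbf{c}}\in q\mathbb{Z}[q]$. *)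

theory Defs
  imports "HOL-Library.Poly_Mapping" "HOL-Computational_Algebra.Polynomial_Factorial"
begin

type_synonym ratfun = "rat poly fract"

definition qvar :: ratfun where
  "qvar = to_fract [:0, 1:]"

definition qint :: "ratfun \<Rightarrow> nat \<Rightarrow> ratfun" where
  "qint v n = (v ^ n - inverse v ^ n) / (v - inverse v)"

definition qfact :: "ratfun \<Rightarrow> nat \<Rightarrow> ratfun" where
  "qfact v n = (\<Prod>k = 1..n. qint v k)"

definition qZq :: "ratfun set" where
  "qZq = {qvar * to_fract (map_poly rat_of_int r) | r :: int poly. True}"

datatype idx = J1 | J2

fun pairing :: "idx \<Rightarrow> idx \<Rightarrow> int" where
  "pairing J1 J1 = 4"
| "pairing J2 J2 = 2"
| "pairing J1 J2 = - 2"
| "pairing J2 J1 = - 2"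

definition cartan :: "idx \<Rightarrow> idx \<Rightarrow> int" where
  "cartan i j = 2 * pairing i j div pairing i i"

definition qidx :: "idx \<Rightarrow> ratfun" where
  "qidx i = qvar ^ nat (pairing i i div 2)"

lemma cartan_values: "cartan J1 J2 = - 1" "cartan J2 J1 = - 2"
  by (simp_all add: cartan_def)

lemma qidx_values: "qidx J1 = qvar ^ 2" "qidx J2 = qvar"
  by (simp_all add: qidx_def)

text \<open>The monoid of words, written additively so that its monoid algebra is an instance
  of the library's convolution ring of finitely supported functions.\<close>

datatype word = Word "idx list"

instantiation word :: monoid_add
begin

definition zero_word :: word where
  "0 = Word []"

fun plus_word :: "word \<Rightarrow> word \<Rightarrow> word" where
  "Word u + Word v = Word (u @ v)"

instance
proof
  fix a b c :: word
  show "a + b + c = a + (b + c)" by (cases a; cases b; cases c) simp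
  show "0 + a = a" by (cases a) (simp add: zero_word_def)
  show "a + 0 = a" by (cases a) (simp add: zero_word_def)
qed

end

type_synonym free_alg = "word \<Rightarrow>\<^sub>0 ratfun"

definition fscale :: "ratfun \<Rightarrow> free_alg \<Rightarrow> free_alg" where
  "fscale c x = Poly_Mapping.single 0 c * x"

definition fgen :: "idx \<Rightarrow> free_alg" where
  "fgen i = Poly_Mapping.single (Word [i]) 1"

definition fgen_dp :: "idx \<Rightarrow> nat \<Rightarrow> free_alg" where
  "fgen_dp i n = fscale (inverse (qfact (qidx i) n)) (fgen i ^ n)"

definition serre :: "idx \<Rightarrow> idx \<Rightarrow> free_alg" where
  "serre i j =
    (let n = nat (1 - cartan i j)
     in \<Sum>k\<le>n. (- 1) ^ k * fgen_dp i k * fgen j * fgen_dp i (n - k))"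

inductive_set serre_ideal :: "free_alg set" where
  zero: "0 \<in> serre_ideal"
| rel: "i \<noteq> j \<Longrightarrow> a * serre i j * b \<in> serre_ideal"
| add: "x \<in> serre_ideal \<Longrightarrow> y \<in> serre_ideal \<Longrightarrow> x + y \<in> serre_ideal"

lemma serre_ideal_mult:
  assumes "x \<in> serre_ideal"
  shows "a * x * b \<in> serre_ideal"
  using assms
proof induction
  case zero
  then show ?case by (simp add: serre_ideal.zero)
next
  case (rel i j c d)
  have "a * (c * serre i j * d) * b = (a * c) * serre i j * (d * b)"
    by (simp add: mult.assoc)
  then show ?case using serre_ideal.rel[OF rel] by simp
next
  case (add x y)
  then show ?case by (simp add: distrib_left distrib_right serre_ideal.add)
qed

lemma serre_ideal_left: "x \<in> serre_ideal \<Longrightarrow> a * x \<in> serre_ideal"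
  using serre_ideal_mult[of x a 1] by simp

lemma serre_ideal_right: "x \<in> serre_ideal \<Longrightarrow> x * b \<in> serre_ideal"
  using serre_ideal_mult[of x 1 b] by simp

lemma serre_ideal_uminus: "x \<in> serre_ideal \<Longrightarrow> - x \<in> serre_ideal"
  using serre_ideal_left[of x "- 1"] by simp

lemma serre_ideal_diff: "x \<in> serre_ideal \<Longrightarrow> y \<in> serre_ideal \<Longrightarrow> x - y \<in> serre_ideal"
  using serre_ideal.add[of x "- y"] serre_ideal_uminus[of y] by simp

lemma lookup_mult_zero_word:
  fixes a b :: free_alg
  shows "Poly_Mapping.lookup (a * b) 0 = Poly_Mapping.lookup a 0 * Poly_Mapping.lookup b 0"
proof -
  have plus0: "(l + m = 0) = (l = 0 \<and> m = 0)" for l m :: word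
    by (cases l; cases m) (auto simp: zero_word_def)
  have inner: "(\<Sum>m. Poly_Mapping.lookup b m when l + m = 0)
      = (Poly_Mapping.lookup b 0 when l = 0)" for l
    by (cases "l = 0") (simp_all add: plus0)
  have "Poly_Mapping.lookup (a * b) 0
      = (\<Sum>l. (Poly_Mapping.lookup a l * Poly_Mapping.lookup b 0 when l = 0))"
    by (simp add: lookup_mult eq_commute[of 0] inner mult_when)
  then show ?thesis by simp
qed

lemma serre_ideal_lookup: "x \<in> serre_ideal \<Longrightarrow> Poly_Mapping.lookup x 0 = 0"
proof (induction rule: serre_ideal.induct)
  case (rel i j a b)
  have "Poly_Mapping.lookup (serre i j) 0 = 0"
    by (simp add: serre_def Let_def Poly_Mapping.lookup_sum lookup_mult_zero_word fgen_def)
      (simp add: lookup_single zero_word_def)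
  then show ?case by (simp add: lookup_mult_zero_word)
qed (simp_all add: lookup_add)

definition serre_eq :: "free_alg \<Rightarrow> free_alg \<Rightarrow> bool" where
  "serre_eq x y \<longleftrightarrow> x - y \<in> serre_ideal"

lemma serre_eq_equivp: "equivp serre_eq"
proof (rule equivpI)
  show "reflp serre_eq"
    by (simp add: reflp_def serre_eq_def serre_ideal.zero)
  show "symp serre_eq"
    unfolding symp_def serre_eq_def using serre_ideal_uminus by (metis minus_diff_eq)
  show "transp serre_eq"
  proof (rule transpI)
    fix x y z
    assume "serre_eq x y" "serre_eq y z"
    then have "(x - y) + (y - z) \<in> serre_ideal"
      unfolding serre_eq_def by (rule serre_ideal.add)
    then show "serre_eq x z" by (simp add: serre_eq_def)
  qed
qed

quotient_type uq = free_alg / serre_eq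
  by (rule serre_eq_equivp)

instantiation uq :: ring_1
begin

lift_definition zero_uq :: uq is 0 .
lift_definition one_uq :: uq is 1 .

lift_definition plus_uq :: "uq \<Rightarrow> uq \<Rightarrow> uq" is "(+)"
  unfolding serre_eq_def by (simp only: add_diff_add serre_ideal.add)

lift_definition minus_uq :: "uq \<Rightarrow> uq \<Rightarrow> uq" is "(-)"
proof -
  fix a b c d :: free_alg
  assume "serre_eq a b" "serre_eq c d"
  moreover have "(a - c) - (b - d) = (a - b) - (c - d)"
    by (simp add: algebra_simps)
  ultimately show "serre_eq (a - c) (b - d)"
    unfolding serre_eq_def by (simp only: serre_ideal_diff)
qed

lift_definition uminus_uq :: "uq \<Rightarrow> uq" is uminus
  unfolding serre_eq_def by (simp only: minus_diff_minus serre_ideal_uminus)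

lift_definition times_uq :: "uq \<Rightarrow> uq \<Rightarrow> uq" is "(*)"
proof -
  fix a b c d :: free_alg
  assume "serre_eq a b" "serre_eq c d"
  moreover have "a * c - b * d = (a - b) * c + b * (c - d)"
    by (simp add: algebra_simps)
  ultimately show "serre_eq (a * c) (b * d)"
    unfolding serre_eq_def
    by (simp add: serre_ideal.add serre_ideal_left serre_ideal_right)
qed

instance
proof
  fix a b c :: uq
  have refl: "serre_eq x x" for x
    by (simp add: serre_eq_def serre_ideal.zero)
  show "a * b * c = a * (b * c)" by transfer (simp only: mult.assoc refl)
  show "1 * a = a" by transfer (simp only: mult_1_left refl)
  show "a * 1 = a" by transfer (simp only: mult_1_right refl)
  show "a + b + c = a + (b + c)" by transfer (simp only: add.assoc refl)
  show "a + b = b + a" by transfer (simp only: add.commute refl)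
  show "0 + a = a" by transfer (simp only: add_0_left refl)
  show "- a + a = 0" by transfer (simp only: left_minus refl)
  show "a - b = a + - b" by transfer (simp only: diff_conv_add_uminus refl)
  show "(a + b) * c = a * c + b * c" by transfer (simp only: distrib_right refl)
  show "a * (b + c) = a * b + a * c" by transfer (simp only: distrib_left refl)
  show "(0 :: uq) \<noteq> 1"
  proof
    assume "(0 :: uq) = 1"
    then have "0 - 1 \<in> serre_ideal" by transfer (simp only: serre_eq_def)
    from serre_ideal_lookup[OF this] show False
      by (simp add: lookup_minus lookup_one)
  qed
qed

end

lift_definition qscale :: "ratfun \<Rightarrow> uq \<Rightarrow> uq"  (infixr \<open>*\<^sub>q\<close> 75) is fscale
  unfolding serre_eq_def fscale_def
  by (simp add: serre_ideal_left flip: right_diff_distrib)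

lift_definition gen :: "idx \<Rightarrow> uq" is fgen .

definition divpow :: "idx \<Rightarrow> uq \<Rightarrow> nat \<Rightarrow> uq" where
  "divpow i x n = inverse (qfact (qidx i) n) *\<^sub>q x ^ n"

text \<open>Type $B_2$: \<open>J1\<close> is the long simple root, \<open>J2\<close> the short one.  For a reduced sequence
  $(j_1,\dots,j_4)$ the $k$-th root vector is $T_{j_1}\cdots T_{j_{k-1}}(f_{j_k})$ for Lusztig's
  $T_i = T''_{i,1}$, and its divided powers use $q_{j_k}$.  The explicit values are
  $f_1, f_{12}, f_{122}, f_2$ for $(1,2,1,2)$ and $f_2, f'_{122}, f'_{12}, f_1$ for $(2,1,2,1)$.\<close>

abbreviation f1 :: uq where "f1 \<equiv> gen J1"
abbreviation f2 :: uq where "f2 \<equiv> gen J2"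

definition f12 :: uq where
  "f12 = f2 * f1 - qvar ^ 2 *\<^sub>q (f1 * f2)"

definition f122 :: uq where
  "f122 = divpow J2 f2 2 * f1 - qvar *\<^sub>q (f2 * f1 * f2) + qvar ^ 2 *\<^sub>q (f1 * divpow J2 f2 2)"

definition f122' :: uq where
  "f122' = f1 * divpow J2 f2 2 - qvar *\<^sub>q (f2 * f1 * f2) + qvar ^ 2 *\<^sub>q (divpow J2 f2 2 * f1)"

definition f12' :: uq where
  "f12' = f1 * f2 - qvar ^ 2 *\<^sub>q (f2 * f1)"

type_synonym exponent = "nat \<times> nat \<times> nat \<times> nat"

fun L_h :: "exponent \<Rightarrow> uq" where
  "L_h (a, b, c, d) = divpow J1 f1 a * divpow J2 f12 b * divpow J1 f122 c * divpow J2 f2 d"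

fun L_h' :: "exponent \<Rightarrow> uq" where
  "L_h' (a, b, c, d) = divpow J2 f2 a * divpow J1 f122' b * divpow J2 f12' c * divpow J1 f1 d"

definition is_bar :: "(uq \<Rightarrow> uq) \<Rightarrow> bool" where
  "is_bar \<phi> \<longleftrightarrow>
     bij \<phi> \<and>
     (\<forall>x y. \<phi> (x + y) = \<phi> x + \<phi> y) \<and>
     (\<forall>x y. \<phi> (x * y) = \<phi> x * \<phi> y) \<and>
     \<phi> 1 = 1 \<and>
     (\<forall>r :: rat. \<forall>x. \<phi> (to_fract [:r:] *\<^sub>q x) = to_fract [:r:] *\<^sub>q \<phi> x) \<and>
     \<phi> (qvar *\<^sub>q 1) = inverse qvar *\<^sub>q 1 \<and>
     (\<forall>i. \<phi> (gen i) = gen i)"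

definition bar :: "uq \<Rightarrow> uq" where
  "bar = (THE \<phi>. is_bar \<phi>)"

definition exponent_less :: "exponent \<Rightarrow> exponent \<Rightarrow> bool"  (infix \<open>\<prec>\<close> 50) where
  "c \<prec> c' \<longleftrightarrow>
     (c, c') \<in> less_than <*lex*> less_than <*lex*> less_than <*lex*> less_than"

definition is_canonical :: "(exponent \<Rightarrow> uq) \<Rightarrow> exponent \<Rightarrow> uq \<Rightarrow> bool" where
  "is_canonical L c b \<longleftrightarrow>
     bar b = b \<and>
     (\<exists>p :: exponent \<Rightarrow> ratfun.
        (\<forall>c'. c \<prec> c' \<longrightarrow> p c' \<in> qZq) \<and>
        finite {c'. c \<prec> c' \<and> p c' \<noteq> 0} \<and>
        b = L c + (\<Sum>c' | c \<prec> c' \<and> p c' \<noteq> 0. p c' *\<^sub>q L c'))"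

definition canonical :: "(exponent \<Rightarrow> uq) \<Rightarrow> exponent \<Rightarrow> uq" where
  "canonical L c = (THE b. is_canonical L c b)"

definition B_h :: "uq set" where
  "B_h = {canonical L_h c | c. True}"

definition B_h' :: "uq set" where
  "B_h' = {canonical L_h' c | c. True}"

end

theory Submission
  imports Defs
begin

text \<open>The reversal \<open>star\<close>, the antiautomorphism fixing \<open>f1\<close> and \<open>f2\<close>, sends \<open>L_h (a, b, c, d)\<close> to
  \<open>L_h' (d, c, b, a)\<close>. The bar-invariant monomials in divided powers
  \<open>f1^(a) f2^(b + 2c) f1^(b + c) f2^(d)\<close> are unitriangular over the PBW basis \<open>L_h\<close> simultaneously for the
  lexicographic order and for the one reading the exponents backwards. Hence one bar-invariant basis is
  triangular for both orders, and \<open>B_h'\<close> is the image of \<open>B_h\<close> under \<open>star\<close>. It remains to show that \<open>star\<close>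
  permutes \<open>B_h\<close>, and for this that it permutes the PBW basis modulo \<open>q\<close>.

  There is a bilinear form, invariant under \<open>star\<close>, for which the PBW basis is orthogonal with norms that
  are \<open>1\<close> at \<open>q = 0\<close>. As \<open>star\<close> also preserves the integral form, the coefficients of
  \<open>star (L_h c)\<close> are integral polynomials in \<open>q\<close> whose values at \<open>0\<close> have square sum \<open>1\<close>: modulo \<open>q\<close>, \<open>star\<close>
  permutes the PBW basis up to signs.

  The signs are \<open>1\<close> by positivity. Left multiplication by \<open>f2\<close> has positive coefficients in the PBW basis, and
  comparing the lowest-order terms of \<open>f2 * L_h c\<close> and of its reversal shows that the sign does not
  depend on the last exponent. This reduces to the basis elements \<open>L_h (a, 0, c, 0)\<close> with \<open>c \<le> a\<close>, where
  a monomial in the generators with a suitable lowest-order term decides.\<close>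

subsection \<open>Scalars\<close>

text \<open>No braid group action is constructed, so neither the independence of the PBW vectors nor
  their orthogonality can be inherited from it. Instead the left regular representation is written
  down by explicit formulas on functions of exponents; the Serre relations are checked there, and
  applying an element to the unit vector at the zero exponent yields its coordinates. The adjoint
  operators \<open>E\<close> satisfy the twisted commutation relations of Kashiwara's q-bosons,
  which makes them skew derivations of the algebra. Invariance of the form under \<open>star\<close>
  then comes down to the fact that these derivations commute with their mirror images.

  The norms are rational functions, regular at 0 but not polynomial; this is why values at 0 are
  needed beyond polynomials. The form sees squares only, hence the signs left open by it. The
  permutation of indices induced by \<open>star\<close> is never computed: it suffices that it is a
  weight-preserving involution and that \<open>depth c\<close> is the last exponent of the image of
  \<open>c\<close>.\<close>

abbreviation q :: ratfun where "q \<equiv> qvar"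

lemma q_power: "q ^ n = to_fract (monom 1 n)"
proof (induction n)
  case 0 then show ?case by (simp add: monom_0 flip: one_pCons)
next
  case (Suc n)
  have "q ^ Suc n = to_fract ([:0,1:] * monom 1 n)"
    by (simp only: power_Suc Suc to_fract_mult qvar_def[symmetric])
  also have "[:0,1:] * monom 1 n = (monom 1 (Suc n) :: rat poly)"
    by (simp add: monom_Suc)
  finally show ?case .
qed

lemma q_neq0 [simp]: "q \<noteq> 0"
  by (simp add: qvar_def)

lemma q_power_eq_iff: "q ^ m = q ^ n \<longleftrightarrow> m = n"
  unfolding q_power to_fract_eq_iff by (simp add: monom_eq_iff')

lemma q_power_eq_1 [simp]: "q ^ n = 1 \<longleftrightarrow> n = 0"
  using q_power_eq_iff[of n 0] by simp

lemma q_diff [simp]: "q - inverse q \<noteq> 0" "q^2 - inverse (q^2) \<noteq> 0"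
proof -
  have "q^2 \<noteq> 1" "q^4 \<noteq> 1" by simp_all
  then show "q - inverse q \<noteq> 0" "q^2 - inverse (q^2) \<noteq> 0"
    by (auto simp: field_simps power2_eq_square power4_eq_xxxx)
qed

section \<open>Polynomials in \<open>q\<close> with integer coefficients\<close>

definition zq :: "int poly \<Rightarrow> ratfun" where
  "zq r = to_fract (map_poly rat_of_int r)"

lemma zq_add: "zq (r + s) = zq r + zq s"
  by (simp add: zq_def flip: to_fract_add)
    (rule poly_eqI, simp add: coeff_map_poly)

lemma zq_minus: "zq (- r) = - zq r"
  by (simp add: zq_def flip: to_fract_uminus)
    (rule poly_eqI, simp add: coeff_map_poly)

lemma zq_mult: "zq (r * s) = zq r * zq s"
  by (simp add: zq_def flip: to_fract_mult)
    (rule poly_eqI, simp add: coeff_map_poly coeff_mult)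

lemma zq_0 [simp]: "zq 0 = 0"
  by (simp add: zq_def)

lemma zq_1 [simp]: "zq 1 = 1"
  by (simp add: zq_def map_poly_1 one_pCons[symmetric])

lemma zq_monom: "zq (monom 1 n) = q ^ n"
  by (simp add: zq_def q_power map_poly_monom)

lemma zq_X: "zq [:0, 1:] = q"
  using zq_monom[of 1] by (simp add: monom_Suc monom_0)

definition Zq :: "ratfun set" where
  "Zq = range zq"

lemma ZqI [simp, intro]: "zq r \<in> Zq" by (simp add: Zq_def)

lemma Zq_add [intro]: "x \<in> Zq \<Longrightarrow> y \<in> Zq \<Longrightarrow> x + y \<in> Zq"
  unfolding Zq_def by (metis (no_types, lifting) image_iff rangeI zq_add)

lemma Zq_mult [intro]: "x \<in> Zq \<Longrightarrow> y \<in> Zq \<Longrightarrow> x * y \<in> Zq"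
  unfolding Zq_def by (metis (no_types, lifting) image_iff rangeI zq_mult)

lemma Zq_uminus [intro]: "x \<in> Zq \<Longrightarrow> - x \<in> Zq"
  unfolding Zq_def by (metis (no_types, lifting) image_iff rangeI zq_minus)

lemma Zq_0 [simp]: "0 \<in> Zq" using ZqI[of 0] by simp
lemma Zq_1 [simp]: "1 \<in> Zq" using ZqI[of 1] by simp
lemma Zq_q [simp]: "q \<in> Zq" using ZqI[of "[:0,1:]"] by (simp add: zq_X)

lemma Zq_power [intro]: "x \<in> Zq \<Longrightarrow> x ^ n \<in> Zq"
  by (induction n) auto

lemma Zq_of_nat [simp]: "of_nat n \<in> Zq"
  by (induction n) auto

lemma Zq_of_int [simp]: "of_int n \<in> Zq"
  by (cases n) (auto simp del: of_nat_Suc)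

lemma Zq_sum [intro]: "(\<And>i. i \<in> A \<Longrightarrow> f i \<in> Zq) \<Longrightarrow> sum f A \<in> Zq"
  by (induction A rule: infinite_finite_induct) auto

lemma qZq_iff: "x \<in> qZq \<longleftrightarrow> (\<exists>y\<in>Zq. x = q * y)"
  by (auto simp: qZq_def Zq_def zq_def)

lemma qZq_Zq: "x \<in> qZq \<Longrightarrow> x \<in> Zq" by (auto simp: qZq_iff)

lemma qZq_0 [simp]: "0 \<in> qZq" by (auto simp: qZq_iff intro!: bexI[of _ 0])

lemma qZq_add [intro]: "x \<in> qZq \<Longrightarrow> y \<in> qZq \<Longrightarrow> x + y \<in> qZq"
  by (auto simp: qZq_iff simp flip: distrib_left)

lemma qZq_uminus [intro]: "x \<in> qZq \<Longrightarrow> - x \<in> qZq"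
  by (auto simp: qZq_iff simp flip: mult_minus_right)

lemma qZq_diff [intro]: "x \<in> qZq \<Longrightarrow> y \<in> qZq \<Longrightarrow> x - y \<in> qZq"
  using qZq_add[of x "- y"] by auto

lemma qZq_mult_left [intro]: "x \<in> Zq \<Longrightarrow> y \<in> qZq \<Longrightarrow> x * y \<in> qZq"
  by (auto simp: qZq_iff mult.left_commute)

lemma qZq_mult_right [intro]: "x \<in> qZq \<Longrightarrow> y \<in> Zq \<Longrightarrow> x * y \<in> qZq"
  using qZq_mult_left[of y x] by (simp add: mult.commute)

lemma qZq_sum [intro]: "(\<And>i. i \<in> A \<Longrightarrow> f i \<in> qZq) \<Longrightarrow> sum f A \<in> qZq"
  by (induction A rule: infinite_finite_induct) auto

lemma qZq_power: "n > 0 \<Longrightarrow> q ^ n \<in> qZq"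
  by (cases n) (auto simp: qZq_iff)

text \<open>Evaluation at \<open>q = 0\<close> on the local ring of rational functions regular
  there, kept as a relation because it is partial. Polynomials would not suffice: the norms of the
  PBW vectors have denominators \<open>1 - q ^ n\<close>.\<close>

definition value0 :: "ratfun \<Rightarrow> rat \<Rightarrow> bool" where
  "value0 x v \<longleftrightarrow> (\<exists>p r. x = to_fract p / to_fract r \<and> coeff r 0 \<noteq> 0 \<and> v = coeff p 0 / coeff r 0)"

lemma regE:
  assumes "value0 x v"
  obtains p r where "x = to_fract p / to_fract r" "coeff r 0 \<noteq> 0" "v = coeff p 0 / coeff r 0" "r \<noteq> 0"
  using assms unfolding value0_def by (metis coeff_0)

lemma value0_unique: assumes "value0 x v" "value0 x w" shows "v = w"
proof -
  from assms obtain p r p' r' where *: "x = to_fract p / to_fract r" "coeff r 0 \<noteq> 0" "v = coeff p 0 / coeff r 0"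
    "x = to_fract p' / to_fract r'" "coeff r' 0 \<noteq> 0" "w = coeff p' 0 / coeff r' 0"
    by (elim regE)
  then have nz: "r \<noteq> 0" "r' \<noteq> 0" by auto
  with *(1,4) have "to_fract p * to_fract r' = to_fract p' * to_fract r"
    by (simp add: field_simps)
  then have "p * r' = p' * r" by (simp flip: to_fract_mult)
  then have "coeff p 0 * coeff r' 0 = coeff p' 0 * coeff r 0" by (metis coeff_mult_0)
  then show ?thesis using * by (simp add: frac_eq_eq)
qed

lemma value0_add: assumes "value0 x v" "value0 y w" shows "value0 (x + y) (v + w)"
proof -
  from assms obtain p r p' r' where *: "x = to_fract p / to_fract r" "coeff r 0 \<noteq> 0" "v = coeff p 0 / coeff r 0"
    "y = to_fract p' / to_fract r'" "coeff r' 0 \<noteq> 0" "w = coeff p' 0 / coeff r' 0"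
    by (elim regE)
  then have nz: "r \<noteq> 0" "r' \<noteq> 0" by auto
  have "x + y = to_fract (p * r' + p' * r) / to_fract (r * r')"
    using nz * by (simp add: field_simps)
  moreover have "v + w = coeff (p * r' + p' * r) 0 / coeff (r * r') 0"
    using * by (simp add: add_frac_eq coeff_mult_0 mult.commute)
  moreover have "coeff (r * r') 0 \<noteq> 0" using * by (simp add: coeff_mult_0)
  ultimately show ?thesis unfolding value0_def by blast
qed

lemma value0_mult: assumes "value0 x v" "value0 y w" shows "value0 (x * y) (v * w)"
proof -
  from assms obtain p r p' r' where *: "x = to_fract p / to_fract r" "coeff r 0 \<noteq> 0" "v = coeff p 0 / coeff r 0"
    "y = to_fract p' / to_fract r'" "coeff r' 0 \<noteq> 0" "w = coeff p' 0 / coeff r' 0"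
    by (elim regE)
  have "x * y = to_fract (p * p') / to_fract (r * r')"
    using * by simp
  moreover have "v * w = coeff (p * p') 0 / coeff (r * r') 0"
    using * by (simp add: coeff_mult_0)
  moreover have "coeff (r * r') 0 \<noteq> 0" using * by (simp add: coeff_mult_0)
  ultimately show ?thesis unfolding value0_def by blast
qed

lemma value0_divide: assumes "value0 x v" "value0 y w" "w \<noteq> 0" shows "value0 (x / y) (v / w)"
proof -
  from assms obtain p r p' r' where *: "x = to_fract p / to_fract r" "coeff r 0 \<noteq> 0" "v = coeff p 0 / coeff r 0"
    "y = to_fract p' / to_fract r'" "coeff r' 0 \<noteq> 0" "w = coeff p' 0 / coeff r' 0"
    by (elim regE)
  then have nz: "r \<noteq> 0" "r' \<noteq> 0" by auto
  have "x / y = to_fract (p * r') / to_fract (r * p')"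
    using * by simp
  moreover have "v / w = coeff (p * r') 0 / coeff (r * p') 0"
    using * by (simp add: coeff_mult_0)
  moreover have "coeff (r * p') 0 \<noteq> 0" using * assms(3) by (simp add: coeff_mult_0)
  ultimately show ?thesis unfolding value0_def by blast
qed

lemma value0_zq: "value0 (zq r) (of_int (coeff r 0))"
  unfolding value0_def
  by (rule exI[of _ "map_poly rat_of_int r"], rule exI[of _ 1]) (simp add: zq_def coeff_map_poly)

lemma value0_0 [simp]: "value0 0 0" using value0_zq[of 0] by simp
lemma value0_1 [simp]: "value0 1 1" using value0_zq[of 1] by simp
lemma value0_q [simp]: "value0 q 0" using value0_zq[of "[:0,1:]"] by (simp add: zq_X)
lemma value0_power: "value0 x v \<Longrightarrow> value0 (x ^ n) (v ^ n)"
  by (induction n) (auto intro: value0_mult)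
lemma value0_minus: "value0 x v \<Longrightarrow> value0 (- x) (- v)"
  using value0_mult[of "- 1" "-1" x v] value0_zq[of "- 1"] by (simp add: zq_minus)
lemma value0_diff: "value0 x v \<Longrightarrow> value0 y w \<Longrightarrow> value0 (x - y) (v - w)"
  using value0_add[of x v "- y" "- w"] value0_minus[of y w] by simp
lemma value0_of_nat: "value0 (of_nat n) (of_nat n)"
  by (induction n) (auto intro: value0_add)
lemma value0_sum: "(\<And>i. i \<in> A \<Longrightarrow> value0 (f i) (g i)) \<Longrightarrow> value0 (sum f A) (sum g A)"
  by (induction A rule: infinite_finite_induct) (auto intro: value0_add)

lemma Zq_value0: assumes "x \<in> Zq" obtains n :: int where "value0 x (of_int n)" "x - of_int n \<in> qZq"
proof -
  from assms obtain r where r: "x = zq r" by (auto simp: Zq_def)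
  obtain c s where cs: "r = pCons c s" by (cases r)
  have rc: "r = [:c:] + [:0,1:] * s" by (simp add: cs)
  have "zq [:c:] = of_int c"
  proof -
    have n: "zq (of_nat n) = of_nat n" for n
      by (induction n) (simp_all add: zq_add)
    have "zq (of_int c) = of_int c"
      by (cases c rule: int_cases2) (simp_all add: n zq_minus)
    then show ?thesis by (simp add: of_int_poly)
  qed
  then have "x = of_int c + q * zq s" unfolding r rc by (simp only: zq_add zq_mult zq_X)
  then have "x - of_int c \<in> qZq" by (auto simp: qZq_iff)
  moreover have "value0 x (of_int c)" using value0_zq[of r] by (simp add: r cs)
  ultimately show ?thesis using that by blast
qed

lemma qZq_value0: assumes "x \<in> qZq" shows "value0 x 0"
proof -
  from assms obtain y where y: "y \<in> Zq" "x = q * y" by (auto simp: qZq_iff)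
  then obtain n :: int where "value0 y (of_int n)" by (auto elim: Zq_value0)
  from value0_mult[OF value0_q this] show ?thesis by (simp add: y)
qed

lemma Zq_value0_0: assumes "x \<in> Zq" "value0 x 0" shows "x \<in> qZq"
  using assms by (metis Zq_value0 diff_zero of_int_0 of_int_eq_0_iff value0_unique)

section \<open>Laurent polynomials in \<open>q\<close> with integer coefficients\<close>

definition Lq :: "ratfun set" where
  "Lq = {z / q ^ n | z n. z \<in> Zq}"

lemma Zq_Lq: "x \<in> Zq \<Longrightarrow> x \<in> Lq"
  unfolding Lq_def by (intro CollectI exI[of _ x] exI[of _ 0]) simp

lemma Lq_0 [simp]: "0 \<in> Lq" by (auto intro: Zq_Lq)
lemma Lq_1 [simp]: "1 \<in> Lq" by (auto intro: Zq_Lq)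
lemma Lq_q [simp]: "q \<in> Lq" by (auto intro: Zq_Lq)
lemma Lq_inverse_q [simp]: "inverse q \<in> Lq"
  unfolding Lq_def by (intro CollectI exI[of _ 1] exI[of _ "1::nat"]) (simp add: field_simps)

lemma Lq_mult [intro]: assumes "x \<in> Lq" "y \<in> Lq" shows "x * y \<in> Lq"
proof -
  from assms obtain a m b n where "a \<in> Zq" "b \<in> Zq" "x = a / q ^ m" "y = b / q ^ n" by (auto simp: Lq_def)
  then have "x * y = (a * b) / q ^ (m + n)" "a * b \<in> Zq" by (auto simp: power_add)
  then show ?thesis by (auto simp: Lq_def)
qed

lemma Lq_add [intro]: assumes "x \<in> Lq" "y \<in> Lq" shows "x + y \<in> Lq"
proof -
  from assms obtain a m b n where "a \<in> Zq" "b \<in> Zq" "x = a / q ^ m" "y = b / q ^ n" by (auto simp: Lq_def)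
  then have "x + y = (a * q ^ n + b * q ^ m) / q ^ (m + n)" "a * q ^ n + b * q ^ m \<in> Zq"
    by (simp_all add: power_add add_frac_eq Zq_add Zq_mult Zq_power)
  then show ?thesis by (auto simp: Lq_def)
qed

lemma Lq_uminus [intro]: "x \<in> Lq \<Longrightarrow> - x \<in> Lq"
  using Lq_mult[of "- 1" x] Zq_Lq[of "- 1"] by (simp add: Zq_uminus)

lemma Lq_diff [intro]: "x \<in> Lq \<Longrightarrow> y \<in> Lq \<Longrightarrow> x - y \<in> Lq"
  using Lq_add[of x "- y"] by auto

lemma Lq_power [intro]: "x \<in> Lq \<Longrightarrow> x ^ n \<in> Lq"
  by (induction n) auto

lemma Lq_divide_power [intro]: "x \<in> Lq \<Longrightarrow> x / q ^ n \<in> Lq"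
  using Lq_mult[of x "inverse q ^ n"] Lq_power[of "inverse q" n] by (simp add: divide_inverse power_inverse)

lemma Lq_sum [intro]: "(\<And>i. i \<in> A \<Longrightarrow> f i \<in> Lq) \<Longrightarrow> sum f A \<in> Lq"
  by (induction A rule: infinite_finite_induct) auto

lemma Lq_clear: assumes "finite A" "\<And>i. i \<in> A \<Longrightarrow> f i \<in> Lq"
  obtains n where "\<And>i. i \<in> A \<Longrightarrow> q ^ n * f i \<in> Zq"
proof -
  have "\<exists>n. \<forall>i\<in>A. q ^ n * f i \<in> Zq" using assms
  proof (induction A rule: finite_induct)
    case (insert a A)
    then obtain n where n: "\<forall>i\<in>A. q ^ n * f i \<in> Zq" by auto
    from insert.prems[of a] obtain z m where z: "z \<in> Zq" "f a = z / q ^ m" by (auto simp: Lq_def)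
    have "q ^ (n + m) * f a \<in> Zq" using z by (simp add: power_add Zq_mult Zq_power)
    moreover have "q ^ (n + m) * f i \<in> Zq" if "i \<in> A" for i
      using Zq_mult[OF Zq_power[OF Zq_q, of m], of "q ^ n * f i"] n that by (simp add: power_add mult_ac)
    ultimately show ?case by blast
  qed simp
  then show ?thesis using that by blast
qed

section \<open>The involution of the scalars that inverts \<open>q\<close>\<close>

definition scalar :: "rat \<Rightarrow> ratfun" where "scalar c = to_fract [:c:]"

lemma scalar_simps: "scalar 0 = 0" "scalar 1 = 1" "scalar (a + b) = scalar a + scalar b" "scalar (a * b) = scalar a * scalar b"
  by (simp_all add: scalar_def flip: one_pCons to_fract_add to_fract_mult)

definition evi :: "rat poly \<Rightarrow> ratfun" where
  "evi p = poly (map_poly scalar p) (inverse q)"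

lemma map_poly_scalar: "map_poly scalar (p + r) = map_poly scalar p + map_poly scalar r"
  "map_poly scalar (p * r) = map_poly scalar p * map_poly scalar r"
proof -
  have s: "scalar (sum f A) = (\<Sum>x\<in>A. scalar (f x))" for f :: "nat \<Rightarrow> rat" and A
    by (induction A rule: infinite_finite_induct) (simp_all add: scalar_simps)
  show "map_poly scalar (p + r) = map_poly scalar p + map_poly scalar r"
    "map_poly scalar (p * r) = map_poly scalar p * map_poly scalar r"
    by (rule poly_eqI, simp add: coeff_map_poly scalar_simps coeff_mult s)+
qed

lemma evi_add: "evi (p + r) = evi p + evi r" by (simp add: evi_def map_poly_scalar)
lemma evi_mult: "evi (p * r) = evi p * evi r" by (simp add: evi_def map_poly_scalar)

lemma evi_pCons: "evi (pCons c p) = scalar c + inverse q * evi p"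
  by (simp add: evi_def map_poly_pCons scalar_simps)

lemma evi_0 [simp]: "evi 0 = 0" by (simp add: evi_def)
lemma evi_1 [simp]: "evi 1 = 1" by (simp add: one_pCons evi_pCons scalar_simps)

lemma to_fract_pCons: "to_fract (pCons c p) = scalar c + q * to_fract p"
  by (simp add: scalar_def qvar_def flip: to_fract_mult to_fract_add)

text \<open>Clearing denominators turns the substitution of \<open>1 / q\<close> back into a
  polynomial. This yields injectivity of \<open>evi\<close>, so that it extends to fractions, and
  later a degree count.\<close>

lemma evi_reflect: "q ^ degree p * evi p = to_fract (reflect_poly p)"
proof -
  have e: "to_fract p = poly (map_poly scalar p) q" for p
    by (induction p) (simp_all add: to_fract_pCons map_poly_pCons scalar_simps)
  have kc0: "scalar c = 0 \<longleftrightarrow> c = 0" for c by (simp add: scalar_def)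
  have d: "degree (map_poly scalar p) = degree p"
    by (rule degree_map_poly) (simp add: kc0)
  have r: "reflect_poly (map_poly scalar p) = map_poly scalar (reflect_poly p)"
    by (rule poly_eqI) (simp add: coeff_reflect_poly coeff_map_poly scalar_simps d)
  show ?thesis
    unfolding e r[symmetric] by (simp add: poly_reflect_poly_nz evi_def d)
qed

lemma evi_eq_0 [simp]: "evi p = 0 \<longleftrightarrow> p = 0"
proof
  assume "evi p = 0"
  then have "to_fract (reflect_poly p) = 0" using evi_reflect[of p] by simp
  then show "p = 0" by simp
qed simp

lemma frac_cases: obtains p r where "r \<noteq> 0" "x = to_fract p / to_fract (r :: rat poly)"
  by (cases x) (auto simp: Fract_conv_to_fract)

definition barK :: "ratfun \<Rightarrow> ratfun" where
  "barK x = (SOME v. \<exists>p r. r \<noteq> 0 \<and> x = to_fract p / to_fract r \<and> v = evi p / evi r)"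

text \<open>Independence of the choice made in \<open>barK\<close>: cross-multiply two
  representations and apply the injective ring homomorphism \<open>evi\<close>.\<close>

lemma barK_frac: assumes "r \<noteq> 0" "x = to_fract p / to_fract r" shows "barK x = evi p / evi r"
proof -
  have "\<exists>v p r. r \<noteq> 0 \<and> x = to_fract p / to_fract r \<and> v = evi p / evi r" using assms by blast
  from someI_ex[OF this] obtain a b where ab: "b \<noteq> 0" "x = to_fract a / to_fract b" "barK x = evi a / evi b"
    by (auto simp: barK_def)
  then have "to_fract a * to_fract r = to_fract p * to_fract b"
    using assms by (simp add: field_simps)
  then have "a * r = p * b" by (simp flip: to_fract_mult)
  then have "evi a * evi r = evi p * evi b" by (simp flip: evi_mult)
  then show ?thesis using ab(1,3) assms(1) by (simp add: frac_eq_eq)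
qed

lemma barK_add: "barK (x + y) = barK x + barK y"
proof -
  obtain a b where ab: "b \<noteq> 0" "x = to_fract a / to_fract b" by (rule frac_cases)
  obtain c d where cd: "d \<noteq> 0" "y = to_fract c / to_fract d" by (rule frac_cases)
  have "barK (x + y) = evi (a * d + c * b) / evi (b * d)"
    by (rule barK_frac) (use ab cd in \<open>simp_all add: field_simps\<close>)
  then show ?thesis using ab(1) cd(1) by (simp add: barK_frac[OF ab] barK_frac[OF cd] evi_add evi_mult add_frac_eq)
qed

lemma barK_mult: "barK (x * y) = barK x * barK y"
proof -
  obtain a b where ab: "b \<noteq> 0" "x = to_fract a / to_fract b" by (rule frac_cases)
  obtain c d where cd: "d \<noteq> 0" "y = to_fract c / to_fract d" by (rule frac_cases)
  have "barK (x * y) = evi (a * c) / evi (b * d)"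
    by (rule barK_frac) (use ab cd in \<open>simp_all add: field_simps\<close>)
  then show ?thesis by (simp add: barK_frac[OF ab] barK_frac[OF cd] evi_mult)
qed

lemma barK_to_fract: "barK (to_fract p) = evi p"
  using barK_frac[of 1 "to_fract p" p] by simp

lemma barK_0 [simp]: "barK 0 = 0" using barK_to_fract[of 0] by simp
lemma barK_1 [simp]: "barK 1 = 1" using barK_to_fract[of 1] by simp
lemma barK_scalar [simp]: "barK (scalar c) = scalar c"
  using barK_to_fract[of "[:c:]"] by (simp add: scalar_def[symmetric] evi_pCons)
lemma barK_q [simp]: "barK q = inverse q"
  using barK_to_fract[of "[:0,1:]"] by (simp add: qvar_def[symmetric] evi_pCons scalar_simps)
lemma barK_minus: "barK (- x) = - barK x"
  using barK_add[of x "- x"] by (simp add: eq_neg_iff_add_eq_0 add.commute)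
lemma barK_diff: "barK (x - y) = barK x - barK y"
  using barK_add[of x "- y"] by (simp add: barK_minus)
lemma barK_power: "barK (x ^ n) = barK x ^ n"
  by (induction n) (simp_all add: barK_mult)
lemma barK_inverse: "barK (inverse x) = inverse (barK x)"
  using barK_mult[of x "inverse x"] by (cases "x = 0") (simp_all add: inverse_unique)
lemma barK_divide: "barK (x / y) = barK x / barK y"
  by (simp add: divide_inverse barK_mult barK_inverse)
lemma barK_of_nat [simp]: "barK (of_nat n) = of_nat n"
  by (induction n) (simp_all add: barK_add)
lemma barK_of_int [simp]: "barK (of_int n) = of_int n"
  by (cases n) (simp_all add: barK_minus barK_diff)

lemma barK_barK [simp]: "barK (barK x) = x"
proof -
  have e: "barK (evi p) = to_fract p" for p
    by (induction p) (simp_all add: evi_pCons to_fract_pCons barK_add barK_mult barK_inverse)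
  obtain a b where ab: "b \<noteq> 0" "x = to_fract a / to_fract b" by (rule frac_cases)
  show ?thesis by (simp add: ab(2) barK_divide barK_to_fract e)
qed

text \<open>A degree count. For \<open>x = q * p\<close>, invariance and clearing of denominators
  equate the reversed polynomial of \<open>p\<close>, of degree at most \<open>degree p\<close>,
  with \<open>q ^ (degree p + 2) * p\<close>, of degree \<open>2 * degree p + 2\<close>.\<close>

lemma barK_eq_self_qZq: assumes "x \<in> qZq" "barK x = x" shows "x = 0"
proof (rule ccontr)
  assume nz: "x \<noteq> 0"
  obtain y where y: "y \<in> Zq" "x = q * y" using assms by (auto simp: qZq_iff)
  obtain r where r: "y = zq r" using y by (auto simp: Zq_def)
  let ?p = "map_poly rat_of_int r"
  have yp: "y = to_fract ?p" by (simp add: r zq_def)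
  have "?p \<noteq> 0" using nz y yp by auto
  have "inverse q * evi ?p = q * to_fract ?p"
    using assms(2) by (simp add: y(2) barK_mult yp barK_to_fract)
  then have "q ^ degree ?p * (inverse q * evi ?p) = q ^ degree ?p * (q * to_fract ?p)" by simp
  then have "inverse q * to_fract (reflect_poly ?p) = q ^ (degree ?p + 1) * to_fract ?p"
    unfolding evi_reflect[symmetric] by (simp add: mult_ac)
  then have "to_fract (reflect_poly ?p) = q ^ (degree ?p + 2) * to_fract ?p"
    by (simp add: field_simps)
  then have "reflect_poly ?p = monom 1 (degree ?p + 2) * ?p"
    by (simp only: q_power to_fract_eq_iff flip: to_fract_mult)
  then have "degree (reflect_poly ?p) = degree ?p + 2 + degree ?p"
    using \<open>?p \<noteq> 0\<close> by (simp add: degree_mult_eq degree_monom_eq)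
  then show False using degree_reflect_poly_le[of ?p] by simp
qed

text \<open>Induction on the pole order: a leading term \<open>k / q ^ n\<close> with
  \<open>n > 0\<close> is removed by the invariant element \<open>k * (q ^ n + 1 / q ^ n)\<close>,
  whose other half already lies in \<open>qZq\<close>.\<close>

lemma Lq_split: assumes "x \<in> Lq" obtains g where "g \<in> Lq" "barK g = g" "x - g \<in> qZq"
proof -
  have "\<exists>g\<in>Lq. barK g = g \<and> z / q ^ n - g \<in> qZq" if "z \<in> Zq" for z n
    using that
  proof (induction n arbitrary: z)
    case 0
    then obtain k :: int where "z - of_int k \<in> qZq" by (auto elim: Zq_value0)
    then show ?case by (auto intro!: bexI[of _ "of_int k"] Zq_Lq)
  next
    case (Suc n)
    then obtain k :: int where k: "z - of_int k \<in> qZq" by (auto elim: Zq_value0)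
    then obtain y where y: "y \<in> Zq" "z = of_int k + q * y" by (auto simp: qZq_iff diff_eq_eq add.commute)
    from Suc.IH[OF y(1)] obtain g where g: "g \<in> Lq" "barK g = g" "y / q ^ n - g \<in> qZq" by blast
    let ?h = "g + of_int k * (q ^ Suc n + inverse q ^ Suc n)"
    have "?h \<in> Lq" using g by (intro Lq_add Lq_mult Lq_power) (auto intro: Zq_Lq)
    moreover have "barK ?h = ?h"
      by (simp only: barK_add barK_mult barK_power barK_of_int barK_q barK_inverse g(2))
        (simp add: add.commute)
    moreover have "z / q ^ Suc n - ?h = (y / q ^ n - g) - of_int k * q ^ Suc n"
      by (simp add: y field_simps)
    moreover have "(y / q ^ n - g) - of_int k * q ^ Suc n \<in> qZq"
      by (intro qZq_diff g qZq_mult_left qZq_power) auto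
    ultimately show ?case by metis
  qed
  then show ?thesis using assms that unfolding Lq_def by blast
qed

lemma Lq_bar: assumes "x \<in> Lq" shows "barK x \<in> Lq"
proof -
  have "barK (zq r) \<in> Lq" for r
  proof -
    have "evi (map_poly rat_of_int s) \<in> Lq" for s
    proof (induction s)
      case (pCons c s)
      have n: "scalar (of_nat n) = of_nat n" for n
        by (induction n) (simp_all add: scalar_simps)
      have m: "scalar (- r) = - scalar r" for r
        using scalar_simps(3)[of r "- r"] by (simp add: scalar_simps eq_neg_iff_add_eq_0 add.commute)
      have "scalar (of_int c) = of_int c"
        by (cases c rule: int_cases2) (simp_all add: n m)
      then show ?case using pCons by (simp add: map_poly_pCons evi_pCons Lq_add Lq_mult Zq_Lq)
    qed simp
    then show ?thesis by (simp add: zq_def barK_to_fract)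
  qed
  then have b: "barK z \<in> Lq" if "z \<in> Zq" for z using that by (auto simp: Zq_def)
  obtain z n where z: "z \<in> Zq" "x = z / q ^ n" using assms by (auto simp: Lq_def)
  have "barK x = barK z * q ^ n" unfolding z(2) barK_divide barK_power barK_q power_inverse by (simp add: divide_inverse)
  then show ?thesis using b[OF z(1)] by (simp add: Lq_mult Lq_power)
qed

subsection \<open>The algebra, its bar involution and its reversal\<close>

lemma serre_eq_refl [simp]: "serre_eq x x"
  by (simp add: serre_eq_def serre_ideal.zero)

lemma free_induct [case_names single add]:
  assumes "\<And>w c. P (Poly_Mapping.single w c)"
    and "\<And>x y. P x \<Longrightarrow> P y \<Longrightarrow> P (x + y)"
  shows "P (x :: 'a \<Rightarrow>\<^sub>0 'b :: comm_monoid_add)"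
proof (induction x rule: update_induct)
  case const
  then show ?case using assms(1)[of _ 0] by simp
next
  case (update f a b)
  have "Poly_Mapping.update a b f = Poly_Mapping.single a b + f"
    using update(1) by (intro poly_mapping_eqI) (auto simp: lookup_update lookup_add lookup_single in_keys_iff when_def)
  then show ?case using assms update(3) by metis
qed

lemma single_0_commute: "Poly_Mapping.single 0 c * x = x * Poly_Mapping.single 0 (c :: ratfun)" for x :: free_alg
  by (induction x rule: free_induct) (simp_all add: mult_single distrib_left distrib_right mult.commute)

lemma fscale_simps:
  "fscale c (x + y) = fscale c x + fscale c y" "fscale (c + d) x = fscale c x + fscale d x"
  "fscale (c * d) x = fscale c (fscale d x)" "fscale 1 x = x" "fscale 0 x = 0"
  "fscale c x * y = fscale c (x * y)" "x * fscale c y = fscale c (x * y)"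
  "fscale c (Poly_Mapping.single w d) = Poly_Mapping.single w (c * d)"
proof -
  show "x * fscale c y = fscale c (x * y)"
    by (metis fscale_def mult.assoc single_0_commute)
  show "fscale (c * d) x = fscale c (fscale d x)"
    by (simp add: fscale_def mult_single flip: mult.assoc)
qed (simp_all add: fscale_def distrib_left distrib_right mult_single single_add mult.assoc)

lemma qscale_add_right: "c *\<^sub>q (x + y) = c *\<^sub>q x + c *\<^sub>q y"
  by transfer (simp add: fscale_simps)
lemma qscale_add_left: "(c + d) *\<^sub>q x = c *\<^sub>q x + d *\<^sub>q x"
  by transfer (simp add: fscale_simps)
lemma qscale_qscale [simp]: "c *\<^sub>q d *\<^sub>q x = (c * d) *\<^sub>q x"
  by transfer (simp add: fscale_simps)
lemma qscale_1 [simp]: "1 *\<^sub>q x = x"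
  by transfer (simp add: fscale_simps)
lemma qscale_0 [simp]: "0 *\<^sub>q x = 0"
  by transfer (simp add: fscale_simps)
lemma qscale_mult_left [simp]: "c *\<^sub>q x * y = c *\<^sub>q (x * y)"
  by transfer (simp add: fscale_simps)
lemma qscale_mult_right [simp]: "x * c *\<^sub>q y = c *\<^sub>q (x * y)"
  by transfer (simp add: fscale_simps)
lemma qscale_zero_right [simp]: "c *\<^sub>q 0 = 0"
  using qscale_add_right[of c 0 0] by simp
lemma qscale_minus_right: "c *\<^sub>q - x = - (c *\<^sub>q x)"
  using qscale_add_right[of c x "- x"] by (simp add: eq_neg_iff_add_eq_0 add.commute)
lemma qscale_minus_left: "(- c) *\<^sub>q x = - (c *\<^sub>q x)"
  using qscale_add_left[of c "- c" x] by (simp add: eq_neg_iff_add_eq_0 add.commute)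
lemma qscale_diff_right: "c *\<^sub>q (x - y) = c *\<^sub>q x - c *\<^sub>q y"
  using qscale_add_right[of c x "- y"] by (simp add: qscale_minus_right)
lemma qscale_diff_left: "(c - d) *\<^sub>q x = c *\<^sub>q x - d *\<^sub>q x"
  using qscale_add_left[of c "- d" x] by (simp add: qscale_minus_left)
lemma qscale_sum_right: "c *\<^sub>q sum f A = (\<Sum>i\<in>A. c *\<^sub>q f i)"
  by (induction A rule: infinite_finite_induct) (simp_all add: qscale_add_right)
lemmas qscale_distribs = qscale_add_right qscale_add_left qscale_minus_right qscale_minus_left
  qscale_diff_right qscale_diff_left
lemma qscale_cancel: "c \<noteq> 0 \<Longrightarrow> c *\<^sub>q x = c *\<^sub>q y \<longleftrightarrow> x = y"
  by (metis left_inverse qscale_1 qscale_qscale)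

lemma abs_single: "abs_uq (Poly_Mapping.single (Word []) c) = c *\<^sub>q 1"
  "abs_uq (Poly_Mapping.single (Word (i # l)) c) = gen i * abs_uq (Poly_Mapping.single (Word l) c)"
  "abs_uq (Poly_Mapping.single (Word (l @ [i])) c) = abs_uq (Poly_Mapping.single (Word l) c) * gen i"
  by (simp_all add: one_uq_def qscale.abs_eq gen_def times_uq.abs_eq fgen_def mult_single fscale_def
      flip: zero_word_def)

text \<open>Words span the algebra, so a linear property closed under multiplication by generators
  on one side holds everywhere. Both sides are provided, as the mirrored derivation below has its
  defining recursion on the right.\<close>

lemma uq_left_induct [case_names one gen add scale]:
  assumes "P 1" "\<And>i x. P x \<Longrightarrow> P (gen i * x)" "\<And>x y. P x \<Longrightarrow> P y \<Longrightarrow> P (x + y)"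
    "\<And>c x. P x \<Longrightarrow> P (c *\<^sub>q x)"
  shows "P x"
proof -
  have "P (abs_uq X)" for X
  proof (induction X rule: free_induct)
    case (single w c)
    obtain l where w: "w = Word l" by (cases w)
    show ?case unfolding w by (induction l) (simp_all add: abs_single assms)
  next
    case (add x y) then show ?case using assms(3) by (simp flip: plus_uq.abs_eq)
  qed
  then show ?thesis by (metis Quotient3_abs_rep Quotient3_uq)
qed

lemma uq_right_induct [case_names one gen add scale]:
  assumes "P 1" "\<And>i x. P x \<Longrightarrow> P (x * gen i)" "\<And>x y. P x \<Longrightarrow> P y \<Longrightarrow> P (x + y)"
    "\<And>c x. P x \<Longrightarrow> P (c *\<^sub>q x)"
  shows "P x"
proof -
  have "P (abs_uq X)" for X
  proof (induction X rule: free_induct)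
    case (single w c)
    obtain l where w: "w = Word l" by (cases w)
    show ?case unfolding w by (induction l rule: rev_induct) (simp_all add: abs_single assms)
  next
    case (add x y) then show ?case using assms(3) by (simp flip: plus_uq.abs_eq)
  qed
  then show ?thesis by (metis Quotient3_abs_rep Quotient3_uq)
qed

lemma qfact_simps: "qfact v 0 = 1" "qfact v (Suc n) = qint v (Suc n) * qfact v n"
  by (simp_all add: qfact_def mult.commute)

lemma serre_12: "serre J1 J2 = fgen J2 * fgen_dp J1 2 - fgen J1 * fgen J2 * fgen J1 + fgen_dp J1 2 * fgen J2"
  and serre_21: "serre J2 J1 = fgen J1 * fgen_dp J2 3 - fgen J2 * fgen J1 * fgen_dp J2 2
    + fgen_dp J2 2 * fgen J1 * fgen J2 - fgen_dp J2 3 * fgen J1"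
proof -
  have 1: "qint (qidx i) (Suc 0) = 1" for i
    using q_diff by (cases i) (simp_all add: qint_def qidx_values)
  have 2: "fgen_dp i 0 = 1" "fgen_dp i (Suc 0) = fgen i" for i
    by (simp_all add: fgen_dp_def qfact_simps 1 fscale_simps)
  have 3: "{..2} = {0,1,2::nat}" "{..3} = {0,1,2,3::nat}" by auto
  show "serre J1 J2 = fgen J2 * fgen_dp J1 2 - fgen J1 * fgen J2 * fgen J1 + fgen_dp J1 2 * fgen J2"
    "serre J2 J1 = fgen J1 * fgen_dp J2 3 - fgen J2 * fgen J1 * fgen_dp J2 2
    + fgen_dp J2 2 * fgen J1 * fgen J2 - fgen_dp J2 3 * fgen J1"
    by (simp_all add: serre_def cartan_values 3 2 power2_eq_square power3_eq_cube)
qed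

section \<open>Reversal of words, descended to the quotient\<close>

definition wrev :: "word \<Rightarrow> word" where
  "wrev w = (case w of Word l \<Rightarrow> Word (rev l))"

lemma wrev_simps [simp]: "wrev (Word l) = Word (rev l)" "wrev (wrev w) = w" "wrev (v + w) = wrev w + wrev v"
  "wrev 0 = 0"
  by (cases v; cases w; simp add: wrev_def zero_word_def)+

lemma inj_wrev: "inj wrev"
  by (metis injI wrev_simps(2))

definition fstar :: "free_alg \<Rightarrow> free_alg" where
  "fstar x = Poly_Mapping.map_key wrev x"

lemma fstar_single [simp]: "fstar (Poly_Mapping.single w c) = Poly_Mapping.single (wrev w) c"
  using map_key_single[OF inj_wrev, of "wrev w" c] by (simp add: fstar_def)

lemma fstar_add: "fstar (x + y) = fstar x + fstar y"
  by (simp add: fstar_def map_key_plus inj_wrev)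

lemma fstar_0 [simp]: "fstar 0 = 0"
  using fstar_add[of 0 0] by simp

lemma fstar_minus: "fstar (- x) = - fstar x"
  using fstar_add[of x "- x"] by (simp add: eq_neg_iff_add_eq_0 add.commute)

lemma fstar_diff: "fstar (x - y) = fstar x - fstar y"
  using fstar_add[of x "- y"] by (simp add: fstar_minus)

lemma fstar_mult: "fstar (x * y) = fstar y * fstar x"
proof (induction x rule: free_induct)
  case (single w c)
  show ?case
    by (induction y rule: free_induct)
      (simp_all add: mult_single distrib_left distrib_right fstar_add mult.commute)
qed (simp add: distrib_left distrib_right fstar_add)

lemma fstar_fstar [simp]: "fstar (fstar x) = x"
  by (induction x rule: free_induct) (simp_all add: fstar_add)

lemma fstar_fscale: "fstar (fscale c x) = fscale c (fstar x)"
  by (simp add: fscale_def fstar_mult single_0_commute)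

lemma fstar_fgen [simp]: "fstar (fgen i) = fgen i"
  by (simp add: fgen_def)

lemma fstar_1 [simp]: "fstar 1 = 1"
  by (metis fstar_single single_one wrev_simps(4))

lemma fstar_power: "fstar (x ^ n) = fstar x ^ n"
  by (induction n) (simp_all add: fstar_mult power_commutes)

lemma fstar_dp [simp]: "fstar (fgen_dp i n) = fgen_dp i n"
  by (simp add: fgen_dp_def fstar_fscale fstar_power)

lemma serre_in: "i \<noteq> j \<Longrightarrow> serre i j \<in> serre_ideal"
  using serre_ideal.rel[of i j 1 1] by simp

text \<open>The first Serre element is a palindrome. The second has four terms with alternating
  signs, so reversal negates it.\<close>

lemma fstar_serre: "i \<noteq> j \<Longrightarrow> fstar (serre i j) \<in> serre_ideal"
proof -
  have "fstar (serre J1 J2) = serre J1 J2"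
    by (simp add: serre_12 fstar_add fstar_diff fstar_mult mult.assoc)
  moreover have "fstar (serre J2 J1) = - serre J2 J1"
    by (simp add: serre_21 fstar_add fstar_diff fstar_mult mult.assoc)
  ultimately show ?thesis if "i \<noteq> j"
    using that serre_in serre_ideal_uminus by (cases i; cases j) auto
qed

lemma fstar_ideal: "x \<in> serre_ideal \<Longrightarrow> fstar x \<in> serre_ideal"
  by (induction rule: serre_ideal.induct)
    (simp_all add: fstar_add fstar_mult serre_ideal.zero serre_ideal.add
      serre_ideal_left serre_ideal_right fstar_serre)

lift_definition star :: "uq \<Rightarrow> uq" is fstar
  unfolding serre_eq_def by (simp add: fstar_ideal flip: fstar_diff)

lemma star_add: "star (x + y) = star x + star y" by transfer (simp add: fstar_add)
lemma star_diff: "star (x - y) = star x - star y" by transfer (simp add: fstar_diff)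
lemma star_mult: "star (x * y) = star y * star x" by transfer (simp add: fstar_mult)
lemma star_scale [simp]: "star (c *\<^sub>q x) = c *\<^sub>q star x" by transfer (simp add: fstar_fscale)
lemma star_star [simp]: "star (star x) = x" by transfer simp
lemma star_gen [simp]: "star (gen i) = gen i" by transfer simp
lemma star_1 [simp]: "star 1 = 1" by transfer simp
lemma star_0 [simp]: "star 0 = 0" by transfer simp
lemma star_power: "star (x ^ n) = star x ^ n"
  by (induction n) (simp_all add: star_mult power_commutes)
lemma star_divpow: "star (divpow i x n) = divpow i (star x) n"
  by (simp add: divpow_def star_power)
lemma star_sum: "star (sum f A) = (\<Sum>i\<in>A. star (f i))"
  by (induction A rule: infinite_finite_induct) (simp_all add: star_add)

section \<open>Conjugation of coefficients, descended to the quotient\<close>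

definition fbar :: "free_alg \<Rightarrow> free_alg" where
  "fbar x = Poly_Mapping.map barK x"

lemma lookup_fbar: "Poly_Mapping.lookup (fbar x) w = barK (Poly_Mapping.lookup x w)"
  by (simp add: fbar_def Poly_Mapping.map.rep_eq when_def)

lemma fbar_single [simp]: "fbar (Poly_Mapping.single w c) = Poly_Mapping.single w (barK c)"
  by (simp add: fbar_def)

lemma fbar_add: "fbar (x + y) = fbar x + fbar y"
  by (rule poly_mapping_eqI) (simp add: lookup_fbar lookup_add barK_add)

lemma fbar_0 [simp]: "fbar 0 = 0"
  using fbar_add[of 0 0] by simp

lemma fbar_minus: "fbar (- x) = - fbar x"
  using fbar_add[of x "- x"] by (simp add: eq_neg_iff_add_eq_0 add.commute)

lemma fbar_diff: "fbar (x - y) = fbar x - fbar y"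
  using fbar_add[of x "- y"] by (simp add: fbar_minus)

lemma fbar_mult: "fbar (x * y) = fbar x * fbar y"
proof (induction x rule: free_induct)
  case (single w c)
  show ?case
    by (induction y rule: free_induct)
      (simp_all add: mult_single distrib_left distrib_right fbar_add barK_mult)
qed (simp add: distrib_left distrib_right fbar_add)

lemma fbar_fbar [simp]: "fbar (fbar x) = x"
  by (induction x rule: free_induct) (simp_all add: fbar_add)

lemma fbar_fscale: "fbar (fscale c x) = fscale (barK c) (fbar x)"
  by (simp add: fscale_def fbar_mult)

lemma fbar_fgen [simp]: "fbar (fgen i) = fgen i"
  by (simp add: fgen_def)

lemma fbar_1 [simp]: "fbar 1 = 1"
  by (metis barK_1 fbar_single single_one)

lemma fbar_power: "fbar (x ^ n) = fbar x ^ n"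
  by (induction n) (simp_all add: fbar_mult)

lemma barK_qint: "barK v = inverse v \<Longrightarrow> barK (qint v n) = qint v n"
  by (simp add: qint_def barK_divide barK_diff barK_power barK_inverse)
    (metis minus_diff_eq minus_divide_left minus_divide_right minus_minus)

lemma barK_qidx [simp]: "barK (qidx i) = inverse (qidx i)"
  by (simp add: qidx_def barK_power power_inverse)

lemma barK_qfact [simp]: "barK (qfact (qidx i) n) = qfact (qidx i) n"
  by (induction n) (simp_all add: qfact_simps barK_mult barK_qint)

lemma fbar_dp [simp]: "fbar (fgen_dp i n) = fgen_dp i n"
  by (simp add: fgen_dp_def fbar_fscale fbar_power barK_inverse)

lemma fbar_serre: "i \<noteq> j \<Longrightarrow> fbar (serre i j) = serre i j"
  by (cases i; cases j) (simp_all add: serre_12 serre_21 fbar_add fbar_diff fbar_mult)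

lemma fbar_ideal: "x \<in> serre_ideal \<Longrightarrow> fbar x \<in> serre_ideal"
  by (induction rule: serre_ideal.induct)
    (auto simp: fbar_add fbar_mult fbar_serre intro: serre_ideal.intros)

lift_definition ubar :: "uq \<Rightarrow> uq" is fbar
  unfolding serre_eq_def by (simp add: fbar_ideal flip: fbar_diff)

lemma ubar_add: "ubar (x + y) = ubar x + ubar y" by transfer (simp add: fbar_add)
lemma ubar_diff: "ubar (x - y) = ubar x - ubar y" by transfer (simp add: fbar_diff)
lemma ubar_mult: "ubar (x * y) = ubar x * ubar y" by transfer (simp add: fbar_mult)
lemma ubar_scale [simp]: "ubar (c *\<^sub>q x) = barK c *\<^sub>q ubar x" by transfer (simp add: fbar_fscale)
lemma ubar_ubar [simp]: "ubar (ubar x) = x" by transfer simp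
lemma ubar_gen [simp]: "ubar (gen i) = gen i" by transfer simp
lemma ubar_1 [simp]: "ubar 1 = 1" by transfer simp

lemma is_bar_ubar: "is_bar ubar"
  unfolding is_bar_def
  by (auto simp: ubar_add ubar_mult scalar_def[symmetric] intro!: o_bij[of ubar])

text \<open>\<open>is_bar\<close> prescribes the effect on scalars only for rationals and for
  \<open>q\<close>. Semilinearity follows first for polynomials in \<open>q\<close>, then for
  fractions by cancelling the denominator; after that the generators decide.\<close>

lemma is_bar_unique: assumes "is_bar \<phi>" shows "\<phi> = ubar"
proof
  have add: "\<phi> (x + y) = \<phi> x + \<phi> y" and mult: "\<phi> (x * y) = \<phi> x * \<phi> y" and one: "\<phi> 1 = 1"
    and k: "\<phi> (scalar r *\<^sub>q x) = scalar r *\<^sub>q \<phi> x" and qv: "\<phi> (q *\<^sub>q 1) = inverse q *\<^sub>q 1"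
    and gn: "\<phi> (gen i) = gen i" for x y r i
    using assms by (auto simp: is_bar_def scalar_def)
  have p: "\<phi> (to_fract p *\<^sub>q 1) = evi p *\<^sub>q 1" for p
  proof (induction p)
    case 0
    show ?case using k[of 0 1] by (simp add: scalar_simps)
  next
    case (pCons c p)
    have "\<phi> (to_fract (pCons c p) *\<^sub>q 1) = \<phi> (scalar c *\<^sub>q 1 + (q *\<^sub>q 1) * (to_fract p *\<^sub>q 1))"
      by (simp add: to_fract_pCons qscale_add_left mult.commute)
    then show ?case using pCons.IH
      by (simp only: add mult k qv one) (simp add: evi_pCons qscale_add_left mult.commute)
  qed
  have "\<phi> (c *\<^sub>q 1) = barK c *\<^sub>q 1" for c
  proof -
    obtain a b where ab: "b \<noteq> 0" "c = to_fract a / to_fract b" by (rule frac_cases)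
    have "(c *\<^sub>q 1) * (to_fract b *\<^sub>q 1) = to_fract a *\<^sub>q (1 :: uq)" using ab by simp
    then have "\<phi> (c *\<^sub>q 1) * (evi b *\<^sub>q 1) = evi a *\<^sub>q 1" by (metis mult p)
    then have "evi b *\<^sub>q \<phi> (c *\<^sub>q 1) = evi b *\<^sub>q barK c *\<^sub>q 1"
      using ab(1) by (simp add: barK_frac[OF ab])
    then show ?thesis using ab(1) by (simp add: qscale_cancel del: qscale_qscale)
  qed
  then have form_scale: "\<phi> (c *\<^sub>q x) = barK c *\<^sub>q \<phi> x" for c x
    using mult[of "c *\<^sub>q 1" x] by simp
  show "\<phi> x = ubar x" for x
    by (induction x rule: uq_left_induct) (simp_all add: one mult add form_scale gn ubar_mult ubar_add)
qed

lemma bar_eq [simp]: "bar = ubar"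
  unfolding bar_def using is_bar_ubar is_bar_unique by (rule the_equality)

lemma ubar_star: "ubar (star x) = star (ubar x)"
  by (induction x rule: uq_left_induct) (simp_all add: ubar_mult star_mult ubar_add star_add)

lemma ubar_0 [simp]: "ubar 0 = 0" by transfer simp
lemma ubar_power: "ubar (x ^ n) = ubar x ^ n"
  by (induction n) (simp_all add: ubar_mult)
lemma ubar_sum: "ubar (sum f A) = (\<Sum>i\<in>A. ubar (f i))"
  by (induction A rule: infinite_finite_induct) (simp_all add: ubar_add)
lemma ubar_divpow [simp]: "ubar (divpow i (gen j) n) = divpow i (gen j) n"
  by (simp add: divpow_def ubar_power barK_inverse)

lemma star_f12: "star f12 = f12'" and star_f122: "star f122 = f122'"
  by (simp_all add: f12_def f12'_def f122_def f122'_def star_diff star_add star_mult star_divpow mult.assoc)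

lemma L_h'_star: "L_h' (a, b, c, d) = star (L_h (d, c, b, a))"
  by (simp add: star_mult star_divpow star_f12 star_f122 mult.assoc)

lemma divpow_0 [simp]: "divpow i x 0 = 1"
  by (simp add: divpow_def qfact_simps)

subsection \<open>The PBW module\<close>

type_synonym coords = "exponent \<Rightarrow> ratfun"

text \<open>In PBW coordinates, \<open>F1\<close> and \<open>F2\<close> are left multiplication by \<open>f1\<close> and \<open>f2\<close>. Wherever truncated
  subtraction takes effect, here and below, the scalar in front is \<open>0\<close>.\<close>

fun F1 :: "coords \<Rightarrow> coords" where
  "F1 w (a, b, c, d) = qint (q^2) a * w (a - 1, b, c, d)"

fun F2 :: "coords \<Rightarrow> coords" where
  "F2 w (a, b, c, d) = qint q b * w (a + 1, b - 1, c, d)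
    + q ^ (2 * a) / q ^ b * qint q (2 * c) * w (a, b + 1, c - 1, d)
    + q ^ (2 * a) / q ^ (2 * c) * qint q d * w (a, b, c, d - 1)"

fun F12 :: "coords \<Rightarrow> coords" where
  "F12 w (a, b, c, d) = qint q b / q ^ (2 * a) * w (a, b - 1, c, d)"

text \<open>The reciprocals of the denominators of \<open>qint\<close> for the short and the long
  root get names, so that identities of quantum integers simplify to identities of Laurent
  monomials.\<close>

definition q_diff_inv :: ratfun where "q_diff_inv = inverse (q - inverse q)"
definition q2_diff_inv :: ratfun where "q2_diff_inv = inverse (q^2 - inverse (q^2))"

lemma qint_q: "qint q n = (q ^ n - 1 / q ^ n) * q_diff_inv"
  by (simp add: qint_def q_diff_inv_def divide_inverse power_inverse)

lemma qint_q2: "qint (q^2) n = (q ^ (2 * n) - 1 / q ^ (2 * n)) * q2_diff_inv"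
  by (simp add: qint_def q2_diff_inv_def divide_inverse power_inverse power_mult)

lemma q_diff_inv_eq: "q2_diff_inv * (q * q) = 1 + q2_diff_inv / (q * q)" "q_diff_inv * q = 1 + q_diff_inv / q" "q_diff_inv = (q + 1 / q) * q2_diff_inv"
proof -
  have "q2_diff_inv * (q^2 - inverse (q^2)) = 1" "q_diff_inv * (q - inverse q) = 1"
    unfolding q_diff_inv_def q2_diff_inv_def using q_diff by simp_all
  then show "q2_diff_inv * (q * q) = 1 + q2_diff_inv / (q * q)" "q_diff_inv * q = 1 + q_diff_inv / q"
    by (simp_all add: algebra_simps divide_inverse power2_eq_square)
  have "(q - inverse q) * (q + inverse q) = q^2 - inverse (q^2)"
    by (simp add: algebra_simps power2_eq_square)
  moreover from this have "q + inverse q \<noteq> 0" using q_diff by auto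
  ultimately show "q_diff_inv = (q + 1 / q) * q2_diff_inv"
    unfolding q_diff_inv_def q2_diff_inv_def using q_diff by (simp add: divide_inverse flip: \<open>_ = q^2 - inverse (q^2)\<close>)
qed

lemma qint_qq: "qint (q * q) n = (q ^ (2 * n) - 1 / q ^ (2 * n)) * q2_diff_inv"
  using qint_q2 by (simp add: power2_eq_square)

lemma power_double: "x ^ (2 * n) = x ^ n * x ^ n" "x ^ (n * 2) = x ^ n * x ^ n" for x :: "'a :: monoid_mult"
  by (simp_all add: mult_2 mult_2_right power_add)

lemma qint_0 [simp]: "qint v 0 = 0"
  by (simp add: qint_def)

lemma qint_Suc: assumes "v - inverse v \<noteq> 0" shows "qint v (Suc n) = v * qint v n + 1 / v ^ n"
proof -
  have v: "v \<noteq> 0" using assms by auto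
  have "v ^ Suc n - inverse v ^ Suc n = v * (v ^ n - inverse v ^ n) + (v - inverse v) * inverse v ^ n"
    using v by (simp add: algebra_simps)
  then show ?thesis using assms unfolding qint_def
    by (simp only: add_divide_distrib times_divide_eq_right nonzero_mult_div_cancel_left)
      (simp add: divide_inverse power_inverse)
qed

lemma qint_Suc_q: "qint q (Suc n) = q * qint q n + 1 / q ^ n"
  and qint_Suc_q2: "qint (q^2) (Suc n) = q^2 * qint (q^2) n + 1 / q ^ (2 * n)"
  using qint_Suc[of q n] qint_Suc[of "q^2" n] q_diff by (simp_all add: power_mult)

lemma qint_1 [simp]: "qint q (Suc 0) = 1" "qint (q^2) (Suc 0) = 1"
  by (simp_all add: qint_Suc_q qint_Suc_q2)

lemma qint_Suc_qq: "qint (q * q) (Suc n) = q * q * qint (q * q) n + 1 / (q ^ n * q ^ n)"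
  using qint_Suc_q2[of n] by (simp add: power2_eq_square flip: power_add mult_2)

lemma F12_eq: "F2 (F1 w) e - q^2 * F1 (F2 w) e = F12 w e"
proof -
  obtain a b c d where e: "e = (a, b, c, d)" by (cases e)
  show ?thesis
  proof (cases a)
    case 0
    then show ?thesis by (simp add: e)
  next
    case (Suc a')
    then show ?thesis
      by (simp add: e qint_Suc_qq[of "Suc a'"] field_simps power2_eq_square power_double)
  qed
qed

text \<open>This is the Serre relation of degree two in \<open>f1\<close>, written as a
  q-commutation. With the closed formula for \<open>F12\<close> it is a one-term identity instead of
  one about words of length three.\<close>

lemma F12_F1: "F12 (F1 w) e = F1 (F12 w) e / q^2"
proof -
  obtain a b c d where e: "e = (a, b, c, d)" by (cases e)
  show ?thesis by (cases a) (simp_all add: e qint_q qint_qq power2_eq_square power_double field_simps)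
qed

text \<open>\<open>(q + 1 / q)\<close> times left multiplication by \<open>f122\<close>.\<close>

fun G :: "coords \<Rightarrow> coords" where
  "G w (a, b, c, d) = (1 / q^2 - 1) / q ^ (2 * a) * (qint q b * (qint q (b - 1) * w (a + 1, b - 2, c, d)))
    + qint q (2 * c) / q ^ (2 * b) * w (a, b, c - 1, d)"

lemma G_eq: "F2 (F12 w) e - F12 (F2 w) e = G w e"
proof -
  obtain a b c d where e: "e = (a, b, c, d)" by (cases e)
  show ?thesis
  proof (cases b)
    case 0
    then show ?thesis by (simp add: e)
  next
    case (Suc b')
    show ?thesis using Suc by (simp add: e field_simps power2_eq_square power_double qint_Suc_q)
  qed
qed

text \<open>The Serre relation of degree three in \<open>f2\<close>, again as a
  q-commutation.\<close>

lemma G_F2: "F2 (G w) e = G (F2 w) e / q^2"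
proof -
  obtain a b c d where e: "e = (a, b, c, d)" by (cases e)
  \<comment> \<open>\<open>G\<close> refers to \<open>b - 2\<close>, so the two truncated values are
    separate. In the generic case \<open>X\<close> is the only quantum integer in \<open>b\<close>
    that survives; its neighbours are expressed through it.\<close>
  consider "b = 0" | "b = 1" | b' where "b = Suc (Suc b')" by (metis One_nat_def nat.exhaust)
  then show ?thesis
  proof cases
    case 1
    then show ?thesis by (cases c) (simp_all add: e field_simps power2_eq_square power_double)
  next
    case 2
    then show ?thesis by (cases c) (simp_all add: e field_simps power2_eq_square power_double qint_Suc_q)
  next
    case 3
    define X where "X = qint q (Suc (Suc b'))"
    have Y: "qint q (Suc (Suc (Suc b'))) = q * X + 1 / q ^ (Suc (Suc b'))"
      by (simp add: X_def qint_Suc_q[of "Suc (Suc b')"])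
    have Z: "qint q (Suc b') = (X - 1 / q ^ Suc b') / q"
      by (simp add: X_def qint_Suc_q[of "Suc b'"])
    show ?thesis
      by (cases c) (simp_all add: e 3 Y Z X_def[symmetric] field_simps power2_eq_square power_double)
  qed
qed

subsection \<open>The action of the algebra on coordinates\<close>

text \<open>Coordinate functions are arbitrary here: each value of \<open>F i w\<close> depends on
  finitely many values of \<open>w\<close>, so the action makes sense without finite
  support.\<close>

definition linear_op :: "(coords \<Rightarrow> coords) \<Rightarrow> bool" where
  "linear_op T \<longleftrightarrow> (\<forall>v w. T (\<lambda>e. v e + w e) = (\<lambda>e. T v e + T w e)) \<and> (\<forall>c v. T (\<lambda>e. c * v e) = (\<lambda>e. c * T v e))"

lemma lin_add: "linear_op T \<Longrightarrow> T (\<lambda>e. v e + w e) = (\<lambda>e. T v e + T w e)"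
  and lin_scale: "linear_op T \<Longrightarrow> T (\<lambda>e. c * v e) = (\<lambda>e. c * T v e)"
  by (simp_all add: linear_op_def)

lemma lin_zero: "linear_op T \<Longrightarrow> T (\<lambda>e. 0) = (\<lambda>e. 0)"
  using lin_scale[of T 0 "\<lambda>e. 0"] by simp

lemma lin_diff: "linear_op T \<Longrightarrow> T (\<lambda>e. v e - w e) = (\<lambda>e. T v e - T w e)"
  using lin_add[of T v "\<lambda>e. (- 1) * w e"] lin_scale[of T "- 1" w] by simp

fun F :: "idx \<Rightarrow> coords \<Rightarrow> coords" where
  "F J1 = F1"
| "F J2 = F2"

lemma lin_F: "linear_op (F i)"
  by (cases i) (auto simp: linear_op_def algebra_simps)

fun actw :: "word \<Rightarrow> coords \<Rightarrow> coords" where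
  "actw (Word l) v = foldr F l v"

lemma actw_0 [simp]: "actw 0 v = v"
  by (simp add: zero_word_def)

lemma actw_add: "actw (u + w) v = actw u (actw w v)"
  by (cases u; cases w) simp

lemma lin_actw: "linear_op (actw w)"
proof (cases w)
  case (Word l)
  have "linear_op (foldr F l)"
    by (induction l) (simp_all add: linear_op_def lin_add[OF lin_F] lin_scale[OF lin_F])
  then show ?thesis by (simp add: Word linear_op_def)
qed

definition act :: "free_alg \<Rightarrow> coords \<Rightarrow> coords" where
  "act x v e = (\<Sum>w\<in>Poly_Mapping.keys x. Poly_Mapping.lookup x w * actw w v e)"

lemma act_single [simp]: "act (Poly_Mapping.single w c) v = (\<lambda>e. c * actw w v e)"
  by (rule ext) (simp add: act_def)

lemma act_add: "act (x + y) v = (\<lambda>e. act x v e + act y v e)"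
  unfolding act_def by (rule ext, rule setsum_keys_plus_distrib) (simp_all add: distrib_right)

lemma lin_act: "linear_op (act x)"
  unfolding linear_op_def act_def
  by (simp add: lin_add[OF lin_actw] lin_scale[OF lin_actw] distrib_left sum.distrib sum_distrib_left mult.left_commute)

lemma act_mult: "act (x * y) v = act x (act y v)"
proof (induction x rule: free_induct)
  case (single w c)
  show ?case
    by (induction y rule: free_induct)
      (simp_all add: mult_single distrib_left actw_add act_add lin_add[OF lin_actw] lin_scale[OF lin_actw]
        mult.assoc)
qed (simp add: distrib_right act_add)

lemma act_1 [simp]: "act 1 v = v"
  by (simp flip: single_one)

lemma act_0 [simp]: "act 0 v = (\<lambda>e. 0)"
  using act_single[of 0 0 v] by simp

lemma act_diff: "act (x - y) v = (\<lambda>e. act x v e - act y v e)"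
  using act_add[of "x - y" y v] by (simp add: fun_eq_iff)

lemma act_fscale [simp]: "act (fscale c x) v = (\<lambda>e. c * act x v e)"
  by (simp add: fscale_def act_mult)

lemma act_fgen [simp]: "act (fgen i) v = F i v"
  by (simp add: fgen_def)

lemma qfact_2: "qfact q 2 = q + 1 / q" "qfact (q^2) 2 = q^2 + 1 / q^2"
  and qfact_3: "qfact q 3 = (q^2 + 1 + 1 / q^2) * (q + 1 / q)"
proof -
  have one: "qint (q * q) (Suc 0) = 1" using qint_1(2) by (simp add: power2_eq_square)
  have "qint (q^2) 2 = q^2 + 1 / q^2" "qint q 2 = q + 1 / q" "qint q 3 = q^2 + 1 + 1 / q^2"
    using qint_Suc_q[of "Suc 0"] qint_Suc_q2[of "Suc 0"] qint_Suc_q[of "Suc (Suc 0)"]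
    by (simp_all add: numeral_2_eq_2 numeral_3_eq_3 field_simps one)
  then show "qfact q 2 = q + 1 / q" "qfact (q^2) 2 = q^2 + 1 / q^2"
    "qfact q 3 = (q^2 + 1 + 1 / q^2) * (q + 1 / q)"
    by (simp_all add: numeral_2_eq_2 numeral_3_eq_3 qfact_simps one)
qed

lemma qfact_nz: "q + 1 / q \<noteq> 0" "q^2 + 1 / q^2 \<noteq> 0" "q^2 + 1 + 1 / q^2 \<noteq> 0"
proof -
  have "q ^ 4 \<noteq> 1" "q ^ 8 \<noteq> 1" "q ^ 6 \<noteq> 1" by simp_all
  moreover have "q^4 - 1 = (q + 1 / q) * (q * (q^2 - 1))" "q^8 - 1 = (q^2 + 1 / q^2) * (q^2 * (q^4 - 1))"
    "q ^ 6 - 1 = (q^2 + 1 + 1 / q^2) * (q^2 * (q^2 - 1))"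
    by (simp_all add: field_simps eval_nat_numeral)
  ultimately show "q + 1 / q \<noteq> 0" "q^2 + 1 / q^2 \<noteq> 0" "q^2 + 1 + 1 / q^2 \<noteq> 0" by auto
qed

lemma lin_F1: "linear_op F1" and lin_F2: "linear_op F2"
  using lin_F[of J1] lin_F[of J2] by simp_all

lemmas F_lin = lin_diff[OF lin_F1] lin_diff[OF lin_F2] lin_scale[OF lin_F1] lin_scale[OF lin_F2]
  lin_add[OF lin_F1] lin_add[OF lin_F2]

lemma F12_fun: "F12 w = (\<lambda>e. F2 (F1 w) e - q^2 * F1 (F2 w) e)"
  by (rule ext) (simp add: F12_eq)

lemma G_fun: "G w = (\<lambda>e. F2 (F12 w) e - F12 (F2 w) e)"
  by (rule ext) (simp add: G_eq)

lemma act_serre_12: "act (serre J1 J2) v = (\<lambda>e. 0)"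
proof
  fix e
  have "F2 (F1 (F1 v)) e - q^2 * F1 (F2 (F1 v)) e = (F1 (F2 (F1 v)) e - q^2 * F1 (F1 (F2 v)) e) / q^2"
    using F12_F1[of v e] by (simp only: F12_fun F_lin)
  then have "F2 (F1 (F1 v)) e + F1 (F1 (F2 v)) e = (q^2 + 1 / q^2) * F1 (F2 (F1 v)) e"
    by (simp add: field_simps)
  then have "(F2 (F1 (F1 v)) e + F1 (F1 (F2 v)) e) / (q^2 + 1 / q^2) = F1 (F2 (F1 v)) e"
    using qfact_nz(2) by simp
  then show "act (serre J1 J2) v e = 0"
    by (simp only: serre_12 act_add act_diff act_mult fgen_dp_def qidx_values qfact_2
      F_lin act_fscale act_fgen F.simps power2_eq_square[of "fgen _"])
      (simp add: divide_inverse algebra_simps)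
qed

lemma act_serre_21: "act (serre J2 J1) v = (\<lambda>e. 0)"
proof
  fix e
  define t where "t = q^2 + 1 + 1 / q^2"
  define x y z u where "x = F2 (F2 (F2 (F1 v))) e" and "y = F2 (F2 (F1 (F2 v))) e"
    and "z = F2 (F1 (F2 (F2 v))) e" and "u = F1 (F2 (F2 (F2 v))) e"
  \<comment> \<open>\<open>G_F2\<close> expanded into words. Solving for the outer terms
    \<open>x\<close> and \<open>u\<close> leaves the factor \<open>t\<close>, the quantum integer 3;
    dividing by \<open>t * (q + 1 / q)\<close> produces the divided powers in
    \<open>serre\<close>.\<close>
  have "x - q^2 * y - (y - q^2 * z) = (y - q^2 * z - (z - q^2 * u)) / q^2"
    using G_F2[of v e] unfolding x_def y_def z_def u_def by (simp only: G_fun F12_fun F_lin)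
  then have "x - u = t * (y - z)"
    by (simp add: field_simps t_def)
  then have "(x - u) / t = y - z"
    using qfact_nz(3) by (simp add: t_def)
  then have "u / t - z + y - x / t = 0"
    by (simp add: diff_divide_distrib)
  then have "(u / t - z + y - x / t) / (q + 1 / q) = 0"
    by (simp only: div_0)
  then have "u / (t * (q + 1 / q)) - z / (q + 1 / q) + y / (q + 1 / q) - x / (t * (q + 1 / q)) = 0"
    by (simp only: diff_divide_distrib add_divide_distrib divide_divide_eq_left)
  then show "act (serre J2 J1) v e = 0"
    unfolding x_def y_def z_def u_def
    by (simp only: serre_21 act_add act_diff act_mult fgen_dp_def qidx_values qfact_2 qfact_3
      F_lin t_def[symmetric] act_fscale act_fgen F.simps power3_eq_cube power2_eq_square[of "fgen _"])
     (simp add: divide_inverse mult.commute)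
qed

lemma act_ideal: "x \<in> serre_ideal \<Longrightarrow> act x v = (\<lambda>e. 0)"
proof (induction arbitrary: v rule: serre_ideal.induct)
  case (rel i j a b)
  then have "act (serre i j) w = (\<lambda>e. 0)" for w
    by (cases i; cases j) (simp_all add: act_serre_12 act_serre_21)
  then show ?case by (simp add: act_mult lin_zero[OF lin_act])
qed (simp_all add: act_add)

definition delta :: "exponent \<Rightarrow> coords" where
  "delta c = (\<lambda>e. of_bool (e = c))"

text \<open>The action applied to the vacuum vector, well defined since the Serre ideal acts by
  zero. \<open>coord_L\<close> identifies the result with coordinates in the PBW basis.\<close>

lift_definition coord :: "uq \<Rightarrow> coords" is "\<lambda>x. act x (delta (0, 0, 0, 0))"
  unfolding serre_eq_def by (drule act_ideal) (simp add: act_diff fun_eq_iff)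

lemma coord_add: "coord (x + y) e = coord x e + coord y e" by transfer (simp add: act_add)
lemma coord_diff: "coord (x - y) e = coord x e - coord y e" by transfer (simp add: act_diff)
lemma coord_scale [simp]: "coord (c *\<^sub>q x) e = c * coord x e" by transfer simp
lemma coord_gen: "coord (gen i * x) = F i (coord x)" by transfer (simp add: act_mult)
lemma coord_1: "coord 1 = delta (0, 0, 0, 0)" by transfer simp
lemma coord_0 [simp]: "coord 0 e = 0" by transfer simp
lemma coord_sum: "coord (sum f A) e = (\<Sum>i\<in>A. coord (f i) e)"
  by (induction A rule: infinite_finite_induct) (simp_all add: coord_add)

lemma coord_f1: "coord (f1 * x) = F1 (coord x)" and coord_f2: "coord (f2 * x) = F2 (coord x)"
  by (simp_all add: coord_gen)

lemma coord_f12: "coord (f12 * x) = F12 (coord x)"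
  by (rule ext) (simp add: f12_def left_diff_distrib mult.assoc coord_diff coord_f1 coord_f2 F12_fun)

lemma f2_f12: "f2 * f12 = f12 * f2 + (q + 1 / q) *\<^sub>q f122"
proof -
  have "divpow J2 f2 2 = inverse (q + 1 / q) *\<^sub>q (f2 * f2)"
    by (simp add: divpow_def qidx_values qfact_2 power2_eq_square)
  then have "(q + 1 / q) *\<^sub>q f122 = f2 * f2 * f1 - ((q + 1 / q) * q) *\<^sub>q (f2 * f1 * f2) + q^2 *\<^sub>q (f1 * f2 * f2)"
    using qfact_nz(1)
    by (simp add: f122_def qscale_add_right qscale_diff_right mult.assoc mult.left_commute[of _ "q^2"])
  moreover have "(q + 1 / q) * q = q^2 + 1" by (simp add: field_simps power2_eq_square)
  ultimately show ?thesis
    by (simp add: f12_def algebra_simps qscale_add_left)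
qed

lemma coord_f122: "coord (f122 * x) e = G (coord x) e / (q + 1 / q)"
proof -
  have "(q + 1 / q) *\<^sub>q (f122 * x) = f2 * (f12 * x) - f12 * (f2 * x)"
    using arg_cong[OF f2_f12, of "\<lambda>z. z * x"] by (simp add: algebra_simps)
  then have "(q + 1 / q) * coord (f122 * x) e = G (coord x) e"
    by (simp add: G_fun coord_f2 coord_f12 coord_diff flip: coord_scale)
  then show ?thesis using qfact_nz(1) by (simp add: field_simps)
qed

subsection \<open>The PBW basis\<close>

declare L_h.simps [simp del] L_h'.simps [simp del]

lemma qint_nz [simp]: "qint (qidx i) (Suc n) \<noteq> 0"
proof -
  have *: "v ^ Suc n - inverse v ^ Suc n \<noteq> 0" if "v ^ (2 * Suc n) \<noteq> 1" "v \<noteq> 0" for v :: ratfun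
    using that by (auto simp: power_inverse field_simps power_double)
  have "qidx i ^ (2 * Suc n) \<noteq> 1"
    by (cases i) (simp_all only: qidx_values q_power_eq_1 power_mult[symmetric], simp_all)
  moreover have "qidx i \<noteq> 0" by (cases i) (simp_all add: qidx_values)
  ultimately have "qidx i ^ Suc n - inverse (qidx i) ^ Suc n \<noteq> 0" using * by blast
  moreover have "qidx i - inverse (qidx i) \<noteq> 0" using q_diff by (cases i) (simp_all add: qidx_values)
  ultimately show ?thesis by (simp add: qint_def)
qed

lemma qfact_nonzero [simp]: "qfact (qidx i) n \<noteq> 0"
  by (induction n) (simp_all add: qfact_simps)

lemma divpow_Suc: "divpow i x (Suc n) = inverse (qint (qidx i) (Suc n)) *\<^sub>q (x * divpow i x n)"
  by (simp add: divpow_def qfact_simps)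

lemma mult_divpow: "x * divpow i x n = qint (qidx i) (Suc n) *\<^sub>q divpow i x (Suc n)"
  by (simp add: divpow_Suc)

lemma divpow_mult: "divpow i x n * x = qint (qidx i) (Suc n) *\<^sub>q divpow i x (Suc n)"
proof -
  have "divpow i x n * x = x * divpow i x n" by (simp add: divpow_def power_commutes)
  then show ?thesis by (simp add: mult_divpow)
qed

section \<open>Commutation relations of the root vectors\<close>

lemma f2_f1: "f2 * f1 = f12 + q^2 *\<^sub>q (f1 * f2)"
  by (simp add: f12_def)

lemma abs_ideal: "x \<in> serre_ideal \<Longrightarrow> abs_uq x = 0"
  using Quotient3_rel_abs[OF Quotient3_uq, of x 0] by (simp add: serre_eq_def zero_uq_def)

lemma abs_power: "abs_uq (x ^ n) = abs_uq x ^ n"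
  by (induction n) (simp_all add: one_uq_def flip: times_uq.abs_eq)

lemma abs_dp: "abs_uq (fgen_dp i n) = divpow i (gen i) n"
  by (simp add: fgen_dp_def divpow_def gen_def abs_power flip: qscale.abs_eq)

lemma serre_uq_12: "f2 * divpow J1 f1 2 - f1 * f2 * f1 + divpow J1 f1 2 * f2 = 0"
  and serre_uq_21: "f1 * divpow J2 f2 3 - f2 * f1 * divpow J2 f2 2 + divpow J2 f2 2 * f1 * f2 - divpow J2 f2 3 * f1 = 0"
  using abs_ideal[OF serre_in[of J1 J2]] abs_ideal[OF serre_in[of J2 J1]]
  by (simp_all add: serre_12 serre_21 abs_dp gen_def flip: plus_uq.abs_eq minus_uq.abs_eq times_uq.abs_eq)

lemma serre_expl_12: "f2 * f1 * f1 = (q^2 + 1 / q^2) *\<^sub>q (f1 * f2 * f1) - f1 * f1 * f2"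
proof -
  have d: "divpow J1 f1 2 = inverse (q^2 + 1 / q^2) *\<^sub>q (f1 * f1)"
    by (simp add: divpow_def qidx_values qfact_2 power2_eq_square[of f1])
  have "(q^2 + 1 / q^2) *\<^sub>q (f2 * divpow J1 f1 2 - f1 * f2 * f1 + divpow J1 f1 2 * f2) = 0"
    by (simp only: serre_uq_12 qscale_zero_right)
  then have "f2 * f1 * f1 - (q^2 + 1 / q^2) *\<^sub>q (f1 * f2 * f1) + f1 * f1 * f2 = 0"
    using qfact_nz(2) by (simp add: d qscale_add_right qscale_diff_right mult.assoc)
  then show ?thesis by (simp add: algebra_simps eq_diff_eq)
qed

lemma serre_expl_21: "f2 * f2 * f2 * f1 = f1 * f2 * f2 * f2
  + (q^2 + 1 + 1 / q^2) *\<^sub>q (f2 * f2 * f1 * f2 - f2 * f1 * f2 * f2)"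
proof -
  let ?t = "q^2 + 1 + 1 / q^2" and ?s = "q + 1 / q"
  have d: "divpow J2 f2 2 = inverse ?s *\<^sub>q (f2 * f2)" "divpow J2 f2 3 = inverse (?t * ?s) *\<^sub>q (f2 * f2 * f2)"
    by (simp_all add: divpow_def qidx_values qfact_2 qfact_3 power2_eq_square[of f2] power3_eq_cube)
  have i: "?t * ?s * inverse ?s = ?t" "?t * ?s * inverse (?t * ?s) = 1"
    using qfact_nz by (simp, intro right_inverse) simp
  have "(?t * ?s) *\<^sub>q (f1 * divpow J2 f2 3 - f2 * f1 * divpow J2 f2 2 + divpow J2 f2 2 * f1 * f2 - divpow J2 f2 3 * f1) = 0"
    by (simp only: serre_uq_21 qscale_zero_right)
  then have "f1 * f2 * f2 * f2 - ?t *\<^sub>q (f2 * f1 * f2 * f2) + ?t *\<^sub>q (f2 * f2 * f1 * f2) - f2 * f2 * f2 * f1 = 0"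
    by (simp only: d qscale_add_right qscale_diff_right qscale_mult_right qscale_mult_left qscale_qscale i i[unfolded mult.assoc] qscale_1 mult.assoc)
  then show ?thesis by (simp add: qscale_diff_right algebra_simps)
qed

lemma f12_f1: "f12 * f1 = (1 / q^2) *\<^sub>q (f1 * f12)"
proof -
  have "f12 * f1 = f2 * f1 * f1 - q^2 *\<^sub>q (f1 * f2 * f1)" by (simp add: f12_def left_diff_distrib)
  also have "\<dots> = (1 / q^2) *\<^sub>q (f1 * f12)"
    by (simp add: serre_expl_12[unfolded mult.assoc] f12_def right_diff_distrib qscale_diff_right qscale_add_left mult.assoc)
  finally show ?thesis .
qed

lemma f2_f122: "f2 * f122 = (1 / q^2) *\<^sub>q (f122 * f2)"
proof -
  let ?s = "q + 1 / q"
  have g: "?s *\<^sub>q f122 = f2 * f12 - f12 * f2" by (simp add: f2_f12)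
  have "?s *\<^sub>q (f2 * f122) = f2 * (f2 * f12 - f12 * f2)" by (simp flip: g)
  also have "\<dots> = (1 / q^2) *\<^sub>q ((f2 * f12 - f12 * f2) * f2)"
    using serre_expl_21
    by (simp add: f12_def algebra_simps qscale_distribs)
  also have "\<dots> = ?s *\<^sub>q (1 / q^2) *\<^sub>q (f122 * f2)" by (simp add: mult.commute flip: g)
  finally show ?thesis using qfact_nz(1) by (simp only: qscale_cancel simp_thms)
qed

definition kap :: ratfun where "kap = (1 / q^2 - 1) / (q + 1 / q)"

text \<open>Order \<open>f2 * f12 * f1\<close> in two ways, starting with \<open>f2 * f12\<close> or
  with \<open>f12 * f1\<close>, and compare; \<open>kap\<close> is the resulting discrepancy divided
  by \<open>q + 1 / q\<close>.\<close>

lemma f122_f1: "f122 * f1 = f1 * f122 + kap *\<^sub>q (f12 * f12)"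
proof -
  let ?s = "q + 1 / q"
  have ks: "?s * kap = 1 / q^2 - 1" using qfact_nz(1) by (simp add: kap_def)
  have "f2 * (f12 * f1) = f12 * (f2 * f1) + ?s *\<^sub>q (f122 * f1)"
    using arg_cong[OF f2_f12, of "\<lambda>x. x * f1"] by (simp add: distrib_right mult.assoc)
  also have "\<dots> = f12 * f12 + f1 * f12 * f2 + ?s *\<^sub>q (f122 * f1)"
    using arg_cong[OF f12_f1, of "\<lambda>x. x * f2"] by (simp add: f2_f1 distrib_left mult.assoc)
  finally have 1: "f2 * (f12 * f1) = f12 * f12 + f1 * f12 * f2 + ?s *\<^sub>q (f122 * f1)" .
  have "f2 * (f12 * f1) = (1 / q^2) *\<^sub>q (f2 * f1 * f12)" by (simp add: f12_f1 mult.assoc)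
  also have "\<dots> = (1 / q^2) *\<^sub>q (f12 * f12) + f1 * (f2 * f12)"
    by (simp add: f2_f1 distrib_right qscale_add_right mult.assoc)
  also have "\<dots> = (1 / q^2) *\<^sub>q (f12 * f12) + f1 * f12 * f2 + ?s *\<^sub>q (f1 * f122)"
    by (simp add: f2_f12 distrib_left mult.assoc)
  finally have "?s *\<^sub>q (f122 * f1) = ?s *\<^sub>q (f1 * f122) + ((1 / q^2) *\<^sub>q (f12 * f12) - f12 * f12)"
    using 1 by (simp add: algebra_simps)
  then have "?s *\<^sub>q (f122 * f1) = ?s *\<^sub>q (f1 * f122 + kap *\<^sub>q (f12 * f12))"
    by (simp only: qscale_add_right qscale_qscale ks qscale_diff_left qscale_1)
  then show ?thesis using qfact_nz(1) by (simp only: qscale_cancel simp_thms)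
qed

text \<open>The same device for \<open>f2 * f122 * f1\<close>. Moving \<open>f2\<close> past
  \<open>f12 * f12\<close> produces a factor \<open>q + 1 / q\<close> that cancels the denominator
  of \<open>kap\<close>.\<close>

lemma f122_f12: "f122 * f12 = (1 / q^2) *\<^sub>q (f12 * f122)"
proof -
  let ?s = "q + 1 / q"
  have ks: "kap * ?s = 1 / q^2 - 1" using qfact_nz(1) by (simp add: kap_def)
  have "f2 * (f122 * f1) = (1 / q^2) *\<^sub>q (f122 * (f2 * f1))"
    using arg_cong[OF f2_f122, of "\<lambda>x. x * f1"] by (simp add: mult.assoc)
  also have "\<dots> = (1 / q^2) *\<^sub>q (f122 * f12) + f122 * f1 * f2"
    by (simp add: f2_f1 distrib_left qscale_add_right mult.assoc)
  also have "\<dots> = (1 / q^2) *\<^sub>q (f122 * f12) + f1 * f122 * f2 + kap *\<^sub>q (f12 * f12 * f2)"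
    by (simp add: f122_f1 distrib_right)
  finally have 1: "f2 * (f122 * f1) = (1 / q^2) *\<^sub>q (f122 * f12) + f1 * f122 * f2 + kap *\<^sub>q (f12 * f12 * f2)" .
  have "f2 * f12 * f12 = f12 * (f2 * f12) + ?s *\<^sub>q (f122 * f12)"
    by (simp add: f2_f12 distrib_right mult.assoc)
  also have "\<dots> = f12 * f12 * f2 + ?s *\<^sub>q (f12 * f122 + f122 * f12)"
    by (simp add: f2_f12 distrib_left qscale_add_right mult.assoc)
  finally have 2: "f2 * f12 * f12 = f12 * f12 * f2 + ?s *\<^sub>q (f12 * f122 + f122 * f12)" .
  have "f2 * (f122 * f1) = f2 * f1 * f122 + kap *\<^sub>q (f2 * f12 * f12)"
    by (simp add: f122_f1 distrib_left mult.assoc)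
  also have "\<dots> = f12 * f122 + q^2 *\<^sub>q (f1 * (f2 * f122)) + kap *\<^sub>q (f12 * f12 * f2) + (1 / q^2 - 1) *\<^sub>q (f12 * f122 + f122 * f12)"
    by (simp add: f2_f1 2[unfolded mult.assoc] qscale_add_right distrib_right mult.assoc ks)
  also have "q^2 *\<^sub>q (f1 * (f2 * f122)) = f1 * f122 * f2"
    by (simp add: f2_f122 mult.assoc)
  finally have "(1 / q^2) *\<^sub>q (f122 * f12) = f12 * f122 + (1 / q^2 - 1) *\<^sub>q (f12 * f122 + f122 * f12)"
    using 1 by (simp add: algebra_simps)
  then show ?thesis
    by (simp add: qscale_add_right qscale_diff_left algebra_simps)
qed

lemma q_commute_power:
  assumes "x * y = c *\<^sub>q (y * x)"
  shows "x * y ^ n = c ^ n *\<^sub>q (y ^ n * x)" "x ^ n * y = c ^ n *\<^sub>q (y * x ^ n)"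
proof -
  show "x * y ^ n = c ^ n *\<^sub>q (y ^ n * x)"
  proof (induction n)
    case (Suc n)
    have "x * y ^ Suc n = c *\<^sub>q (y * (x * y ^ n))" by (simp add: assms flip: mult.assoc)
    then show ?case by (simp add: Suc mult.assoc mult.commute)
  qed simp
  show "x ^ n * y = c ^ n *\<^sub>q (y * x ^ n)"
  proof (induction n)
    case (Suc n)
    have "x ^ Suc n * y = c ^ n *\<^sub>q (x * y * x ^ n)" by (simp add: Suc mult.assoc)
    then show ?case by (simp add: assms mult.assoc mult.commute)
  qed simp
qed

lemma f2_f1_pow: "f2 * f1 ^ a = qint (q^2) a *\<^sub>q (f1 ^ (a - 1) * f12) + q ^ (2 * a) *\<^sub>q (f1 ^ a * f2)"
proof (induction a)
  case (Suc a)
  have 1: "qint (q^2) a *\<^sub>q (f1 * (f1 ^ (a - 1) * f12)) = qint (q^2) a *\<^sub>q (f1 ^ a * f12)"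
    by (cases a) (simp_all add: mult.assoc)
  have "f2 * f1 ^ Suc a = f12 * f1 ^ a + q^2 *\<^sub>q (f1 * (f2 * f1 ^ a))"
    using arg_cong[OF f2_f1, of "\<lambda>x. x * f1 ^ a"] by (simp add: distrib_right mult.assoc)
  also have "\<dots> = (1 / q ^ (2 * a)) *\<^sub>q (f1 ^ a * f12) + q^2 *\<^sub>q (qint (q^2) a *\<^sub>q (f1 * (f1 ^ (a - 1) * f12)))
      + q ^ (2 * Suc a) *\<^sub>q (f1 ^ Suc a * f2)"
    by (simp add: Suc q_commute_power(1)[OF f12_f1] distrib_left qscale_add_right mult.assoc power_one_over power_mult
      power2_eq_square)
  also have "\<dots> = qint (q^2) (Suc a) *\<^sub>q (f1 ^ (Suc a - 1) * f12) + q ^ (2 * Suc a) *\<^sub>q (f1 ^ Suc a * f2)"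
    unfolding 1 by (simp add: qint_Suc_q2 qscale_add_left)
  finally show ?case .
qed simp

lemma f2_f12_pow: "f2 * f12 ^ b = ((q + 1 / q) * (q * qint q b) / q ^ b) *\<^sub>q (f12 ^ (b - 1) * f122) + f12 ^ b * f2"
proof (induction b)
  case (Suc b)
  let ?s = "q + 1 / q"
  have 1: "qint q b *\<^sub>q (f12 * (f12 ^ (b - 1) * f122)) = qint q b *\<^sub>q (f12 ^ b * f122)"
    by (cases b) (simp_all add: mult.assoc)
  have "f2 * f12 ^ Suc b = f12 * (f2 * f12 ^ b) + ?s *\<^sub>q (f122 * f12 ^ b)"
    using arg_cong[OF f2_f12, of "\<lambda>x. x * f12 ^ b"] by (simp add: distrib_right mult.assoc)
  also have "\<dots> = (?s * q / q ^ b) *\<^sub>q (qint q b *\<^sub>q (f12 * (f12 ^ (b - 1) * f122))) + f12 ^ Suc b * f2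
      + (?s / q ^ (2 * b)) *\<^sub>q (f12 ^ b * f122)"
    by (simp add: Suc q_commute_power(1)[OF f122_f12] distrib_left mult.assoc power_one_over power_mult)
  also have "\<dots> = ((?s * q / q ^ b) * qint q b + ?s / q ^ (2 * b)) *\<^sub>q (f12 ^ b * f122) + f12 ^ Suc b * f2"
    unfolding 1 by (simp add: qscale_add_left algebra_simps)
  also have "(?s * q / q ^ b) * qint q b + ?s / q ^ (2 * b) = ?s * (q * qint q (Suc b)) / q ^ Suc b"
    unfolding qint_Suc_q power_double by (simp add: divide_simps) (simp add: algebra_simps)
  finally show ?case by simp
qed simp

section \<open>The PBW vectors span the algebra\<close>

definition Lp :: "exponent \<Rightarrow> uq" where
  "Lp = (\<lambda>(a, b, c, d). f1 ^ a * f12 ^ b * f122 ^ c * f2 ^ d)"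

lemma L_h_Lp: "L_h (a, b, c, d) = inverse (qfact (q^2) a * qfact q b * qfact (q^2) c * qfact q d) *\<^sub>q Lp (a, b, c, d)"
  by (simp add: L_h.simps divpow_def Lp_def qidx_values mult_ac)

lemma f2_Lp: "f2 * Lp (a, b, c, d) = qint (q^2) a *\<^sub>q Lp (a - 1, b + 1, c, d)
    + (q ^ (2 * a) * ((q + 1 / q) * (q * qint q b) / q ^ b)) *\<^sub>q Lp (a, b - 1, c + 1, d)
    + (q ^ (2 * a) / q ^ (2 * c)) *\<^sub>q Lp (a, b, c, d + 1)"
proof -
  have "f2 * Lp (a, b, c, d) = (f2 * f1 ^ a) * (f12 ^ b * f122 ^ c * f2 ^ d)"
    by (simp add: Lp_def mult.assoc)
  also have "\<dots> = qint (q^2) a *\<^sub>q Lp (a - 1, b + 1, c, d) + q ^ (2 * a) *\<^sub>q (f1 ^ a * (f2 * f12 ^ b) * f122 ^ c * f2 ^ d)"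
    by (simp add: f2_f1_pow Lp_def distrib_right mult.assoc)
  also have "f1 ^ a * (f2 * f12 ^ b) * f122 ^ c * f2 ^ d =
     ((q + 1 / q) * (q * qint q b) / q ^ b) *\<^sub>q Lp (a, b - 1, c + 1, d) + f1 ^ a * f12 ^ b * (f2 * f122 ^ c) * f2 ^ d"
    by (simp add: f2_f12_pow Lp_def distrib_right distrib_left mult.assoc)
  also have "f1 ^ a * f12 ^ b * (f2 * f122 ^ c) * f2 ^ d = (1 / q ^ (2 * c)) *\<^sub>q Lp (a, b, c, d + 1)"
    by (simp add: q_commute_power(1)[OF f2_f122] Lp_def mult.assoc power_one_over power_mult)
  finally show ?thesis by (simp add: qscale_add_right)
qed

inductive_set PBW_span :: "uq set" where
  L: "L_h c \<in> PBW_span"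
| zero: "0 \<in> PBW_span"
| add: "x \<in> PBW_span \<Longrightarrow> y \<in> PBW_span \<Longrightarrow> x + y \<in> PBW_span"
| scale: "x \<in> PBW_span \<Longrightarrow> r *\<^sub>q x \<in> PBW_span"

lemma Lp_span: "Lp c \<in> PBW_span"
proof -
  obtain a b c' d where c: "c = (a, b, c', d)" by (cases c)
  let ?k = "qfact (q^2) a * qfact q b * qfact (q^2) c' * qfact q d"
  have "?k \<noteq> 0" using qfact_nonzero[of J1] qfact_nonzero[of J2] by (simp add: qidx_values)
  then have "Lp c = ?k *\<^sub>q L_h c" unfolding c L_h_Lp by (simp only: qscale_qscale right_inverse qscale_1 not_False_eq_True)
  then show ?thesis using PBW_span.L PBW_span.scale by metis
qed

lemma L_h_scale_Lp: "\<exists>k. L_h c = k *\<^sub>q Lp c"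
  by (cases c) (metis L_h_Lp)

lemma f1_Lp: "f1 * Lp (a, b, c, d) = Lp (a + 1, b, c, d)"
  by (simp add: Lp_def mult.assoc)

lemma gen_span: "x \<in> PBW_span \<Longrightarrow> gen i * x \<in> PBW_span"
proof (induction rule: PBW_span.induct)
  case (L c)
  obtain k where k: "L_h c = k *\<^sub>q Lp c" using L_h_scale_Lp by blast
  obtain a b c' d where c: "c = (a, b, c', d)" by (cases c)
  have "gen i * Lp c \<in> PBW_span"
    unfolding c by (cases i) (simp_all only: f1_Lp f2_Lp Lp_span PBW_span.add PBW_span.scale)
  then show ?case by (simp add: k PBW_span.scale)
qed (simp_all add: distrib_left PBW_span.intros)

lemma in_PBW_span: "x \<in> PBW_span"
proof (induction x rule: uq_left_induct)
  case one
  then show ?case using PBW_span.L[of "(0,0,0,0)"] by (simp add: L_h.simps)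
qed (auto intro: gen_span PBW_span.add PBW_span.scale)

text \<open>One induction for all four factors of \<open>L_h c\<close>, taken from the right:
  \<open>T\<close> is left multiplication by the root vector and \<open>e n\<close> the exponent
  with \<open>n\<close> in its position.\<close>

lemma coord_divpow:
  assumes "\<And>x. coord (y * x) = T (coord x)" "\<And>n. T (delta (e n)) = (\<lambda>z. qint (qidx i) (Suc n) * delta (e (Suc n)) z)"
    and "coord x = delta (e 0)"
  shows "coord (divpow i y n * x) = delta (e n)"
proof (induction n)
  case (Suc n)
  have "coord (divpow i y (Suc n) * x) = (\<lambda>z. inverse (qint (qidx i) (Suc n)) * T (coord (divpow i y n * x)) z)"
    by (rule ext) (simp add: divpow_Suc mult.assoc assms(1))
  then show ?case by (simp add: Suc assms(2) flip: mult.assoc)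
qed (simp add: assms)

lemma eq_Suc_pred_iff: "n = Suc (n - Suc 0) \<longleftrightarrow> n \<noteq> 0"
  by auto

text \<open>This is the linear independence. When the factors are applied from the right, the
  remaining terms of \<open>F2\<close> and \<open>G\<close> ask for a positive exponent in a
  position that is still 0, so each operator only raises its own exponent.\<close>

lemma coord_L [simp]: "coord (L_h c) = delta c"
proof -
  obtain a b c' d where c: "c = (a, b, c', d)" by (cases c)
  have 1: "coord (divpow J2 f2 d * 1) = delta (0, 0, 0, d)"
    by (rule coord_divpow[where T = F2]) (auto simp: coord_f2 coord_1 delta_def fun_eq_iff qidx_values eq_Suc_pred_iff)
  \<comment> \<open>The factor \<open>q + 1 / q\<close> carried by \<open>G\<close> converts
    short-root quantum integers of even numbers into the long-root ones in the divided powers of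
    \<open>f122\<close>.\<close>
  have "qint q (2 * n) / (q + 1 / q) = qint (q^2) n" for n
    using qfact_nz(1) by (simp add: qint_q qint_q2 q_diff_inv_eq(3))
  from this[of "Suc n" for n] have "qint q (Suc (Suc (2 * n))) / (q + 1 / q) = qint (q^2) (Suc n)" for n
    by simp
  note G = this
  have 2: "coord (divpow J1 f122 c' * divpow J2 f2 d) = delta (0, 0, c', d)"
    by (rule coord_divpow[where T = "\<lambda>w e. G w e / (q + 1 / q)"])
     (use 1 G in \<open>auto simp: coord_f122 delta_def fun_eq_iff qidx_values eq_Suc_pred_iff simp flip: times_divide_eq_left\<close>)
  have 3: "coord (divpow J2 f12 b * (divpow J1 f122 c' * divpow J2 f2 d)) = delta (0, b, c', d)"
    by (rule coord_divpow[where T = F12]) (use 2 in \<open>auto simp: coord_f12 delta_def fun_eq_iff qidx_values eq_Suc_pred_iff\<close>)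
  have 4: "coord (divpow J1 f1 a * (divpow J2 f12 b * (divpow J1 f122 c' * divpow J2 f2 d))) = delta (a, b, c', d)"
    by (rule coord_divpow[where T = F1]) (use 3 in \<open>auto simp: coord_f1 delta_def fun_eq_iff qidx_values eq_Suc_pred_iff\<close>)
  then show ?thesis by (simp add: c L_h.simps mult.assoc)
qed

definition supp :: "uq \<Rightarrow> exponent set" where
  "supp x = {c. coord x c \<noteq> 0}"

lemma coord_notin: "supp x \<subseteq> A \<Longrightarrow> c \<notin> A \<Longrightarrow> coord x c = 0"
  by (auto simp: supp_def)

lemma PBW_expansion_ex: "\<exists>A. finite A \<and> supp x \<subseteq> A \<and> x = (\<Sum>c\<in>A. coord x c *\<^sub>q L_h c)"
  using in_PBW_span[of x]
proof (induction rule: PBW_span.induct)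
  case (L c)
  show ?case by (rule exI[of _ "{c}"]) (auto simp: supp_def delta_def)
next
  case zero
  show ?case by (rule exI[of _ "{}"]) (auto simp: supp_def)
next
  case (add x y)
  then obtain A B where A: "finite A" "supp x \<subseteq> A" "x = (\<Sum>c\<in>A. coord x c *\<^sub>q L_h c)"
    and B: "finite B" "supp y \<subseteq> B" "y = (\<Sum>c\<in>B. coord y c *\<^sub>q L_h c)" by blast
  have "x = (\<Sum>c\<in>A \<union> B. coord x c *\<^sub>q L_h c)"
    by (subst A(3), rule sum.mono_neutral_left) (use A B in \<open>auto simp: coord_notin\<close>)
  moreover have "y = (\<Sum>c\<in>A \<union> B. coord y c *\<^sub>q L_h c)"
    by (subst B(3), rule sum.mono_neutral_left) (use A B in \<open>auto simp: coord_notin\<close>)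
  ultimately have "x + y = (\<Sum>c\<in>A \<union> B. coord (x + y) c *\<^sub>q L_h c)"
    by (simp add: coord_add qscale_add_left sum.distrib)
  moreover have "supp (x + y) \<subseteq> A \<union> B"
  proof (rule subsetI, rule ccontr)
    fix c assume "c \<in> supp (x + y)" "c \<notin> A \<union> B"
    then show False using coord_notin[OF A(2), of c] coord_notin[OF B(2), of c] by (simp add: supp_def coord_add)
  qed
  ultimately show ?case using A(1) B(1) by (intro exI[of _ "A \<union> B"]) blast
next
  case (scale x r)
  then obtain A where A: "finite A" "supp x \<subseteq> A" "x = (\<Sum>c\<in>A. coord x c *\<^sub>q L_h c)" by blast
  have "r *\<^sub>q x = (\<Sum>c\<in>A. coord (r *\<^sub>q x) c *\<^sub>q L_h c)"
    by (subst A(3)) (simp add: qscale_sum_right)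
  moreover have "supp (r *\<^sub>q x) \<subseteq> A" using A(2) by (auto simp: supp_def)
  ultimately show ?case using A(1) by blast
qed

lemma finite_supp [simp]: "finite (supp x)"
  using PBW_expansion_ex finite_subset by blast

lemma PBW_expansion_on: assumes "finite A" "supp x \<subseteq> A" shows "x = (\<Sum>c\<in>A. coord x c *\<^sub>q L_h c)"
proof -
  obtain B where B: "finite B" "supp x \<subseteq> B" "x = (\<Sum>c\<in>B. coord x c *\<^sub>q L_h c)" using PBW_expansion_ex by blast
  have "x = (\<Sum>c\<in>supp x. coord x c *\<^sub>q L_h c)"
    by (subst B(3), rule sum.mono_neutral_right) (use B in \<open>auto simp: supp_def\<close>)
  also have "\<dots> = (\<Sum>c\<in>A. coord x c *\<^sub>q L_h c)"
    by (rule sum.mono_neutral_left) (use assms in \<open>auto simp: supp_def\<close>)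
  finally show ?thesis .
qed

lemma PBW_expansion: "x = (\<Sum>c\<in>supp x. coord x c *\<^sub>q L_h c)"
  by (rule PBW_expansion_on) auto

lemma coord_eqI: "(\<And>c. coord x c = coord y c) \<Longrightarrow> x = y"
proof -
  assume *: "\<And>c. coord x c = coord y c"
  then have "supp x = supp y" by (simp add: supp_def)
  then show "x = y" using PBW_expansion[of x] PBW_expansion[of y] * by simp
qed

subsection \<open>Monomials in the generators\<close>

declare split_paired_All [simp del] split_paired_Ex [simp del]

text \<open>The unsymmetric Gaussian binomial, for \<open>k \<le> n\<close> a polynomial in
  \<open>w\<close> with constant term 1: integrality and value at 0 are visible from Pascal's
  recursion. \<open>dp_binom\<close> is the symmetric version.\<close>

fun gauss_binom :: "ratfun \<Rightarrow> nat \<Rightarrow> nat \<Rightarrow> ratfun" where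
  "gauss_binom w n 0 = 1"
| "gauss_binom w 0 (Suc k) = 0"
| "gauss_binom w (Suc n) (Suc k) = gauss_binom w n k + w ^ Suc k * gauss_binom w n (Suc k)"

lemma gauss_binom_Zq: "w \<in> Zq \<Longrightarrow> gauss_binom w n k \<in> Zq"
  by (induction w n k rule: gauss_binom.induct) (auto intro!: Zq_add Zq_mult Zq_power)

lemma gauss_binom_big: "n < k \<Longrightarrow> gauss_binom w n k = 0"
  by (induction w n k rule: gauss_binom.induct) auto

lemma gauss_binom_self [simp]: "gauss_binom w n n = 1"
  by (induction n) (simp_all add: gauss_binom_big)

lemma value0_gauss_binom: "value0 w 0 \<Longrightarrow> k \<le> n \<Longrightarrow> value0 (gauss_binom w n k) 1"
proof (induction w n k rule: gauss_binom.induct)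
  case (3 w n k)
  have "value0 (w ^ Suc k * gauss_binom w n (Suc k)) 0"
  proof (cases "Suc k \<le> n")
    case True
    have "value0 (w ^ Suc k * gauss_binom w n (Suc k)) (0 ^ Suc k * 1)"
      using True 3 by (intro value0_mult value0_power) auto
    then show ?thesis by simp
  qed (simp add: gauss_binom_big)
  then show ?case using 3 value0_add[of "gauss_binom w n k" 1 "w ^ Suc k * gauss_binom w n (Suc k)" 0] by simp
qed simp_all

lemma qint_add: assumes "v \<noteq> 0" shows "qint v (m + n) = qint v m / v ^ n + v ^ m * qint v n"
proof -
  have "v ^ (m + n) - inverse v ^ (m + n) = (v ^ m - inverse v ^ m) * inverse v ^ n + v ^ m * (v ^ n - inverse v ^ n)"
    by (simp add: algebra_simps power_add)
  then show ?thesis by (simp add: qint_def divide_inverse power_inverse distrib_left distrib_right mult_ac )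
qed

lemma qfact_gauss_binom: assumes "v \<noteq> 0"
  shows "qfact v (s + a) * v ^ (s * a) = gauss_binom (v^2) (s + a) s * (qfact v s * qfact v a)"
proof (induction "s + a" arbitrary: s a)
  case (Suc n)
  show ?case
  proof (cases "s = 0 \<or> a = 0")
    case True
    then show ?thesis by (auto simp: qfact_def)
  next
    case False
    then obtain s' a' where sa: "s = Suc s'" "a = Suc a'" by (metis not0_implies_Suc)
    have n: "n = s' + Suc a'" "n = Suc s' + a'" using Suc(2) sa by auto
    let ?f = "qfact v n"
    have 1: "?f * v ^ (s' * Suc a') = gauss_binom (v^2) n s' * (qfact v s' * qfact v (Suc a'))"
      and 2: "?f * v ^ (Suc s' * a') = gauss_binom (v^2) n (Suc s') * (qfact v (Suc s') * qfact v a')"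
      using Suc(1)[OF n(1)] Suc(1)[OF n(2)] n by simp_all
    have q: "qint v (Suc n) = qint v (Suc s') / v ^ Suc a' + v ^ Suc s' * qint v (Suc a')"
      using qint_add[OF assms, of "Suc s'" "Suc a'"] n by simp
    have "qfact v (s + a) * v ^ (s * a) = qint v (Suc n) * ?f * v ^ (Suc s' * Suc a')"
      using n sa by (simp add: qfact_simps)
    also have "\<dots> = qint v (Suc s') * (?f * v ^ (s' * Suc a')) + (v^2) ^ Suc s' * qint v (Suc a') * (?f * v ^ (Suc s' * a'))"
      unfolding q using assms by (simp add: field_simps power_add power2_eq_square power_mult_distrib)
    also have "\<dots> = gauss_binom (v^2) (Suc n) (Suc s') * (qfact v (Suc s') * qfact v (Suc a'))"
      unfolding 1 2 by (simp add: qfact_simps algebra_simps)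
    finally show ?thesis using n sa by simp
  qed
qed (simp add: qfact_def)

definition dp_binom :: "idx \<Rightarrow> nat \<Rightarrow> nat \<Rightarrow> ratfun" where
  "dp_binom i s a = gauss_binom ((qidx i)^2) (s + a) s / qidx i ^ (s * a)"

lemma qidx_nz [simp]: "qidx i \<noteq> 0"
  by (cases i) (simp_all add: qidx_values)

lemma divpow_divpow: "divpow i x s * divpow i x a = dp_binom i s a *\<^sub>q divpow i x (s + a)"
proof -
  have "qfact (qidx i) (s + a) = dp_binom i s a * (qfact (qidx i) s * qfact (qidx i) a)"
    using qfact_gauss_binom[of "qidx i" s a] by (simp add: dp_binom_def field_simps)
  moreover from this have "dp_binom i s a \<noteq> 0" using qfact_nonzero[of i "s + a"] by auto
  ultimately have "inverse (qfact (qidx i) s) * inverse (qfact (qidx i) a) = dp_binom i s a * inverse (qfact (qidx i) (s + a))"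
    by simp
  then show ?thesis by (simp add: divpow_def power_add mult.commute)
qed

lemma dp_binom_0 [simp]: "dp_binom i 0 a = 1" "dp_binom i s 0 = 1"
  by (simp_all add: dp_binom_def)

lemma qidx_Zq: "qidx i \<in> Zq"
  by (cases i) (simp_all add: qidx_values Zq_power)

lemma dp_binom_Lq: "dp_binom i s a \<in> Lq"
proof -
  have "gauss_binom ((qidx i)^2) (s + a) s \<in> Lq" by (intro Zq_Lq gauss_binom_Zq Zq_power qidx_Zq)
  then show ?thesis
    by (cases i) (simp_all add: dp_binom_def qidx_values Lq_divide_power flip: power_mult)
qed

lemma linear_expand:
  assumes "\<And>x y. T (x + y) = T x + T y" "\<And>k x. T (k *\<^sub>q x) = k *\<^sub>q T x"
  shows "T x = (\<Sum>c\<in>supp x. coord x c *\<^sub>q T (L_h c))"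
proof -
  have 0: "T 0 = 0" using assms(2)[of 0 0] by simp
  have s: "T (sum f A) = (\<Sum>i\<in>A. T (f i))" for f :: "exponent \<Rightarrow> uq" and A
    by (induction A rule: infinite_finite_induct) (simp_all add: assms(1) 0)
  show ?thesis by (subst PBW_expansion[of x]) (simp add: s assms(2))
qed

lemma coord_linear:
  assumes "\<And>x y. T (x + y) = T x + T y" "\<And>k x. T (k *\<^sub>q x) = k *\<^sub>q T x"
  shows "coord (T x) e = (\<Sum>c\<in>supp x. coord x c * coord (T (L_h c)) e)"
  by (subst linear_expand[of T x]) (simp_all add: assms coord_sum)

text \<open>Meant for multiplication by divided powers of \<open>f1\<close> on the left or of
  \<open>f2\<close> on the right: the outer factor of \<open>L_h\<close> absorbs them, so PBW
  vectors go injectively to multiples of PBW vectors.\<close>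

lemma coord_shift:
  assumes "\<And>x y. T (x + y) = T x + T y" "\<And>k x. T (k *\<^sub>q x) = k *\<^sub>q T x"
    and "\<And>c. T (L_h c) = k c *\<^sub>q L_h (g c)" "inj g"
  shows "coord (T x) (g c) = k c * coord x c" and "e \<notin> range g \<Longrightarrow> coord (T x) e = 0"
proof -
  have *: "coord (T x) e = (\<Sum>c\<in>supp x. coord x c * (k c * of_bool (e = g c)))" for e
    by (subst coord_linear) (simp_all add: assms(1-3) delta_def)
  have "coord (T x) (g c) = (\<Sum>c'\<in>supp x. if c' = c then coord x c * k c else 0)"
    unfolding * by (rule sum.cong) (use assms(4) in \<open>auto dest: injD\<close>)
  then show "coord (T x) (g c) = k c * coord x c"
    using finite_supp[of x] by (simp add: supp_def)
  show "e \<notin> range g \<Longrightarrow> coord (T x) e = 0"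
    unfolding * by (auto intro!: sum.neutral)
qed

lemma coord_dp1_left: "coord (divpow J1 f1 s * x) (a, b, c, d) = (if s \<le> a then dp_binom J1 s (a - s) * coord x (a - s, b, c, d) else 0)"
proof -
  define g :: "exponent \<Rightarrow> exponent" where "g = (\<lambda>(a, b, c, d). (s + a, b, c, d))"
  define k :: "exponent \<Rightarrow> ratfun" where "k = (\<lambda>(a, b, c, d). dp_binom J1 s a)"
  have L: "divpow J1 f1 s * L_h c = k c *\<^sub>q L_h (g c)" for c
    by (cases c) (simp add: L_h.simps g_def k_def divpow_divpow flip: mult.assoc)
  have "inj g" by (auto simp: inj_def g_def)
  note sh = coord_shift[of "\<lambda>x. divpow J1 f1 s * x" k g, OF distrib_left qscale_mult_right L this]
  show ?thesis
  proof (cases "s \<le> a")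
    case True
    then show ?thesis using sh(1)[of x "(a - s, b, c, d)"] by (simp add: g_def k_def)
  next
    case False
    then show ?thesis by (subst sh(2)) (auto simp: g_def)
  qed
qed

lemma coord_dp2_right: "coord (x * divpow J2 f2 t) (a, b, c, d) = (if t \<le> d then dp_binom J2 t (d - t) * coord x (a, b, c, d - t) else 0)"
proof -
  define g :: "exponent \<Rightarrow> exponent" where "g = (\<lambda>(a, b, c, d). (a, b, c, d + t))"
  define k :: "exponent \<Rightarrow> ratfun" where "k = (\<lambda>(a, b, c, d). dp_binom J2 t d)"
  have "divpow J2 f2 d * divpow J2 f2 t = divpow J2 f2 t * divpow J2 f2 d" for d
    by (simp add: divpow_def mult.commute flip: power_add add.commute[of t])
  then have L: "L_h c * divpow J2 f2 t = k c *\<^sub>q L_h (g c)" for c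
    by (cases c) (simp add: L_h.simps g_def k_def divpow_divpow mult.assoc add.commute[of t])
  have "inj g" by (auto simp: inj_def g_def)
  note sh = coord_shift[of "\<lambda>x. x * divpow J2 f2 t" k g, OF distrib_right qscale_mult_left L this]
  show ?thesis
  proof (cases "t \<le> d")
    case True
    then show ?thesis using sh(1)[of x "(a, b, c, d - t)"] by (simp add: g_def k_def)
  next
    case False
    then show ?thesis by (subst sh(2)) (auto simp: g_def)
  qed
qed

text \<open>Each coefficient is a single power of \<open>q\<close>, since the quantum integer of
  \<open>b + 2 * c + d\<close> splits into exactly the three contributions of \<open>F2\<close> and
  cancels the new denominator.\<close>

lemma coord_f2f1: "coord (divpow J2 f2 y * divpow J1 f1 x) (a, b, c, d)
  = of_bool (a + b + c = x \<and> b + 2 * c + d = y) * q ^ (2 * a * d + b * d + 2 * a * c)"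
proof (induction y arbitrary: a b c d)
  case 0
  have "coord (divpow J1 f1 x) = delta (x, 0, 0, 0)"
    using coord_L[of "(x, 0, 0, 0)"] by (simp add: L_h.simps)
  then show ?case by (auto simp: delta_def)
next
  case (Suc y)
  let ?x = "divpow J2 f2 y * divpow J1 f1 x"
  let ?e = "q ^ (2 * a * d + b * d + 2 * a * c)"
  have nz: "qint q (Suc y) \<noteq> 0" using qint_nz[of J2] by (simp only: qidx_values) simp
  have "coord (divpow J2 f2 (Suc y) * divpow J1 f1 x) (a, b, c, d) = inverse (qint q (Suc y)) * F2 (coord ?x) (a, b, c, d)"
    by (simp only: divpow_Suc qscale_mult_left mult.assoc coord_scale coord_f2 qidx_values)
  also have "F2 (coord ?x) (a, b, c, d) = of_bool (a + b + c = x \<and> b + 2 * c + d = Suc y) * (qint q (Suc y) * ?e)"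
  proof -
    have t1: "qint q b * coord ?x (a + 1, b - 1, c, d)
      = of_bool (a + b + c = x \<and> b + 2 * c + d = Suc y) * (qint q b * q ^ (d + 2 * c) * ?e)"
      unfolding Suc by (cases b) (auto simp: power_add algebra_simps power_double)
    have t2: "q ^ (2 * a) / q ^ b * qint q (2 * c) * coord ?x (a, b + 1, c - 1, d)
      = of_bool (a + b + c = x \<and> b + 2 * c + d = Suc y) * (qint q (2 * c) * q ^ d / q ^ b * ?e)"
      unfolding Suc by (cases c) (auto simp: power_add field_simps power_double)
    have t3: "q ^ (2 * a) / q ^ (2 * c) * qint q d * coord ?x (a, b, c, d - 1)
      = of_bool (a + b + c = x \<and> b + 2 * c + d = Suc y) * (qint q d / (q ^ b * q ^ (2 * c)) * ?e)"
      unfolding Suc by (cases d) (auto simp: power_add field_simps power_double)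
    have q: "qint q (b + 2 * c + d) = qint q b * q ^ (d + 2 * c) + qint q (2 * c) * q ^ d / q ^ b + qint q d / (q ^ b * q ^ (2 * c))"
    proof -
      have "qint q (m + n) = qint q n / q ^ m + q ^ n * qint q m" for m n
        using qint_add[of q n m] by (simp add: add.commute)
      from this[of "b + 2 * c" d] this[of b "2 * c"] show ?thesis
        by (simp only: power_add distrib_left distrib_right) (simp add: mult_ac)
    qed
    show ?thesis unfolding F2.simps t1 t2 t3
      using q by (auto simp: algebra_simps)
  qed
  finally show ?case using nz by simp
qed

definition gen_monomial :: "nat \<Rightarrow> nat \<Rightarrow> nat \<Rightarrow> nat \<Rightarrow> uq" where
  "gen_monomial s y x t = divpow J1 f1 s * (divpow J2 f2 y * divpow J1 f1 x) * divpow J2 f2 t"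

lemma ubar_gen_monomial [simp]: "ubar (gen_monomial s y x t) = gen_monomial s y x t"
  by (simp add: gen_monomial_def ubar_mult)

lemma coord_gen_monomial: "coord (gen_monomial s y x t) (a, b, c, d) = (if s \<le> a \<and> t \<le> d \<and> (a - s) + b + c = x \<and> b + 2 * c + (d - t) = y
  then dp_binom J1 s (a - s) * dp_binom J2 t (d - t) * q ^ (2 * (a - s) * (d - t) + b * (d - t) + 2 * (a - s) * c) else 0)"
  by (simp add: gen_monomial_def coord_dp2_right coord_dp1_left coord_f2f1)

subsection \<open>Triangularity of the bar involution\<close>

definition wt :: "exponent \<Rightarrow> nat \<times> nat" where
  "wt = (\<lambda>(a, b, c, d). (a + b + c, b + 2 * c + d))"

definition rev_exp :: "exponent \<Rightarrow> exponent" where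
  "rev_exp = (\<lambda>(a, b, c, d). (d, c, b, a))"

lemma rev_exp_rev_exp [simp]: "rev_exp (rev_exp c) = c"
  by (cases c) (simp add: rev_exp_def)

text \<open>The intersection of the two orders, so that one canonical basis element is triangular for both.\<close>

definition above :: "exponent \<Rightarrow> exponent \<Rightarrow> bool" where
  "above c e \<longleftrightarrow> wt c = wt e \<and> c \<prec> e \<and> rev_exp c \<prec> rev_exp e"

lemma prec_simp: "(a, b, c, d) \<prec> (a', b', c', d') \<longleftrightarrow>
  a < a' \<or> a = a' \<and> (b < b' \<or> b = b' \<and> (c < c' \<or> c = c' \<and> d < d'))"
  by (simp add: exponent_less_def)

lemma prec_irrefl: "\<not> c \<prec> c"
  by (cases c) (simp add: prec_simp)

lemma prec_trans: "c \<prec> c' \<Longrightarrow> c' \<prec> c'' \<Longrightarrow> c \<prec> c''"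
  by (cases c; cases c'; cases c'') (auto simp: prec_simp)

lemma above_irrefl: "\<not> above c c"
  by (simp add: above_def prec_irrefl)

lemma above_trans: "above c c' \<Longrightarrow> above c' c'' \<Longrightarrow> above c c''"
  unfolding above_def by (auto intro: prec_trans)

lemma finite_wt: "finite {c. wt c = m}"
proof (rule finite_subset)
  show "{c. wt c = m} \<subseteq> {..fst m} \<times> {..fst m} \<times> {..fst m} \<times> {..snd m}"
    by (auto simp: wt_def)
qed simp

lemma finite_above: "finite {e. above c e}"
  by (rule finite_subset[OF _ finite_wt[of "wt c"]]) (auto simp: above_def)

text \<open>Descending induction. It terminates because \<open>above\<close> stays within one
  weight, whereas lexicographic up-sets are infinite.\<close>

lemma above_induct [case_names above]:
  assumes "\<And>c. (\<And>e. above c e \<Longrightarrow> P e) \<Longrightarrow> P c" shows "P c"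
proof (induction "card {e. above c e}" arbitrary: c rule: less_induct)
  case less
  have "P e" if e: "above c e" for e
  proof (rule less)
    have "{e'. above e e'} \<subset> {e. above c e}" using e above_trans above_irrefl by blast
    then show "card {e'. above e e'} < card {e. above c e}" by (rule psubset_card_mono[OF finite_above])
  qed
  then show ?case using assms by blast
qed

fun Mon :: "exponent \<Rightarrow> uq" where
  "Mon (a, b, c, d) = gen_monomial a (b + 2 * c) (b + c) d"

lemma ubar_Mon [simp]: "ubar (Mon c) = Mon c"
  by (cases c) simp

lemma coord_Mon_self: "coord (Mon c) c = 1"
  by (cases c) (simp add: coord_gen_monomial)

text \<open>Let \<open>i\<close> and \<open>j\<close> be the increases of the first and last
  exponent; equality of weights forces \<open>c2 + j = c' + i\<close>. If only \<open>j\<close> is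
  positive, the second exponent grows by \<open>j\<close>; if only \<open>i\<close> is positive, the
  third grows by \<open>i\<close>. So both reading directions see an increase first.\<close>

lemma coord_Mon_above: "coord (Mon c) e \<noteq> 0 \<Longrightarrow> e = c \<or> above c e"
proof -
  assume nz: "coord (Mon c) e \<noteq> 0"
  obtain a b c' d where c: "c = (a, b, c', d)" by (cases c)
  obtain a2 b2 c2 d2 where e: "e = (a2, b2, c2, d2)" by (cases e)
  have *: "a \<le> a2" "d \<le> d2" "(a2 - a) + b2 + c2 = b + c'" "b2 + 2 * c2 + (d2 - d) = b + 2 * c'"
    using nz unfolding c e by (auto simp: coord_gen_monomial split: if_splits)
  have "wt c = wt e" using * by (auto simp: c e wt_def)
  moreover have "e = c \<or> c \<prec> e \<and> rev_exp c \<prec> rev_exp e"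
  proof -
    obtain i j where ij: "a2 = a + i" "d2 = d + j" using *(1,2) by (metis le_iff_add)
    then have 1: "i + b2 + c2 = b + c'" "b2 + 2 * c2 + j = b + 2 * c'" using * by simp_all
    then have 2: "c2 + j = c' + i" by linarith
    show ?thesis
      unfolding c e rev_exp_def prod.case prec_simp prod.inject ij using 1 2
      by (cases "i = 0"; cases "j = 0"; simp; linarith?)
  qed
  ultimately show ?thesis by (auto simp: above_def)
qed

lemma coord_Mon_Lq: "coord (Mon c) e \<in> Lq"
  by (cases c; cases e) (auto simp: coord_gen_monomial intro!: Lq_mult Lq_power dp_binom_Lq)

definition bar_tri :: "uq \<Rightarrow> exponent \<Rightarrow> bool" where
  "bar_tri x c \<longleftrightarrow> (\<forall>e. coord x e \<in> Lq \<and> (coord x e \<noteq> 0 \<longrightarrow> e = c \<or> above c e))"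

lemma Mon_expand: "L_h c = Mon c - (\<Sum>e | above c e. coord (Mon c) e *\<^sub>q L_h e)"
proof -
  have "supp (Mon c) \<subseteq> insert c {e. above c e}"
    unfolding supp_def using coord_Mon_above[of c] by blast
  then have "Mon c = (\<Sum>e\<in>insert c {e. above c e}. coord (Mon c) e *\<^sub>q L_h e)"
    by (intro PBW_expansion_on) (simp_all add: finite_above)
  also have "\<dots> = L_h c + (\<Sum>e | above c e. coord (Mon c) e *\<^sub>q L_h e)"
    using finite_above above_irrefl by (simp add: coord_Mon_self)
  finally show ?thesis by (simp add: algebra_simps)
qed

text \<open>The monomial is bar-invariant, so the bar image of \<open>L_h c\<close> is
  \<open>Mon c\<close> minus conjugated multiples of the bar images at higher indices, which are
  triangular by induction.\<close>

lemma bar_L_tri: "coord (ubar (L_h c)) c = 1 \<and> bar_tri (ubar (L_h c)) c"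
proof (induction c rule: above_induct)
  case (above c)
  have *: "coord (ubar (L_h c)) e' = coord (Mon c) e' - (\<Sum>e | above c e. barK (coord (Mon c) e) * coord (ubar (L_h e)) e')" for e'
    by (subst Mon_expand) (simp add: ubar_diff ubar_sum coord_diff coord_sum)
  have z: "coord (ubar (L_h e)) e' = 0" if "above c e" "\<not> above c e'" for e e'
    using above[OF that(1)] that above_trans unfolding bar_tri_def by blast
  have "bar_tri (ubar (L_h c)) c"
    unfolding bar_tri_def
  proof (intro allI conjI impI)
    fix e' show "coord (ubar (L_h c)) e' \<in> Lq"
      unfolding * using above by (intro Lq_diff Lq_sum Lq_mult Lq_bar coord_Mon_Lq) (simp add: bar_tri_def)
    assume nz: "coord (ubar (L_h c)) e' \<noteq> 0"
    show "e' = c \<or> above c e'"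
    proof (rule ccontr)
      assume n: "\<not> (e' = c \<or> above c e')"
      then have "(\<Sum>e | above c e. barK (coord (Mon c) e) * coord (ubar (L_h e)) e') = 0"
        by (auto intro!: sum.neutral simp: z)
      moreover have "coord (Mon c) e' = 0" using n coord_Mon_above by blast
      ultimately show False using nz unfolding * by simp
    qed
  qed
  moreover have "(\<Sum>e | above c e. barK (coord (Mon c) e) * coord (ubar (L_h e)) c) = 0"
    by (auto intro!: sum.neutral simp: z above_irrefl)
  ultimately show ?case by (simp add: * coord_Mon_self)
qed

lemma coord_ubar: "coord (ubar x) e = (\<Sum>c\<in>supp x. barK (coord x c) * coord (ubar (L_h c)) e)"
  by (subst PBW_expansion[of x]) (simp add: ubar_sum coord_sum)

lemma wf_prec: "wf {(c, e). c \<prec> e}"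
proof -
  have "{(c, e). c \<prec> e} = less_than <*lex*> less_than <*lex*> less_than <*lex*> less_than"
    by (auto simp: exponent_less_def)
  then show ?thesis by (simp add: wf_lex_prod)
qed

text \<open>The uniqueness argument for canonical bases: triangularity makes the coefficient at a
  minimal index of the support bar-invariant, and \<open>qZq\<close> contains no nonzero invariant.
  Every later identification of canonical elements ends here.\<close>

lemma bar_fixed_small: assumes "ubar x = x" "\<And>c. coord x c \<in> qZq" shows "x = 0"
proof (rule ccontr)
  assume "x \<noteq> 0"
  then have "supp x \<noteq> {}" using PBW_expansion[of x] by auto
  then obtain c where c: "c \<in> supp x" "\<And>e. e \<prec> c \<Longrightarrow> e \<notin> supp x"
    using wfE_min[OF wf_prec, of _ "supp x"] by (metis (mono_tags, lifting) case_prodI ex_in_conv mem_Collect_eq)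
  have "coord x c = (\<Sum>e\<in>supp x. barK (coord x e) * coord (ubar (L_h e)) c)"
    using coord_ubar[of x c] assms(1) by simp
  also have "\<dots> = (\<Sum>e\<in>supp x. if e = c then barK (coord x c) else 0)"
  proof (rule sum.cong[OF refl])
    fix e assume e: "e \<in> supp x"
    have "coord (ubar (L_h e)) c = 0" if "e \<noteq> c"
    proof (rule ccontr)
      assume "coord (ubar (L_h e)) c \<noteq> 0"
      then have "above e c" using bar_L_tri[of e] that by (auto simp: bar_tri_def)
      then show False using c(2) e by (auto simp: above_def)
    qed
    then show "barK (coord x e) * coord (ubar (L_h e)) c = (if e = c then barK (coord x c) else 0)"
      using bar_L_tri[of c] by auto
  qed
  also have "\<dots> = barK (coord x c)" using c(1) by simp
  finally have "coord x c = 0" using assms(2) barK_eq_self_qZq by metis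
  then show False using c(1) by (simp add: supp_def)
qed

definition is_can :: "uq \<Rightarrow> exponent \<Rightarrow> bool" where
  "is_can x c \<longleftrightarrow> ubar x = x \<and> coord x c = 1 \<and> (\<forall>e. e \<noteq> c \<longrightarrow> coord x e \<in> qZq \<and> (coord x e \<noteq> 0 \<longrightarrow> above c e))"

lemma is_can_tri: "is_can x c \<Longrightarrow> bar_tri x c"
  unfolding is_can_def bar_tri_def by (metis Lq_1 Zq_Lq qZq_Zq)

text \<open>Sweeps an up-closed set from below. At a minimal index the bar-invariant part
  \<open>g\<close> of the coefficient is cancelled by \<open>g\<close> times the canonical element
  there, which otherwise affects only indices above.\<close>

lemma is_can_reduce:
  assumes "finite T" "\<And>c. c \<in> T \<Longrightarrow> \<exists>x. is_can x c" "\<And>c e. c \<in> T \<Longrightarrow> above c e \<Longrightarrow> e \<in> T"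
    and "ubar y = y" "\<And>e. coord y e \<in> Lq"
  shows "\<exists>z. ubar z = z \<and> supp z \<subseteq> T \<and> (\<forall>e\<in>T. coord (y - z) e \<in> qZq)"
  using assms
proof (induction "card T" arbitrary: T y)
  case 0
  then show ?case by (intro exI[of _ 0]) (simp add: supp_def)
next
  case (Suc n)
  then have "T \<noteq> {}" by auto
  then obtain c where c: "c \<in> T" "\<And>e. e \<prec> c \<Longrightarrow> e \<notin> T"
    using wfE_min[OF wf_prec, of _ T] by (metis (mono_tags, lifting) case_prodI ex_in_conv mem_Collect_eq)
  obtain x where x: "is_can x c" using Suc.prems(2) c(1) by blast
  obtain g where g: "g \<in> Lq" "barK g = g" "coord y c - g \<in> qZq" using Suc.prems(5) Lq_split by blast
  let ?y = "y - g *\<^sub>q x" and ?T = "T - {c}"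
  have "\<exists>z. ubar z = z \<and> supp z \<subseteq> ?T \<and> (\<forall>e\<in>?T. coord (?y - z) e \<in> qZq)"
  proof (rule Suc.hyps)
    show "n = card ?T" using Suc.hyps(2) c(1) Suc.prems(1) by simp
    show "finite ?T" using Suc.prems(1) by simp
    show "\<exists>x. is_can x c'" if "c' \<in> ?T" for c' using that Suc.prems(2) by auto
    show "e \<in> ?T" if "c' \<in> ?T" "above c' e" for c' e
      using that Suc.prems(3)[of c' e] c(2)[of c'] unfolding above_def by blast
    show "ubar ?y = ?y" using Suc.prems(4) x g by (simp add: ubar_diff is_can_def)
    show "coord ?y e \<in> Lq" for e
      using is_can_tri[OF x] by (simp add: coord_diff) (intro Lq_diff Lq_mult Suc.prems(5) g(1), simp add: bar_tri_def)
  qed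
  then obtain z where z: "ubar z = z" "supp z \<subseteq> ?T" "\<forall>e\<in>?T. coord (?y - z) e \<in> qZq" by blast
  show ?case
  proof (intro exI[of _ "g *\<^sub>q x + z"] conjI ballI)
    show "ubar (g *\<^sub>q x + z) = g *\<^sub>q x + z" using x z g by (simp add: ubar_add is_can_def)
    show "supp (g *\<^sub>q x + z) \<subseteq> T"
    proof (rule subsetI, rule ccontr)
      fix e assume e: "e \<in> supp (g *\<^sub>q x + z)" "e \<notin> T"
      then have "coord z e = 0" using coord_notin[OF z(2)] by blast
      moreover have "coord x e = 0" using e(2) is_can_tri[OF x] Suc.prems(3)[OF c(1)] c(1) unfolding bar_tri_def by blast
      ultimately show False using e(1) by (simp add: supp_def coord_add)
    qed
    fix e assume "e \<in> T"
    show "coord (y - (g *\<^sub>q x + z)) e \<in> qZq"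
    proof (cases "e = c")
      case True
      have "coord z c = 0" using coord_notin[OF z(2), of c] by simp
      then show ?thesis using True g(3) x by (simp add: coord_diff coord_add is_can_def)
    next
      case False
      then show ?thesis using z(3) \<open>e \<in> T\<close> by (simp add: diff_diff_eq)
    qed
  qed
qed

lemma is_can_ex: "\<exists>x. is_can x c"
proof (induction c rule: above_induct)
  case (above c)
  have "\<exists>z. ubar z = z \<and> supp z \<subseteq> {e. above c e} \<and> (\<forall>e\<in>{e. above c e}. coord (Mon c - z) e \<in> qZq)"
    by (rule is_can_reduce) (use above above_trans finite_above coord_Mon_Lq in auto)
  then obtain z where z: "ubar z = z" "supp z \<subseteq> {e. above c e}" "\<And>e. above c e \<Longrightarrow> coord (Mon c - z) e \<in> qZq" by auto
  have z0: "coord z e = 0" if "\<not> above c e" for e using coord_notin[OF z(2)] that by simp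
  have "is_can (Mon c - z) c"
    unfolding is_can_def
  proof (intro conjI allI impI)
    show "ubar (Mon c - z) = Mon c - z" by (simp add: ubar_diff z)
    show "coord (Mon c - z) c = 1" by (simp add: coord_diff coord_Mon_self z0 above_irrefl)
    fix e assume e: "e \<noteq> c"
    then have n: "coord (Mon c - z) e = 0" if "\<not> above c e"
      using that z0 coord_Mon_above[of c e] by (auto simp: coord_diff)
    then show "coord (Mon c - z) e \<in> qZq" using z(3) by (cases "above c e") auto
    show "above c e" if "coord (Mon c - z) e \<noteq> 0" using n that by blast
  qed
  then show ?case by blast
qed

subsection \<open>Skew derivations\<close>

text \<open>Up to scalars, \<open>E J1\<close> and \<open>E J2\<close> are the adjoints of \<open>F1\<close> and \<open>F2\<close> for the form in which the PBW basis
  is orthogonal with norms \<open>pbw_norm\<close>.\<close>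

fun E :: "idx \<Rightarrow> coords \<Rightarrow> coords" where
  "E J1 w (a, b, c, d) = 1 / q ^ (2 * a) * w (a + 1, b, c, d)"
| "E J2 w (a, b, c, d) = (1 - q ^ (4 * a)) / q ^ b * w (a - 1, b + 1, c, d)
    + q ^ (2 * a) * (1 - q ^ (2 * b)) / (q ^ b * q ^ (2 * c)) * w (a, b - 1, c + 1, d)
    + q ^ (2 * a) / (q ^ (2 * c) * q ^ d) * w (a, b, c, d + 1)"

text \<open>The value is \<open>q\<close> raised to minus the pairing of the two simple
  roots.\<close>

fun twist :: "idx \<Rightarrow> idx \<Rightarrow> ratfun" where
  "twist J1 J1 = 1 / q ^ 4"
| "twist J2 J2 = 1 / q ^ 2"
| "twist J1 J2 = q ^ 2"
| "twist J2 J1 = q ^ 2"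

lemma twist_sym: "twist i j = twist j i"
  by (cases i; cases j) simp_all

lemma power_quadruple: "x ^ (4 * n) = x ^ n * x ^ n * x ^ n * x ^ n" "x ^ (n * 4) = x ^ n * x ^ n * x ^ n * x ^ n"
  for x :: "'a :: monoid_mult"
proof -
  show *: "x ^ (4 * n) = x ^ n * x ^ n * x ^ n * x ^ n" for n
  proof -
    have "4 * n = n + n + n + n" by simp
    then show ?thesis by (simp only: power_add)
  qed
  show "x ^ (n * 4) = x ^ n * x ^ n * x ^ n * x ^ n" using * by (simp add: mult.commute)
qed

lemma power8: "x ^ 8 = x * x * x * x * x * x * x * x" for x :: "'a :: monoid_mult"
  by (simp add: eval_nat_numeral mult.assoc)

lemma power12: "x ^ 12 = x * x * x * x * x * x * x * x * x * x * x * x" for x :: "'a :: monoid_mult"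
  by (simp add: eval_nat_numeral mult.assoc)

lemma qint_Suc'_q2: "qint (q^2) (Suc n) = qint (q^2) n / q^2 + q ^ (2 * n)"
  using qint_add[of "q^2" n 1] by (simp add: power_mult)

text \<open>With the next three lemmas, these are the q-boson relations; transported to the algebra
  they become the skew Leibniz rule \<open>skder_gen\<close>.\<close>

lemma E1_F1: "E J1 (F1 w) e = 1 / q ^ 4 * F1 (E J1 w) e + w e"
proof -
  obtain a b c d where e: "e = (a, b, c, d)" by (cases e)
  have 1: "qint (q * q) (Suc n) = qint (q * q) n / (q * q) + q ^ n * q ^ n" for n
    using qint_Suc'_q2[of n] by (simp add: power2_eq_square power_double)
  show ?thesis
    by (cases a) (simp_all add: e 1 field_simps power2_eq_square power4_eq_xxxx power_double)
qed

lemma E1_F2: "E J1 (F2 w) e = q ^ 2 * F2 (E J1 w) e"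
proof -
  obtain a b c d where e: "e = (a, b, c, d)" by (cases e)
  show ?thesis
    by (simp add: e field_simps power2_eq_square power_double)
qed

lemma E2_F1: "E J2 (F1 w) e = q ^ 2 * F1 (E J2 w) e"
proof -
  obtain a b c d where e: "e = (a, b, c, d)" by (cases e)
  show ?thesis
    by (cases a) (simp_all add: e qint_qq field_simps power2_eq_square power4_eq_xxxx power_double power_quadruple power_add power8)
qed

lemma E2_F2: "E J2 (F2 w) e = 1 / q ^ 2 * F2 (E J2 w) e + w e"
proof -
  obtain a b c d where e: "e = (a, b, c, d)" by (cases e)
  have "E J2 (F2 w) e = 1 / q ^ 2 * F2 (E J2 w) e + q_diff_inv * (q - 1 / q) * w e"
    by (cases a; cases b; cases c; cases d)
      (simp_all add: e qint_q field_simps power2_eq_square power4_eq_xxxx power_double power_quadruple power_add power8)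
  moreover have "q_diff_inv * (q - 1 / q) = 1" using q_diff_inv_eq(2) by (simp add: algebra_simps)
  ultimately show ?thesis by simp
qed

definition finite_coords :: "coords \<Rightarrow> bool" where
  "finite_coords w \<longleftrightarrow> finite {c. w c \<noteq> 0}"

lemma finite_coords_coord [simp]: "finite_coords (coord x)"
  using finite_supp[of x] by (simp add: finite_coords_def supp_def)

lemma finite_coords_E: assumes "finite_coords w" shows "finite_coords (E i w)"
proof -
  let ?S = "{c. w c \<noteq> 0}"
  let ?T = "(\<lambda>(a, b, c, d). (a - 1, b, c, d)) ` ?S \<union> (\<lambda>(a, b, c, d). (a + 1, b - 1, c, d)) ` ?S
    \<union> (\<lambda>(a, b, c, d). (a, b + 1, c - 1, d)) ` ?S \<union> (\<lambda>(a, b, c, d). (a, b, c, d - 1)) ` ?S"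
  have "E i w e = 0" if n: "e \<notin> ?T" for e
  proof -
    obtain a b c d where e: "e = (a, b, c, d)" by (cases e)
    have "w (a + 1, b, c, d) = 0" using n unfolding e by force
    moreover have "w (a - 1, b + 1, c, d) = 0" if "a \<noteq> 0" using n that unfolding e by force
    moreover have "w (a, b - 1, c + 1, d) = 0" if "b \<noteq> 0" using n that unfolding e by force
    moreover have "w (a, b, c, d + 1) = 0" using n unfolding e by force
    ultimately show ?thesis unfolding e by (cases i; cases "a = 0"; cases "b = 0") simp_all
  qed
  then have "{e. E i w e \<noteq> 0} \<subseteq> ?T" by blast
  then show ?thesis unfolding finite_coords_def by (rule finite_subset) (use assms in \<open>simp add: finite_coords_def\<close>)
qed

definition of_coords :: "coords \<Rightarrow> uq" where
  "of_coords w = (\<Sum>c | w c \<noteq> 0. w c *\<^sub>q L_h c)"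

lemma coord_of_coords: assumes "finite_coords w" shows "coord (of_coords w) = w"
proof
  fix e
  have "coord (of_coords w) e = (\<Sum>c | w c \<noteq> 0. if e = c then w e else 0)"
    unfolding of_coords_def coord_sum by (rule sum.cong) (simp_all add: delta_def)
  also have "\<dots> = w e" using assms by (simp add: finite_coords_def)
  finally show "coord (of_coords w) e = w e" .
qed

text \<open>Pulled back from coordinates to the algebra, where it can be conjugated by
  \<open>star\<close>. This is possible because \<open>E i\<close> preserves finite support.\<close>

definition skder :: "idx \<Rightarrow> uq \<Rightarrow> uq" where
  "skder i x = of_coords (E i (coord x))"

lemma coord_skder [simp]: "coord (skder i x) = E i (coord x)"
  by (simp add: skder_def coord_of_coords finite_coords_E)

lemma lin_E: "linear_op (E i)"
proof -
  have "E i (\<lambda>e. v e + w e) e = E i v e + E i w e" "E i (\<lambda>e. c * v e) e = c * E i v e" for c v w e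
    by (cases e; cases i; simp add: distrib_left mult.left_commute)+
  then show ?thesis by (auto simp: linear_op_def)
qed

lemma coord_add_fun: "coord (x + y) = (\<lambda>e. coord x e + coord y e)" and coord_scale_fun: "coord (k *\<^sub>q x) = (\<lambda>e. k * coord x e)"
  by (simp_all add: fun_eq_iff coord_add)

lemma skder_add: "skder i (x + y) = skder i x + skder i y"
  by (rule coord_eqI) (simp add: coord_add_fun lin_add[OF lin_E])

lemma skder_scale [simp]: "skder i (k *\<^sub>q x) = k *\<^sub>q skder i x"
  by (rule coord_eqI) (simp add: coord_scale_fun lin_scale[OF lin_E])

lemma skder_0 [simp]: "skder i 0 = 0"
  using skder_scale[of i 0 0] by (simp del: skder_scale)

lemma skder_1 [simp]: "skder i 1 = 0"
proof (rule coord_eqI)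
  fix e :: exponent
  obtain a b c d where e: "e = (a, b, c, d)" by (cases e)
  show "coord (skder i 1) e = coord 0 e" by (cases i) (simp_all add: e coord_1 delta_def)
qed

lemma skder_gen: "skder i (gen j * x) = twist i j *\<^sub>q (gen j * skder i x) + (if i = j then x else 0)"
proof (rule coord_eqI)
  fix e
  show "coord (skder i (gen j * x)) e = coord (twist i j *\<^sub>q (gen j * skder i x) + (if i = j then x else 0)) e"
    by (cases i; cases j) (simp_all add: coord_gen coord_add E1_F1 E1_F2 E2_F1 E2_F2)
qed

text \<open>The eigenvalue of a Cartan element: \<open>q\<close> raised to minus the pairing of the
  simple root \<open>j\<close> with the weight of the exponent.\<close>

fun wt_char :: "idx \<Rightarrow> exponent \<Rightarrow> ratfun" where
  "wt_char J1 (a, b, c, d) = q ^ (2 * (b + 2 * c + d)) / q ^ (4 * (a + b + c))"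
| "wt_char J2 (a, b, c, d) = q ^ (2 * (a + b + c)) / q ^ (2 * (b + 2 * c + d))"

definition wt_twist :: "idx \<Rightarrow> uq \<Rightarrow> uq" where
  "wt_twist j x = of_coords (\<lambda>c. wt_char j c * coord x c)"

lemma coord_wt_twist [simp]: "coord (wt_twist j x) e = wt_char j e * coord x e"
proof -
  have "finite_coords (\<lambda>c. wt_char j c * coord x c)"
    using finite_coords_coord[of x] unfolding finite_coords_def by (rule finite_subset[rotated]) auto
  then show ?thesis by (simp add: wt_twist_def coord_of_coords)
qed

lemma wt_twist_add: "wt_twist j (x + y) = wt_twist j x + wt_twist j y"
  by (rule coord_eqI) (simp add: coord_add distrib_left)

lemma wt_twist_scale [simp]: "wt_twist j (k *\<^sub>q x) = k *\<^sub>q wt_twist j x"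
  by (rule coord_eqI) (simp add: mult.left_commute)

lemma wt_twist_1 [simp]: "wt_twist j 1 = 1"
  by (rule coord_eqI, cases j) (auto simp: coord_1 delta_def)

lemma wt_twist_gen: "wt_twist j (gen i * x) = twist j i *\<^sub>q (gen i * wt_twist j x)"
proof (rule coord_eqI)
  fix e :: exponent
  obtain a b c d where e: "e = (a, b, c, d)" by (cases e)
  show "coord (wt_twist j (gen i * x)) e = coord (twist j i *\<^sub>q (gen i * wt_twist j x)) e"
    by (cases j; cases i; cases a; cases b; cases c; cases d)
      (simp_all add: e coord_gen field_simps power_add power2_eq_square power4_eq_xxxx power8 power12)
qed

lemma wt_twist_gen_right: "wt_twist j (x * gen i) = twist j i *\<^sub>q (wt_twist j x * gen i)"
proof (induction x rule: uq_left_induct)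
  case one
  show ?case using wt_twist_gen[of j i 1] by simp
qed (simp_all add: wt_twist_gen mult.assoc mult.commute[of _ "twist j i"] distrib_right wt_twist_add qscale_add_right)

definition skder_right :: "idx \<Rightarrow> uq \<Rightarrow> uq" where
  "skder_right j x = star (skder j (star x))"

lemma skder_right_add: "skder_right j (x + y) = skder_right j x + skder_right j y"
  by (simp add: skder_right_def star_add skder_add)

lemma skder_right_scale [simp]: "skder_right j (k *\<^sub>q x) = k *\<^sub>q skder_right j x"
  by (simp add: skder_right_def)

lemma skder_right_1 [simp]: "skder_right j 1 = 0" and skder_right_0 [simp]: "skder_right j 0 = 0"
  by (simp_all add: skder_right_def)

lemma skder_right_gen: "skder_right j (x * gen i) = twist j i *\<^sub>q (skder_right j x * gen i) + (if j = i then x else 0)"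
  by (simp add: skder_right_def star_mult skder_gen star_add)

text \<open>The mirrored derivation collects a twist for every letter to the right of the one it
  removes. Removing the leftmost letter therefore twists all of \<open>x\<close> by its
  weight.\<close>

lemma skder_right_gen_left: "skder_right j (gen i * x) = gen i * skder_right j x + (if j = i then wt_twist j x else 0)"
proof (induction x rule: uq_right_induct)
  case one
  show ?case using skder_right_gen[of j 1 i] by simp
next
  case (gen k x)
  then show ?case
    by (simp add: skder_right_gen wt_twist_gen_right distrib_left distrib_right qscale_add_right flip: mult.assoc)
qed (simp_all add: distrib_left skder_right_add wt_twist_add qscale_add_right)

lemma skder_wt_twist: "skder i (wt_twist j x) = twist i j *\<^sub>q wt_twist j (skder i x)"
proof (induction x rule: uq_left_induct)
  case one
  show ?case using wt_twist_scale[of j 0 0] by (simp del: wt_twist_scale)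
next
  case (gen k x)
  then show ?case
    using wt_twist_scale[of j 0 0]
    by (simp add: skder_gen wt_twist_gen wt_twist_add qscale_add_right twist_sym[of j] mult_ac)
qed (simp_all add: skder_add wt_twist_add qscale_add_right mult.commute[of _ "twist i j"])

text \<open>Both composites obey the same recursion under left multiplication by a generator; the
  terms where the mirrored derivation removes that generator agree by \<open>skder_wt_twist\<close>.
  The \<open>star\<close> invariance of the form rests on this.\<close>

lemma skder_skder_right: "skder i (skder_right j x) = skder_right j (skder i x)"
proof (induction x rule: uq_left_induct)
  case (gen k x)
  then show ?case
    by (simp add: skder_gen skder_right_gen_left skder_add skder_right_add skder_wt_twist distrib_left qscale_add_right)
qed (simp_all add: skder_add skder_right_add)

subsection \<open>The bilinear form\<close>

text \<open>The norm of an \<open>m\<close>-th divided power, normalized so that a root vector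
  itself has norm \<open>1 / (1 - v ^ 2)\<close>.\<close>

definition norm_factor :: "ratfun \<Rightarrow> nat \<Rightarrow> ratfun" where
  "norm_factor v m = (\<Prod>k=1..m. 1 / (1 - v ^ (2 * k)))"

fun pbw_norm :: "exponent \<Rightarrow> ratfun" where
  "pbw_norm (a, b, c, d) = norm_factor (q^2) a * norm_factor q b * norm_factor (q^2) c * norm_factor q d"

lemma norm_factor_0 [simp]: "norm_factor v 0 = 1"
  by (simp add: norm_factor_def)

lemma norm_factor_Suc: "norm_factor v (Suc m) = norm_factor v m / (1 - v ^ (2 * Suc m))"
  by (simp add: norm_factor_def)

lemma value0_pbw_norm: "value0 (pbw_norm c) 1"
proof -
  have *: "value0 (norm_factor v m) 1" if "value0 v 0" for v m
  proof (induction m)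
    case (Suc m)
    have "value0 (norm_factor v m / (1 - v ^ (2 * Suc m))) (1 / (1 - 0 ^ (2 * Suc m)))"
      by (intro value0_divide value0_diff value0_power that Suc) auto
    then show ?case unfolding norm_factor_Suc by simp
  qed simp
  have "value0 (q^2) (0^2)" by (intro value0_power value0_q)
  then have "value0 (q^2) 0" by simp
  note ** = *[OF this] *[OF value0_q]
  obtain a b c' d where c: "c = (a, b, c', d)" by (cases c)
  have "value0 (pbw_norm c) (1 * 1 * 1 * 1)" unfolding c pbw_norm.simps by (intro value0_mult **)
  then show ?thesis by simp
qed

definition pbw_form :: "uq \<Rightarrow> uq \<Rightarrow> ratfun" where
  "pbw_form x y = (\<Sum>c\<in>supp x. coord x c * coord y c * pbw_norm c)"

lemma pbw_form_on: assumes "finite A" "supp x \<subseteq> A" shows "pbw_form x y = (\<Sum>c\<in>A. coord x c * coord y c * pbw_norm c)"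
  unfolding pbw_form_def by (rule sum.mono_neutral_left) (use assms in \<open>auto simp: supp_def\<close>)

lemma pbw_form_sym: "pbw_form x y = pbw_form y x"
proof -
  have "pbw_form x y = (\<Sum>c\<in>supp x \<union> supp y. coord x c * coord y c * pbw_norm c)" by (rule pbw_form_on) auto
  also have "\<dots> = pbw_form y x" by (subst pbw_form_on[of "supp x \<union> supp y" y]) (auto simp: mult.commute)
  finally show ?thesis .
qed

lemma pbw_form_add_right: "pbw_form x (y + z) = pbw_form x y + pbw_form x z"
  by (simp add: pbw_form_def coord_add distrib_left distrib_right sum.distrib)

lemma pbw_form_scale_right [simp]: "pbw_form x (k *\<^sub>q y) = k * pbw_form x y"
  by (simp add: pbw_form_def sum_distrib_left mult_ac)

lemma pbw_form_add_left: "pbw_form (x + y) z = pbw_form x z + pbw_form y z"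
  using pbw_form_add_right pbw_form_sym by metis

lemma pbw_form_scale_left [simp]: "pbw_form (k *\<^sub>q x) y = k * pbw_form x y"
  using pbw_form_scale_right pbw_form_sym by metis

lemma pbw_form_0_right [simp]: "pbw_form x 0 = 0"
  by (simp add: pbw_form_def)

lemma pbw_form_L_right: "pbw_form x (L_h c) = coord x c * pbw_norm c"
proof -
  have "pbw_form x (L_h c) = (\<Sum>e\<in>supp x. if e = c then coord x c * pbw_norm c else 0)"
    unfolding pbw_form_def by (rule sum.cong) (auto simp: delta_def)
  then show ?thesis using finite_supp[of x] by (simp add: supp_def)
qed

lemma pbw_form_1_left: "pbw_form 1 x = coord x (0, 0, 0, 0)"
  using pbw_form_L_right[of x "(0,0,0,0)"] by (simp add: pbw_form_sym[of 1] L_h.simps)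

lemma der1_L: "skder J1 (L_h (a, b, c, d)) = (if a = 0 then 0 else (1 / q ^ (2 * (a - 1))) *\<^sub>q L_h (a - 1, b, c, d))"
proof (rule coord_eqI)
  fix e :: exponent
  obtain a' b' c' d' where e: "e = (a', b', c', d')" by (cases e)
  show "coord (skder J1 (L_h (a, b, c, d))) e = coord (if a = 0 then 0 else (1 / q ^ (2 * (a - 1))) *\<^sub>q L_h (a - 1, b, c, d)) e"
    by (cases a) (auto simp: e delta_def)
qed

lemma der2_L: "skder J2 (L_h (a, b, c, d)) =
    (if b = 0 then 0 else ((1 - q ^ (4 * (a + 1))) / q ^ (b - 1)) *\<^sub>q L_h (a + 1, b - 1, c, d))
  + (if c = 0 then 0 else (q ^ (2 * a) * (1 - q ^ (2 * (b + 1))) / (q ^ (b + 1) * q ^ (2 * (c - 1)))) *\<^sub>q L_h (a, b + 1, c - 1, d))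
  + (if d = 0 then 0 else (q ^ (2 * a) / (q ^ (2 * c) * q ^ (d - 1))) *\<^sub>q L_h (a, b, c, d - 1))"
  (is "_ = ?R")
proof (rule coord_eqI)
  fix e :: exponent
  obtain a' b' c' d' where e: "e = (a', b', c', d')" by (cases e)
  have "coord ?R e = (if b = 0 then 0 else ((1 - q ^ (4 * (a + 1))) / q ^ (b - 1)) * delta (a + 1, b - 1, c, d) e)
  + (if c = 0 then 0 else (q ^ (2 * a) * (1 - q ^ (2 * (b + 1))) / (q ^ (b + 1) * q ^ (2 * (c - 1)))) * delta (a, b + 1, c - 1, d) e)
  + (if d = 0 then 0 else (q ^ (2 * a) / (q ^ (2 * c) * q ^ (d - 1))) * delta (a, b, c, d - 1) e)"
    by (simp add: coord_add)
  also have "\<dots> = coord (skder J2 (L_h (a, b, c, d))) e"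
  proof -
    have 1: "(if b = 0 then 0 else ((1 - q ^ (4 * (a + 1))) / q ^ (b - 1)) * delta (a + 1, b - 1, c, d) e)
      = (1 - q ^ (4 * a')) / q ^ b' * delta (a, b, c, d) (a' - 1, b' + 1, c', d')"
      by (cases b; cases a') (auto simp: e delta_def)
    have 2: "(if c = 0 then 0 else (q ^ (2 * a) * (1 - q ^ (2 * (b + 1))) / (q ^ (b + 1) * q ^ (2 * (c - 1)))) * delta (a, b + 1, c - 1, d) e)
      = q ^ (2 * a') * (1 - q ^ (2 * b')) / (q ^ b' * q ^ (2 * c')) * delta (a, b, c, d) (a', b' - 1, c' + 1, d')"
      by (cases c; cases b') (auto simp: e delta_def)
    have 3: "(if d = 0 then 0 else (q ^ (2 * a) / (q ^ (2 * c) * q ^ (d - 1))) * delta (a, b, c, d - 1) e)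
      = q ^ (2 * a') / (q ^ (2 * c') * q ^ d') * delta (a, b, c, d) (a', b', c', d' + 1)"
      by (cases d) (auto simp: e delta_def)
    show ?thesis unfolding 1 2 3 by (simp add: e)
  qed
  finally show "coord (skder J2 (L_h (a, b, c, d))) e = coord ?R e" ..
qed

fun form_scale :: "idx \<Rightarrow> ratfun" where
  "form_scale J1 = 1 / (1 - q ^ 4)"
| "form_scale J2 = 1 / (1 - q ^ 2)"

lemma one_minus_q_power [simp]: "1 - q ^ n = 0 \<longleftrightarrow> n = 0"
  using q_power_eq_1[of n] by (metis eq_iff_diff_eq_0)

lemma qint_alt: "qint q n * q ^ n = q * (1 - q ^ (2 * n)) / (1 - q ^ 2)"
  and qint_alt2: "qint (q^2) n * q ^ (2 * n) = q^2 * (1 - q ^ (4 * n)) / (1 - q ^ 4)"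
proof -
  have *: "qint v n * v ^ n = v * (1 - v ^ (2 * n)) / (1 - v ^ 2)" if "v \<noteq> 0" "1 - v^2 \<noteq> 0" for v
  proof -
    have "v - inverse v = - (1 - v^2) / v" using that by (simp add: field_simps power2_eq_square)
    then have "qint v n * v ^ n = (v ^ n - inverse v ^ n) * v ^ n / (- (1 - v^2) / v)"
      by (simp add: qint_def)
    also have "(v ^ n - inverse v ^ n) * v ^ n = - (1 - v ^ (2 * n))"
      using that by (simp add: power_double algebra_simps power_inverse)
    finally have "qint v n * v ^ n = - (1 - v ^ (2 * n)) / (- ((1 - v^2) / v))"
      by (simp only: minus_divide_left)
    also have "\<dots> = (1 - v ^ (2 * n)) / ((1 - v^2) / v)" by (rule minus_divide_divide)
    finally show ?thesis by (simp only: divide_divide_eq_right mult.commute)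
  qed
  show "qint q n * q ^ n = q * (1 - q ^ (2 * n)) / (1 - q ^ 2)"
    by (rule *) simp_all
  have "1 - (q^2)^2 \<noteq> 0" unfolding power_mult[symmetric] by simp
  from *[OF _ this] show "qint (q^2) n * q ^ (2 * n) = q^2 * (1 - q ^ (4 * n)) / (1 - q ^ 4)"
    by (simp flip: power_mult)
qed

text \<open>By orthogonality each term of \<open>F\<close> is compared with one term of
  \<open>E\<close>. The numerators of the quantum integers in \<open>F\<close> cancel factors of the
  norms, which leaves the scalar \<open>form_scale i\<close>.\<close>

lemma pbw_form_adjoint_L: "pbw_form (gen i * x) (L_h e) = form_scale i * pbw_form x (skder i (L_h e))"
proof -
  obtain a b c d where e: "e = (a, b, c, d)" by (cases e)
  have n1: "norm_factor (q^2) m = norm_factor (q^2) (Suc m) * (1 - q ^ (4 * Suc m))" for m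
  proof -
    have "(q^2) ^ (2 * Suc m) = q ^ (4 * Suc m)"
      unfolding power_mult[symmetric] by (rule arg_cong[where f = "(^) q"]) simp
    moreover have "1 - q ^ (4 * Suc m) \<noteq> 0" by (simp only: one_minus_q_power) simp
    ultimately show ?thesis unfolding norm_factor_Suc by simp
  qed
  have n2: "norm_factor q m = norm_factor q (Suc m) * (1 - q ^ (2 * Suc m))" for m
  proof -
    have "1 - q ^ (2 * Suc m) \<noteq> 0" by (simp only: one_minus_q_power) simp
    then show ?thesis unfolding norm_factor_Suc by simp
  qed
  have qa: "qint q (Suc m) = (1 - q ^ (2 * Suc m)) / (1 - q^2) / q ^ m" for m
    using qint_alt[of "Suc m"] by (simp add: nonzero_eq_divide_eq mult_ac)
  show ?thesis
  proof (cases i)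
    case J1
    show ?thesis
    proof (cases a)
      case 0
      then show ?thesis by (simp add: J1 e pbw_form_L_right coord_f1 der1_L)
    next
      case (Suc a')
      have "qint (q^2) (Suc a') = q^2 * (1 - q ^ (4 * Suc a')) / (1 - q ^ 4) / q ^ (2 * Suc a')"
        using qint_alt2[of "Suc a'"] by (simp add: field_simps)
      moreover have "norm_factor (q^2) (Suc a') = norm_factor (q^2) a' / (1 - q ^ (4 * Suc a'))"
        unfolding norm_factor_Suc power_mult[symmetric] by (rule arg_cong[where f = "\<lambda>n. norm_factor (q^2) a' / (1 - q ^ n)"]) simp
      moreover have "1 - q ^ (4 * Suc a') \<noteq> 0" by (simp only: one_minus_q_power) simp
      ultimately show ?thesis using Suc
        by (simp del: one_minus_q_power add: J1 e pbw_form_L_right coord_f1 der1_L power_add power2_eq_square)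
    qed
  next
    case J2
    have 1: "qint q b * coord x (a + 1, b - 1, c, d) * pbw_norm (a, b, c, d) = form_scale J2 *
       (if b = 0 then 0 else ((1 - q ^ (4 * (a + 1))) / q ^ (b - 1)) * (coord x (a + 1, b - 1, c, d) * pbw_norm (a + 1, b - 1, c, d)))"
    proof (cases b)
      case (Suc b')
      show ?thesis
        by (simp only: Suc n1[of a] n2[of b'] qa form_scale.simps pbw_norm.simps diff_Suc_1 Suc_eq_plus1[symmetric] nat.distinct if_False)
          (simp only: times_divide_eq_left times_divide_eq_right divide_divide_eq_left mult_ac mult_1_left)
    qed simp
    have 2: "q ^ (2 * a) / q ^ b * qint q (2 * c) * coord x (a, b + 1, c - 1, d) * pbw_norm (a, b, c, d) = form_scale J2 *
       (if c = 0 then 0 else (q ^ (2 * a) * (1 - q ^ (2 * (b + 1))) / (q ^ (b + 1) * q ^ (2 * (c - 1)))) * (coord x (a, b + 1, c - 1, d) * pbw_norm (a, b + 1, c - 1, d)))"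
    proof (cases c)
      case (Suc c')
      \<comment> \<open>The short-root quantum integer of the even number \<open>2 * c\<close> has
        numerator \<open>1 - q ^ (4 * c)\<close>, which is the factor occurring in the long-root
        norm.\<close>
      have "2 * Suc (Suc (2 * c')) = 4 * Suc c'" by simp
      have "qint q (2 * Suc c') = qint q (Suc (Suc (2 * c')))" by simp
      also have "\<dots> = (1 - q ^ (4 * Suc c')) / (1 - q^2) / (q * q ^ (2 * c'))"
        unfolding qa \<open>2 * Suc (Suc (2 * c')) = 4 * Suc c'\<close> by simp
      finally have qc: "qint q (2 * Suc c') = (1 - q ^ (4 * Suc c')) / (1 - q^2) / (q * q ^ (2 * c'))" .
      show ?thesis
        by (simp only: Suc n1[of c'] n2[of b] qc form_scale.simps pbw_norm.simps diff_Suc_1 Suc_eq_plus1[symmetric] nat.distinct if_False power_Suc[of q b])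
          (simp only: times_divide_eq_left times_divide_eq_right divide_divide_eq_left mult_ac mult_1_left)
    qed simp
    have 3: "q ^ (2 * a) / q ^ (2 * c) * qint q d * coord x (a, b, c, d - 1) * pbw_norm (a, b, c, d) = form_scale J2 *
       (if d = 0 then 0 else (q ^ (2 * a) / (q ^ (2 * c) * q ^ (d - 1))) * (coord x (a, b, c, d - 1) * pbw_norm (a, b, c, d - 1)))"
    proof (cases d)
      case (Suc d')
      show ?thesis
        by (simp only: Suc n2[of d'] qa form_scale.simps pbw_norm.simps diff_Suc_1 nat.distinct if_False)
          (simp only: times_divide_eq_left times_divide_eq_right divide_divide_eq_left mult_ac mult_1_left)
    qed simp
    show ?thesis
      using 1 2 3 by (simp only: J2 e pbw_form_L_right coord_f2 der2_L F2.simps distrib_right distrib_left pbw_form_add_right)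
        (simp add: pbw_form_L_right if_distrib[of "pbw_form x"])
  qed
qed

lemma pbw_form_adjoint: "pbw_form (gen i * x) y = form_scale i * pbw_form x (skder i y)"
  using in_PBW_span[of y]
  by (induction rule: PBW_span.induct) (simp_all add: pbw_form_adjoint_L pbw_form_add_right skder_add distrib_left)

lemma coord_gen_0: "coord (gen i * x) (0, 0, 0, 0) = 0"
  by (cases i) (simp_all add: coord_gen)

lemma coord_gen_right_0: "coord (x * gen i) (0, 0, 0, 0) = 0"
proof (induction x rule: uq_left_induct)
  case one
  show ?case using coord_gen_0[of i 1] by simp
qed (simp_all add: coord_gen_0 mult.assoc distrib_right coord_add)

lemma coord_star_0: "coord (star x) (0, 0, 0, 0) = coord x (0, 0, 0, 0)"
  by (induction x rule: uq_left_induct) (simp_all add: star_mult star_add coord_gen_0 coord_gen_right_0 coord_add)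

lemma coord_skder_0: "coord (skder j x) (0, 0, 0, 0) = coord (skder_right j x) (0, 0, 0, 0)"
proof (induction x rule: uq_left_induct)
  case (gen i x)
  have "wt_char i (0, 0, 0, 0) = 1" by (cases i) simp_all
  moreover have "coord (0 :: uq) = (\<lambda>e. 0)" by (simp add: fun_eq_iff)
  ultimately show ?case
    by (simp del: coord_skder add: skder_gen skder_right_gen_left coord_add coord_gen_0)
qed (simp_all del: coord_skder add: skder_add skder_right_add coord_add)

text \<open>The left adjoint peels the letters off \<open>x\<close>, and the resulting derivations
  pass the mirrored one by \<open>skder_skder_right\<close>. At \<open>x = 1\<close> only constant
  terms are left to compare.\<close>

lemma pbw_form_right_adjoint: "pbw_form (x * gen j) y = form_scale j * pbw_form x (skder_right j y)"
proof (induction x arbitrary: y rule: uq_left_induct)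
  case one
  show ?case using pbw_form_adjoint[of j 1 y] coord_skder_0[of j y] by (simp del: coord_skder add: pbw_form_1_left)
next
  case (gen i x)
  show ?case by (simp add: mult.assoc pbw_form_adjoint gen skder_skder_right)
qed (simp_all add: distrib_right pbw_form_add_left distrib_left)

lemma pbw_form_star: "pbw_form (star x) (star y) = pbw_form x y"
proof (induction x arbitrary: y rule: uq_left_induct)
  case one
  show ?case by (simp add: pbw_form_1_left coord_star_0)
next
  case (gen i x)
  have "pbw_form (star (gen i * x)) (star y) = form_scale i * pbw_form (star x) (star (skder i y))"
    by (simp add: star_mult pbw_form_right_adjoint skder_right_def)
  then show ?case by (simp add: gen pbw_form_adjoint)
qed (simp_all add: star_add pbw_form_add_left)

subsection \<open>Integrality\<close>

definition integral :: "uq \<Rightarrow> bool" where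
  "integral x \<longleftrightarrow> (\<forall>e. coord x e \<in> Lq)"

text \<open>Integrality inside the span of the PBW vectors without \<open>f1\<close>. There
  \<open>f122\<close> and \<open>f12\<close> merely q-commute, whereas moving \<open>f122\<close>
  past \<open>f1\<close> brings in \<open>kap\<close>, which is not a Laurent polynomial.\<close>

definition integral0 :: "uq \<Rightarrow> bool" where
  "integral0 x \<longleftrightarrow> (\<forall>e. coord x e \<in> Lq) \<and> (\<forall>a b c d. a \<noteq> 0 \<longrightarrow> coord x (a, b, c, d) = 0)"

lemma integral_0 [simp]: "integral 0" by (simp add: integral_def)
lemma integral_scale: "k \<in> Lq \<Longrightarrow> integral x \<Longrightarrow> integral (k *\<^sub>q x)" by (auto simp: integral_def)
lemma integral_add: "integral x \<Longrightarrow> integral y \<Longrightarrow> integral (x + y)" by (auto simp: integral_def coord_add)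
lemma integral_diff: "integral x \<Longrightarrow> integral y \<Longrightarrow> integral (x - y)" by (auto simp: integral_def coord_diff)
lemma integral_sum: "(\<And>i. i \<in> A \<Longrightarrow> integral (f i)) \<Longrightarrow> integral (sum f A)"
  by (induction A rule: infinite_finite_induct) (auto intro: integral_add)
lemma integral_L: "integral (L_h c)" by (simp add: integral_def delta_def)
lemma integral0_0 [simp]: "integral0 0" by (simp add: integral0_def)
lemma integral0_scale: "k \<in> Lq \<Longrightarrow> integral0 x \<Longrightarrow> integral0 (k *\<^sub>q x)" by (auto simp: integral0_def)
lemma integral0_add: "integral0 x \<Longrightarrow> integral0 y \<Longrightarrow> integral0 (x + y)" by (auto simp: integral0_def coord_add)
lemma integral0_sum: "(\<And>i. i \<in> A \<Longrightarrow> integral0 (f i)) \<Longrightarrow> integral0 (sum f A)"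
  by (induction A rule: infinite_finite_induct) (auto intro: integral0_add)
lemma integral0_L: "integral0 (L_h (0, b, c, d))" by (auto simp: integral0_def delta_def)
lemma integral0_intg: "integral0 x \<Longrightarrow> integral x" by (simp add: integral_def integral0_def)

lemma integral_linear:
  assumes "\<And>x y. T (x + y) = T x + T y" "\<And>k x. T (k *\<^sub>q x) = k *\<^sub>q T x"
    and "\<And>c. integral (T (L_h c))" "integral x"
  shows "integral (T x)"
  by (subst linear_expand[of T, OF assms(1,2)]) (use assms(3,4) in \<open>auto simp: integral_def[of x] intro!: integral_sum integral_scale\<close>)

lemma integral0_linear:
  assumes "\<And>x y. T (x + y) = T x + T y" "\<And>k x. T (k *\<^sub>q x) = k *\<^sub>q T x"
    and "\<And>b c d. integral0 (T (L_h (0, b, c, d)))" "integral0 x"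
  shows "integral0 (T x)"
proof (subst linear_expand[of T, OF assms(1,2)], rule integral0_sum)
  fix e assume "e \<in> supp x"
  moreover obtain a b c d where e: "e = (a, b, c, d)" by (cases e)
  ultimately have "a = 0" using assms(4) by (auto simp: supp_def integral0_def)
  then show "integral0 (coord x e *\<^sub>q T (L_h e))" using assms(3,4) e by (intro integral0_scale) (simp_all add: integral0_def[of x])
qed

lemma integral_f1_left: "integral x \<Longrightarrow> integral (divpow J1 f1 s * x)"
proof -
  assume "integral x"
  then have "coord (divpow J1 f1 s * x) (a, b, c, d) \<in> Lq" for a b c d
    by (auto simp: integral_def coord_dp1_left intro!: Lq_mult dp_binom_Lq)
  then show ?thesis by (auto simp: integral_def)
qed

lemma integral_f2_right: "integral x \<Longrightarrow> integral (x * divpow J2 f2 s)"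
proof -
  assume "integral x"
  then have "coord (x * divpow J2 f2 s) (a, b, c, d) \<in> Lq" for a b c d
    by (auto simp: integral_def coord_dp2_right intro!: Lq_mult dp_binom_Lq)
  then show ?thesis by (auto simp: integral_def)
qed

lemma q_commute_divpow:
  assumes "x * y = c *\<^sub>q (y * x)"
  shows "divpow i x m * divpow j y n = c ^ (m * n) *\<^sub>q (divpow j y n * divpow i x m)"
proof -
  have "x ^ m * y ^ n = (c ^ m) ^ n *\<^sub>q (y ^ n * x ^ m)"
    by (rule q_commute_power(1), rule q_commute_power(2), rule assms)
  then show ?thesis by (simp add: divpow_def power_mult mult_ac)
qed

lemma Lq_inv_q2: "1 / q ^ 2 \<in> Lq" by (intro Lq_divide_power) simp

lemma integral_f122_right: "integral x \<Longrightarrow> integral (x * divpow J1 f122 m)"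
proof (rule integral_linear[of "\<lambda>x. x * divpow J1 f122 m"])
  fix e show "integral (L_h e * divpow J1 f122 m)"
  proof -
    obtain a b c d where e: "e = (a, b, c, d)" by (cases e)
    have "L_h e * divpow J1 f122 m = (divpow J1 f1 a * divpow J2 f12 b * divpow J1 f122 c) * (divpow J2 f2 d * divpow J1 f122 m)"
      by (simp add: e L_h.simps mult.assoc)
    also have "\<dots> = ((1 / q^2) ^ (d * m)) *\<^sub>q (divpow J1 f1 a * divpow J2 f12 b * (divpow J1 f122 c * divpow J1 f122 m) * divpow J2 f2 d)"
      by (simp add: q_commute_divpow[OF f2_f122] mult.assoc)
    also have "\<dots> = ((1 / q^2) ^ (d * m) * dp_binom J1 c m) *\<^sub>q L_h (a, b, c + m, d)"
      by (simp add: divpow_divpow L_h.simps)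
    finally show ?thesis by (simp only:) (intro integral_scale Lq_mult Lq_power Lq_inv_q2 dp_binom_Lq integral_L)
  qed
qed (simp_all add: distrib_right)

lemma integral0_f122_left: "integral0 x \<Longrightarrow> integral0 (divpow J1 f122 m * x)"
proof (rule integral0_linear[of "\<lambda>x. divpow J1 f122 m * x"])
  fix b c d show "integral0 (divpow J1 f122 m * L_h (0, b, c, d))"
  proof -
    have "divpow J1 f122 m * L_h (0, b, c, d) = (divpow J1 f122 m * divpow J2 f12 b) * (divpow J1 f122 c * divpow J2 f2 d)"
      by (simp add: L_h.simps mult.assoc)
    also have "\<dots> = ((1 / q^2) ^ (m * b)) *\<^sub>q (divpow J2 f12 b * (divpow J1 f122 m * divpow J1 f122 c) * divpow J2 f2 d)"
      by (simp add: q_commute_divpow[OF f122_f12] mult.assoc)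
    also have "\<dots> = ((1 / q^2) ^ (m * b) * dp_binom J1 m c) *\<^sub>q L_h (0, b, m + c, d)"
      by (simp add: divpow_divpow L_h.simps)
    finally show ?thesis by (simp only:) (intro integral0_scale Lq_mult Lq_power Lq_inv_q2 dp_binom_Lq integral0_L)
  qed
qed (simp_all add: distrib_left)

lemma integral0_f12_left: "integral0 x \<Longrightarrow> integral0 (divpow J2 f12 m * x)"
proof (rule integral0_linear[of "\<lambda>x. divpow J2 f12 m * x"])
  fix b c d show "integral0 (divpow J2 f12 m * L_h (0, b, c, d))"
  proof -
    have "divpow J2 f12 m * L_h (0, b, c, d) = dp_binom J2 m b *\<^sub>q L_h (0, m + b, c, d)"
      by (simp add: L_h.simps divpow_divpow flip: mult.assoc)
    then show ?thesis by (simp only:) (intro integral0_scale dp_binom_Lq integral0_L)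
  qed
qed (simp_all add: distrib_left)

text \<open>The product of the \<open>q ^ j + 1 / q ^ j\<close> for \<open>j \<le> k\<close>, divided by \<open>q ^ (k * (k - 1) / 2)\<close>.\<close>

fun Wq :: "nat \<Rightarrow> ratfun" where
  "Wq 0 = 1"
| "Wq (Suc k) = Wq k * (q ^ Suc k + 1 / q ^ Suc k) / q ^ k"

lemma Wq_Lq: "Wq k \<in> Lq"
proof (induction k)
  case (Suc k)
  have "1 / q ^ Suc k \<in> Lq" by (intro Lq_divide_power) simp
  moreover have "q ^ Suc k \<in> Lq" by (intro Lq_power) simp
  ultimately show ?case using Suc unfolding Wq.simps
    by - (rule Lq_divide_power, rule Lq_mult, assumption, rule Lq_add)
qed simp

lemma qint_double: "qint q (2 * k) = (q ^ k + 1 / q ^ k) * qint q k"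
  by (simp add: qint_q power_double field_simps)

text \<open>The induction of \<open>coord_f2f1\<close> again; splitting
  \<open>qint q (2 * k)\<close> by \<open>qint_double\<close> contributes the factors collected in
  \<open>Wq\<close>.\<close>

lemma coord_f2f12: "coord (divpow J2 f2 n * divpow J2 f12 m) (a, b, k, d)
  = of_bool (a = 0 \<and> b + k = m \<and> k + d = n) * (Wq k / (q ^ (b * k) * q ^ (d * k)))"
proof (induction n arbitrary: a b k d)
  case 0
  have "coord (divpow J2 f12 m) = delta (0, m, 0, 0)"
    using coord_L[of "(0, m, 0, 0)"] by (simp add: L_h.simps)
  then show ?case by (auto simp: delta_def)
next
  case (Suc n)
  let ?x = "divpow J2 f2 n * divpow J2 f12 m"
  let ?e = "Wq k / (q ^ (b * k) * q ^ (d * k))"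
  let ?o = "of_bool (a = 0 \<and> b + k = m \<and> k + d = Suc n) :: ratfun"
  have nz: "qint q (Suc n) \<noteq> 0" using qint_nz[of J2] by (simp only: qidx_values) simp
  have "coord (divpow J2 f2 (Suc n) * divpow J2 f12 m) (a, b, k, d) = inverse (qint q (Suc n)) * F2 (coord ?x) (a, b, k, d)"
    by (simp only: divpow_Suc qscale_mult_left mult.assoc coord_scale coord_f2 qidx_values)
  also have "F2 (coord ?x) (a, b, k, d) = ?o * (qint q (Suc n) * ?e)"
  proof -
    have t1: "qint q b * coord ?x (a + 1, b - 1, k, d) = 0"
      unfolding Suc by simp
    have t2: "q ^ (2 * a) / q ^ b * qint q (2 * k) * coord ?x (a, b + 1, k - 1, d) = ?o * (qint q k * q ^ d * ?e)"
      unfolding Suc qint_double by (cases k) (auto simp: power_add field_simps)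
    have t3: "q ^ (2 * a) / q ^ (2 * k) * qint q d * coord ?x (a, b, k, d - 1) = ?o * (qint q d / q ^ k * ?e)"
      unfolding Suc by (cases d; cases "a = 0") (auto simp: power_add field_simps power_double)
    have "qint q (k + d) = qint q d / q ^ k + q ^ d * qint q k"
      using qint_add[of q d k] by (simp add: add.commute)
    then have o: "?o * (qint q (Suc n) * ?e) = ?o * ((qint q d / q ^ k + q ^ d * qint q k) * ?e)" by auto
    show ?thesis unfolding F2.simps t1 t2 t3 o by (simp add: distrib_left distrib_right mult_ac)
  qed
  finally show ?case using nz by simp
qed

lemma integral0_f2f12: "integral0 (divpow J2 f2 n * divpow J2 f12 m)"
proof -
  have "coord (divpow J2 f2 n * divpow J2 f12 m) (a, b, k, d) \<in> Lq" for a b k d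
    unfolding coord_f2f12 by (auto intro!: Lq_divide_power Wq_Lq simp flip: power_add)
  then show ?thesis by (auto simp: integral0_def coord_f2f12)
qed

lemma integral_f2f1: "integral (divpow J2 f2 n * divpow J1 f1 m)"
proof -
  have "coord (divpow J2 f2 n * divpow J1 f1 m) (a, b, k, d) \<in> Lq" for a b k d
    unfolding coord_f2f1 by (auto intro!: Lq_power)
  then show ?thesis by (auto simp: integral_def)
qed

text \<open>The factors of \<open>L_h e\<close> are appended one at a time: \<open>f1\<close> by
  \<open>coord_f2f1\<close>; then \<open>f12\<close>, which is straightened within
  \<open>integral0\<close> before \<open>f1\<close> is put in front; finally \<open>f122\<close> and
  \<open>f2\<close>, which cost only powers of \<open>q\<close> and binomials.\<close>

lemma integral_f2_left: "integral x \<Longrightarrow> integral (divpow J2 f2 n * x)"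
proof (rule integral_linear[of "\<lambda>x. divpow J2 f2 n * x"])
  fix e :: exponent
  obtain a b c d where e: "e = (a, b, c, d)" by (cases e)
  have "integral (L_h c' * divpow J2 f12 b)" for c'
  proof -
    obtain a' b' c'' d' where c': "c' = (a', b', c'', d')" by (cases c')
    have "L_h c' * divpow J2 f12 b
      = divpow J1 f1 a' * (divpow J2 f12 b' * (divpow J1 f122 c'' * (divpow J2 f2 d' * divpow J2 f12 b)))"
      by (simp add: c' L_h.simps mult.assoc)
    then show ?thesis
      by (simp only:) (intro integral_f1_left integral0_intg integral0_f12_left integral0_f122_left integral0_f2f12)
  qed
  then have "integral (divpow J2 f2 n * divpow J1 f1 a * divpow J2 f12 b)"
    by (rule integral_linear[of "\<lambda>x. x * divpow J2 f12 b", rotated 2]) (simp_all add: distrib_right integral_f2f1)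
  then have "integral ((divpow J2 f2 n * divpow J1 f1 a * divpow J2 f12 b) * divpow J1 f122 c * divpow J2 f2 d)"
    by (intro integral_f2_right integral_f122_right)
  then show "integral (divpow J2 f2 n * L_h e)" by (simp add: e L_h.simps mult.assoc)
qed (simp_all add: distrib_left)

lemma integral_star_gen_monomial: "integral (star (gen_monomial s y x t))"
proof -
  have "star (gen_monomial s y x t) = divpow J2 f2 t * (divpow J1 f1 x * (divpow J2 f2 y * divpow J1 f1 s))"
    by (simp add: gen_monomial_def star_mult star_divpow mult.assoc)
  then show ?thesis by (simp only:) (intro integral_f2_left integral_f1_left integral_f2f1)
qed

text \<open>The reversal of a monomial is again a product of divided powers of generators, hence
  integral; descending induction passes this on to the PBW vectors.\<close>

lemma integral_star_L: "integral (star (L_h c))"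
proof (induction c rule: above_induct)
  case (above c)
  have "integral (star (Mon c))" by (cases c) (simp add: integral_star_gen_monomial)
  then show ?case
    by (subst Mon_expand) (auto simp: star_diff star_sum intro!: integral_diff integral_sum integral_scale coord_Mon_Lq above)
qed

subsection \<open>The reversal modulo \<open>q\<close>\<close>

text \<open>Let \<open>q ^ n\<close> be the least power clearing all poles. If \<open>n > 0\<close>,
  then \<open>q ^ (2 * n)\<close> times the norm vanishes at 0, where it is also a sum of integer
  squares because the basis norms are 1. So all these integers vanish and a smaller power would
  do.\<close>

lemma Zq_of_value0_norm:
  assumes "integral x" "value0 (pbw_form x x) v" shows "coord x e \<in> Zq"
proof -
  define P where "P n \<longleftrightarrow> (\<forall>e\<in>supp x. q ^ n * coord x e \<in> Zq)" for n
  have "\<exists>n. P n" using Lq_clear[OF finite_supp, of x "coord x"] assms(1) unfolding P_def integral_def by metis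
  then have Pn: "P (LEAST n. P n)" by (rule LeastI_ex)
  have "(LEAST n. P n) = 0"
  proof (rule ccontr)
    assume "(LEAST n. P n) \<noteq> 0"
    then obtain m where m: "(LEAST n. P n) = Suc m" by (metis not0_implies_Suc)
    have "P (Suc m)" using Pn m by simp
    then have y: "q ^ Suc m * coord x e \<in> Zq" if "e \<in> supp x" for e using that unfolding P_def by blast
    have "\<forall>e\<in>supp x. \<exists>n :: int. value0 (q ^ Suc m * coord x e) (of_int n)" using y Zq_value0 by metis
    then obtain z :: "exponent \<Rightarrow> int" where z: "\<And>e. e \<in> supp x \<Longrightarrow> value0 (q ^ Suc m * coord x e) (of_int (z e))" by metis
    have A: "value0 (\<Sum>e\<in>supp x. (q ^ Suc m * coord x e) * (q ^ Suc m * coord x e) * pbw_norm e) (\<Sum>e\<in>supp x. of_int (z e) * of_int (z e) * 1)"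
      by (intro value0_sum value0_mult z value0_pbw_norm)
    have B: "(\<Sum>e\<in>supp x. (q ^ Suc m * coord x e) * (q ^ Suc m * coord x e) * pbw_norm e) = q ^ Suc m * q ^ Suc m * pbw_form x x"
      by (simp add: pbw_form_def sum_distrib_left mult_ac)
    have "value0 (q ^ Suc m * q ^ Suc m * pbw_form x x) (0 ^ Suc m * 0 ^ Suc m * v)"
      by (intro value0_mult value0_power value0_q assms(2))
    then have "(\<Sum>e\<in>supp x. rat_of_int (z e) * of_int (z e) * 1) = 0 ^ Suc m * 0 ^ Suc m * v"
      using A unfolding B by (rule value0_unique[rotated])
    then have "(\<Sum>e\<in>supp x. rat_of_int (z e) * of_int (z e) * 1) = 0" by simp
    then have "\<forall>e\<in>supp x. rat_of_int (z e) * of_int (z e) = 0"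
      by (subst (asm) mult_1_right, subst (asm) sum_nonneg_eq_0_iff) auto
    then have "value0 (q ^ Suc m * coord x e) 0" if "e \<in> supp x" for e using z[OF that] that by auto
    then have "q ^ Suc m * coord x e \<in> qZq" if "e \<in> supp x" for e using Zq_value0_0[OF y] that by blast
    then have "\<exists>w\<in>Zq. q * (q ^ m * coord x e) = q * w" if "e \<in> supp x" for e using that by (simp add: qZq_iff mult.assoc)
    then have "P m" unfolding P_def by auto
    then have "Suc m \<le> m" using Least_le[of P m] m by simp
    then show False by simp
  qed
  then have "P 0" using Pn by simp
  then show ?thesis by (cases "e \<in> supp x") (auto simp: P_def supp_def)
qed

lemma int_sum_squares_1:
  fixes z :: "'a \<Rightarrow> int"
  assumes "finite A" "(\<Sum>e\<in>A. z e * z e) = 1"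
  shows "\<exists>e\<in>A. (z e = 1 \<or> z e = - 1) \<and> (\<forall>e'\<in>A. e' \<noteq> e \<longrightarrow> z e' = 0)"
proof -
  have "\<exists>e\<in>A. z e \<noteq> 0"
  proof (rule ccontr)
    assume "\<not> ?thesis"
    then have "(\<Sum>e\<in>A. z e * z e) = 0" by (intro sum.neutral) auto
    then show False using assms(2) by simp
  qed
  then obtain e where e: "e \<in> A" "z e \<noteq> 0" by blast
  have s: "z e * z e + (\<Sum>e\<in>A - {e}. z e * z e) = 1"
    using sum.remove[OF assms(1) e(1), of "\<lambda>e. z e * z e"] assms(2) by simp
  moreover have "(\<Sum>e\<in>A - {e}. z e * z e) \<ge> 0" by (intro sum_nonneg) simp
  moreover have "z e * z e > 0" using e(2) by (cases "z e > 0") (simp_all add: mult_neg_neg)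
  ultimately have *: "z e * z e = 1" "(\<Sum>e\<in>A - {e}. z e * z e) = 0" by linarith+
  have "\<forall>e'\<in>A - {e}. z e' * z e' = 0"
    using *(2) assms(1) by (subst (asm) sum_nonneg_eq_0_iff) auto
  moreover have "z e = 1 \<or> z e = - 1" using *(1) by (metis square_eq_1_iff)
  ultimately show ?thesis using e(1) by auto
qed

lemma star_L_ex: "\<exists>p :: exponent \<times> int. (snd p = 1 \<or> snd p = - 1) \<and> (\<forall>e. coord (star (L_h c)) e - of_int (snd p) * delta (fst p) e \<in> qZq)"
proof -
  let ?x = "star (L_h c)"
  have ipx: "pbw_form ?x ?x = pbw_norm c" by (simp add: pbw_form_star pbw_form_L_right delta_def)
  then have rx: "value0 (pbw_form ?x ?x) 1" by (simp add: value0_pbw_norm)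
  have Z: "coord ?x e \<in> Zq" for e using Zq_of_value0_norm[OF integral_star_L rx] .
  then have "\<forall>e. \<exists>n :: int. value0 (coord ?x e) (of_int n) \<and> coord ?x e - of_int n \<in> qZq" using Zq_value0 by metis
  then obtain z :: "exponent \<Rightarrow> int" where z: "\<And>e. value0 (coord ?x e) (of_int (z e))" "\<And>e. coord ?x e - of_int (z e) \<in> qZq" by metis
  have "value0 (pbw_form ?x ?x) (\<Sum>e\<in>supp ?x. of_int (z e) * of_int (z e) * 1)"
    unfolding pbw_form_def by (intro value0_sum value0_mult z value0_pbw_norm)
  then have "(\<Sum>e\<in>supp ?x. of_int (z e) * of_int (z e) * 1) = (1 :: rat)"
    using rx by (rule value0_unique)
  then have "rat_of_int (\<Sum>e\<in>supp ?x. z e * z e) = of_int 1" by simp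
  then have "(\<Sum>e\<in>supp ?x. z e * z e) = 1" by (simp only: of_int_eq_iff)
  then obtain e0 where e0: "z e0 = 1 \<or> z e0 = - 1" "\<And>e'. e' \<in> supp ?x \<Longrightarrow> e' \<noteq> e0 \<Longrightarrow> z e' = 0"
    using int_sum_squares_1[OF finite_supp] by blast
  have "coord ?x e - of_int (z e0) * delta e0 e \<in> qZq" for e
  proof (cases "e = e0")
    case True
    then show ?thesis using z(2)[of e] by (simp add: delta_def)
  next
    case False
    then have "coord ?x e \<in> qZq"
      using z(2)[of e] e0(2)[of e] by (cases "e \<in> supp ?x") (simp_all add: supp_def)
    then show ?thesis using False by (simp add: delta_def)
  qed
  then show ?thesis using e0(1) by (intro exI[of _ "(e0, z e0)"]) simp
qed

definition rindex_rsign :: "exponent \<Rightarrow> exponent \<times> int" where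
  "rindex_rsign c = (SOME p. (snd p = 1 \<or> snd p = - 1) \<and> (\<forall>e. coord (star (L_h c)) e - of_int (snd p) * delta (fst p) e \<in> qZq))"

definition rindex :: "exponent \<Rightarrow> exponent" where "rindex c = fst (rindex_rsign c)"
definition rsign :: "exponent \<Rightarrow> int" where "rsign c = snd (rindex_rsign c)"

lemma rsign_cases: "rsign c = 1 \<or> rsign c = - 1"
  and star_L_mod: "coord (star (L_h c)) e - of_int (rsign c) * delta (rindex c) e \<in> qZq"
  using someI_ex[OF star_L_ex[of c]] unfolding rindex_def rsign_def rindex_rsign_def by blast+

subsection \<open>Signs\<close>

definition in_Zq_lattice :: "uq \<Rightarrow> bool" where
  "in_Zq_lattice x \<longleftrightarrow> (\<forall>e. coord x e \<in> Zq)"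

definition in_qZq_lattice :: "uq \<Rightarrow> bool" where
  "in_qZq_lattice x \<longleftrightarrow> (\<forall>e. coord x e \<in> qZq)"

lemma coord_star: "coord (star x) e = (\<Sum>c\<in>supp x. coord x c * coord (star (L_h c)) e)"
  by (rule coord_linear) (simp_all add: star_add)

lemma star_L_Zq: "coord (star (L_h c)) e \<in> Zq"
proof -
  have "of_int (rsign c) * delta (rindex c) e \<in> Zq" by (rule Zq_mult) (simp_all add: delta_def)
  from Zq_add[OF qZq_Zq[OF star_L_mod[of c e]] this] show ?thesis by simp
qed

lemma value0_star_L: "value0 (coord (star (L_h c)) e) (of_int (rsign c) * of_bool (e = rindex c))"
proof -
  have i: "value0 (of_int n) (of_int n)" for n :: int
    by (cases n rule: int_cases2) (auto intro: value0_minus value0_of_nat)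
  have "value0 (of_int (rsign c) * delta (rindex c) e) (of_int (rsign c) * of_bool (e = rindex c))"
    by (intro value0_mult i) (simp add: delta_def)
  from value0_add[OF qZq_value0[OF star_L_mod[of c e]] this] show ?thesis by simp
qed

lemma in_Zq_lattice_star: "in_Zq_lattice x \<Longrightarrow> in_Zq_lattice (star x)"
  unfolding in_Zq_lattice_def by (subst coord_star) (auto intro!: Zq_sum Zq_mult star_L_Zq)

lemma in_qZq_lattice_star: "in_qZq_lattice x \<Longrightarrow> in_qZq_lattice (star x)"
  unfolding in_qZq_lattice_def by (subst coord_star) (auto intro!: qZq_sum qZq_mult_right star_L_Zq)

lemma rindex_rindex [simp]: "rindex (rindex c) = c" and rsign_rindex [simp]: "rsign (rindex c) = rsign c"
proof -
  have "in_qZq_lattice (star (L_h c) - of_int (rsign c) *\<^sub>q L_h (rindex c))"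
    using star_L_mod[of c] by (simp add: in_qZq_lattice_def coord_diff)
  from in_qZq_lattice_star[OF this] have "coord (L_h c) c - of_int (rsign c) * coord (star (L_h (rindex c))) c \<in> qZq"
    by (simp add: in_qZq_lattice_def star_diff coord_diff)
  then have r0: "value0 (coord (L_h c) c - of_int (rsign c) * coord (star (L_h (rindex c))) c) 0" by (rule qZq_value0)
  have i: "value0 (of_int n) (of_int n)" for n :: int
    by (cases n rule: int_cases2) (auto intro: value0_minus value0_of_nat)
  have "value0 (coord (L_h c) c - of_int (rsign c) * coord (star (L_h (rindex c))) c)
      (1 - of_int (rsign c) * (of_int (rsign (rindex c)) * of_bool (c = rindex (rindex c))))"
    by (intro value0_diff value0_mult value0_star_L i) (simp add: delta_def)
  then have *: "1 - rat_of_int (rsign c) * (of_int (rsign (rindex c)) * of_bool (c = rindex (rindex c))) = 0"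
    using r0 by (rule value0_unique)
  show s: "rindex (rindex c) = c"
  proof (rule ccontr)
    assume "rindex (rindex c) \<noteq> c"
    then have "c \<noteq> rindex (rindex c)" by (rule not_sym)
    then show False using * by simp
  qed
  then show "rsign (rindex c) = rsign c" using * rsign_cases[of c] rsign_cases[of "rindex c"] by auto
qed

lemma value0_star:
  assumes "in_Zq_lattice y" "value0 (coord y (rindex e)) v" shows "value0 (coord (star y) e) (v * of_int (rsign e))"
proof -
  have "\<forall>c. \<exists>n :: int. value0 (coord y c) (of_int n)" using assms(1) Zq_value0 unfolding in_Zq_lattice_def by metis
  then obtain z :: "exponent \<Rightarrow> int" where z: "\<And>c. value0 (coord y c) (of_int (z c))" by metis
  have "value0 (coord (star y) e) (\<Sum>c\<in>supp y. of_int (z c) * (of_int (rsign c) * of_bool (e = rindex c)))"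
    by (subst coord_star) (intro value0_sum value0_mult z value0_star_L)
  also have "(\<Sum>c\<in>supp y. rat_of_int (z c) * (of_int (rsign c) * of_bool (e = rindex c)))
     = (\<Sum>c\<in>supp y. if c = rindex e then of_int (z (rindex e)) * of_int (rsign e) else 0)"
    by (rule sum.cong) (auto dest: arg_cong[where f = rindex])
  also have "\<dots> = of_int (z (rindex e)) * of_int (rsign e)"
  proof (cases "rindex e \<in> supp y")
    case False
    then have "z (rindex e) = 0" using value0_unique[OF z[of "rindex e"], of 0] by (simp add: supp_def)
    then show ?thesis by simp
  qed simp
  finally show ?thesis using value0_unique[OF assms(2) z] by simp
qed

lemma wt_twist_star: "wt_twist j (star x) = star (wt_twist j x)"
  by (induction x rule: uq_left_induct) (simp_all add: star_mult wt_twist_gen_right wt_twist_gen star_add wt_twist_add)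

text \<open>The exponents of \<open>q\<close> are linear forms in the weight whose matrix, the Gram
  matrix of the simple roots up to sign, is invertible.\<close>

lemma wt_char_inj: assumes "wt_char J1 c = wt_char J1 e" "wt_char J2 c = wt_char J2 e" shows "wt c = wt e"
proof -
  obtain a b c' d where c: "c = (a, b, c', d)" by (cases c)
  obtain a2 b2 c2 d2 where e: "e = (a2, b2, c2, d2)" by (cases e)
  have "q ^ (2 * (b + 2 * c' + d) + 4 * (a2 + b2 + c2)) = q ^ (2 * (b2 + 2 * c2 + d2) + 4 * (a + b + c'))"
    using assms(1) by (simp add: c e frac_eq_eq power_add)
  moreover have "q ^ (2 * (a + b + c') + 2 * (b2 + 2 * c2 + d2)) = q ^ (2 * (a2 + b2 + c2) + 2 * (b + 2 * c' + d))"
    using assms(2) by (simp add: c e frac_eq_eq power_add)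
  ultimately show ?thesis unfolding q_power_eq_iff by (simp add: c e wt_def)
qed

lemma wt_rindex: "wt (rindex c) = wt c"
proof -
  have "value0 (coord (star (L_h c)) (rindex c)) (of_int (rsign c))" using value0_star_L[of c "rindex c"] by simp
  then have nz: "coord (star (L_h c)) (rindex c) \<noteq> 0" using value0_unique[OF value0_0] rsign_cases[of c] by fastforce
  have "wt_char j c = wt_char j (rindex c)" for j
  proof -
    have "wt_twist j (L_h c) = wt_char j c *\<^sub>q L_h c"
      by (rule coord_eqI) (simp add: delta_def)
    then have "wt_twist j (star (L_h c)) = wt_char j c *\<^sub>q star (L_h c)" by (simp add: wt_twist_star)
    from arg_cong[OF this, of "\<lambda>x. coord x (rindex c)"] show ?thesis using nz by simp
  qed
  then show ?thesis using wt_char_inj by metis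
qed

definition last_exp :: "exponent \<Rightarrow> nat" where
  "last_exp = (\<lambda>(a, b, c, d). d)"

definition incr_last :: "exponent \<Rightarrow> exponent" where
  "incr_last = (\<lambda>(a, b, c, d). (a, b, c, d + 1))"

text \<open>The lowest power of \<open>q\<close> occurring in the PBW coefficients of \<open>f2 * L_h c\<close> is \<open>q\<close> to the power \<open>- depth c\<close>.\<close>

definition depth :: "exponent \<Rightarrow> nat" where
  "depth = (\<lambda>(a, b, c, d). max b (max (b + 2 * c - 2 * a) (d + 2 * c - 2 * a)))"

lemma qint_lead: "q ^ n * qint q (Suc n) \<in> Zq" "value0 (q ^ n * qint q (Suc n)) 1"
proof -
  have "q ^ n * qint q (Suc n) \<in> Zq \<and> value0 (q ^ n * qint q (Suc n)) 1"
  proof (induction n)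
    case (Suc n)
    have eq: "q ^ Suc n * qint q (Suc (Suc n)) = 1 + q ^ 2 * (q ^ n * qint q (Suc n))"
      unfolding qint_Suc_q[of "Suc n"] by (simp add: algebra_simps power2_eq_square)
    have "1 + q ^ 2 * z \<in> Zq \<and> value0 (1 + q ^ 2 * z) (1 + 0 ^ 2 * 1)" if "z \<in> Zq \<and> value0 z 1" for z
    proof
      show "1 + q ^ 2 * z \<in> Zq" using that by (intro Zq_add Zq_mult Zq_power) simp_all
      show "value0 (1 + q ^ 2 * z) (1 + 0 ^ 2 * 1)"
        using that by (intro value0_add value0_power[OF value0_q] value0_mult[of "q ^ 2" "0 ^ 2" z 1]) simp_all
    qed
    from this[OF Suc] show ?case unfolding eq by simp
  qed simp
  then show "q ^ n * qint q (Suc n) \<in> Zq" "value0 (q ^ n * qint q (Suc n)) 1" by auto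
qed

text \<open>Nonnegativity is recorded for the constant term alone, the only one that a comparison at
  \<open>q = 0\<close> sees.\<close>

definition Zq_pos :: "ratfun \<Rightarrow> bool" where
  "Zq_pos x \<longleftrightarrow> x \<in> Zq \<and> (\<exists>n :: nat. value0 x (of_nat n))"

lemma Zq_pos_0 [simp]: "Zq_pos 0" unfolding Zq_pos_def by (auto intro!: exI[of _ 0])
lemma Zq_pos_1 [simp]: "Zq_pos 1" unfolding Zq_pos_def by (auto intro!: exI[of _ 1])
lemma Zq_pos_add: "Zq_pos x \<Longrightarrow> Zq_pos y \<Longrightarrow> Zq_pos (x + y)" unfolding Zq_pos_def by (metis Zq_add of_nat_add value0_add)
lemma Zq_pos_mult: "Zq_pos x \<Longrightarrow> Zq_pos y \<Longrightarrow> Zq_pos (x * y)" unfolding Zq_pos_def by (metis Zq_mult of_nat_mult value0_mult)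
lemma Zq_pos_q [simp]: "Zq_pos q" unfolding Zq_pos_def by (auto intro!: exI[of _ 0])
lemma Zq_pos_power: "Zq_pos x \<Longrightarrow> Zq_pos (x ^ n)" by (induction n) (auto intro: Zq_pos_mult)
lemma Zq_pos_qint: assumes "n \<le> m" shows "Zq_pos (q ^ m * qint q (Suc n))"
proof -
  have "Zq_pos (q ^ n * qint q (Suc n))" using qint_lead[of n] unfolding Zq_pos_def by (metis of_nat_1)
  then have "Zq_pos (q ^ (m - n) * (q ^ n * qint q (Suc n)))" by (rule Zq_pos_mult[OF Zq_pos_power[OF Zq_pos_q]])
  then show ?thesis using assms by (simp flip: mult.assoc power_add)
qed

text \<open>The three terms of \<open>F2\<close> have poles of order at most \<open>b\<close>,
  \<open>b + 2 * c' - 2 * a\<close> and \<open>d + 2 * c' - 2 * a\<close>, the three entries of the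
  maximum in \<open>depth\<close>.\<close>

lemma f2_L_lead: "Zq_pos (coord (q ^ depth c *\<^sub>q (f2 * L_h c)) e)"
proof -
  obtain a b c' d where c: "c = (a, b, c', d)" by (cases c)
  obtain a2 b2 c2 d2 where e: "e = (a2, b2, c2, d2)" by (cases e)
  let ?E = "depth c"
  have 1: "Zq_pos (q ^ ?E * (qint q b2 * delta c (a2 + 1, b2 - 1, c2, d2)))"
    unfolding c delta_def by (cases b2) (auto simp: depth_def intro!: Zq_pos_qint)
  have 2: "Zq_pos (q ^ ?E * (q ^ (2 * a2) / q ^ b2 * qint q (2 * c2) * delta c (a2, b2 + 1, c2 - 1, d2)))"
  proof (cases "c2 \<noteq> 0 \<and> c = (a2, b2 + 1, c2 - 1, d2)")
    case True
    then have h: "c2 = Suc c'" "a2 = a" "b = Suc b2" by (auto simp: c)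
    have "?E + 2 * a \<ge> b + 2 * c'" unfolding c depth_def by simp
    then obtain k where "?E + 2 * a = (b + 2 * c') + k" using le_iff_add by blast
    then have k: "?E + 2 * a = (Suc (2 * c') + k) + b2" using h(3) by simp
    have "q ^ ?E * (q ^ (2 * a2) / q ^ b2 * qint q (2 * c2)) = q ^ (?E + 2 * a) / q ^ b2 * qint q (Suc (Suc (2 * c')))"
      using h by (simp add: power_add)
    also have "\<dots> = q ^ (Suc (2 * c') + k) * qint q (Suc (Suc (2 * c')))"
      unfolding k by (simp add: power_add)
    finally have "Zq_pos (q ^ ?E * (q ^ (2 * a2) / q ^ b2 * qint q (2 * c2)))"
      by (simp only: Zq_pos_qint le_add1)
    then show ?thesis using True by (simp add: delta_def)
  qed (auto simp: delta_def)
  have 3: "Zq_pos (q ^ ?E * (q ^ (2 * a2) / q ^ (2 * c2) * qint q d2 * delta c (a2, b2, c2, d2 - 1)))"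
  proof (cases "d2 \<noteq> 0 \<and> c = (a2, b2, c2, d2 - 1)")
    case True
    then have h: "d2 = Suc d" "a2 = a" "c2 = c'" by (auto simp: c)
    have "?E + 2 * a \<ge> d + 2 * c'" unfolding c depth_def by simp
    then obtain k where "?E + 2 * a = (d + 2 * c') + k" using le_iff_add by blast
    then have k: "?E + 2 * a = (d + k) + 2 * c'" by simp
    have "q ^ ?E * (q ^ (2 * a2) / q ^ (2 * c2) * qint q d2) = q ^ (?E + 2 * a) / q ^ (2 * c') * qint q (Suc d)"
      using h by (simp add: power_add)
    also have "\<dots> = q ^ (d + k) * qint q (Suc d)"
      unfolding k by (simp add: power_add)
    finally have "Zq_pos (q ^ ?E * (q ^ (2 * a2) / q ^ (2 * c2) * qint q d2))"
      by (simp only: Zq_pos_qint le_add1)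
    then show ?thesis using True by (simp add: delta_def)
  qed (auto simp: delta_def)
  show ?thesis using Zq_pos_add[OF Zq_pos_add[OF 1 2] 3]
    by (simp only: e coord_scale coord_f2 coord_L F2.simps distrib_left)
qed

lemma coord_mult_f2: "coord (x * f2) (incr_last e) = qint q (Suc (last_exp e)) * coord x e"
proof (rule coord_shift(1)[of "\<lambda>x. x * f2"])
  show "inj incr_last" by (auto simp: inj_def incr_last_def)
  fix e show "L_h e * f2 = qint q (Suc (last_exp e)) *\<^sub>q L_h (incr_last e)"
  proof -
    obtain a b c d where e: "e = (a, b, c, d)" by (cases e)
    show ?thesis using divpow_mult[of J2 f2 d]
      by (simp add: e L_h.simps last_exp_def incr_last_def mult.assoc qidx_values)
  qed
qed (simp_all add: distrib_right)

lemma star_f2_L: "coord (star (q ^ n *\<^sub>q (f2 * L_h c))) (incr_last (rindex c))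
  = q ^ n * qint q (Suc (last_exp (rindex c))) * coord (star (L_h c)) (rindex c)"
  by (simp add: star_mult coord_mult_f2)

text \<open>The coefficient of \<open>star (L_h c) * f2\<close> at
  \<open>incr_last (rindex c)\<close> has a pole of order exactly
  \<open>last_exp (rindex c)\<close>. It is also a coefficient of the reversal of
  \<open>f2 * L_h c\<close>, and \<open>star\<close> preserves the lattice of polynomial
  coefficients, so the order is at most \<open>depth c\<close>.\<close>

lemma last_exp_le_depth: "last_exp (rindex c) \<le> depth c"
proof (rule ccontr)
  let ?d = "last_exp (rindex c)"
  assume "\<not> ?d \<le> depth c"
  then obtain k where k: "?d = Suc k + depth c" by (metis add.commute less_imp_Suc_add not_le add_Suc)
  have "in_Zq_lattice (q ^ depth c *\<^sub>q (f2 * L_h c))" using f2_L_lead[of c] by (auto simp: in_Zq_lattice_def Zq_pos_def)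
  from in_Zq_lattice_star[OF this] obtain n :: int where n: "value0 (coord (star (q ^ depth c *\<^sub>q (f2 * L_h c))) (incr_last (rindex c))) (of_int n)"
    unfolding in_Zq_lattice_def by (metis Zq_value0)
  have "value0 (q ^ Suc k * coord (star (q ^ depth c *\<^sub>q (f2 * L_h c))) (incr_last (rindex c))) (0 ^ Suc k * of_int n)"
    by (intro value0_mult value0_power value0_q n)
  moreover have "q ^ Suc k * coord (star (q ^ depth c *\<^sub>q (f2 * L_h c))) (incr_last (rindex c))
      = (q ^ ?d * qint q (Suc ?d)) * coord (star (L_h c)) (rindex c)"
    unfolding star_f2_L k power_add by (simp only: mult_ac)
  moreover have "value0 ((q ^ ?d * qint q (Suc ?d)) * coord (star (L_h c)) (rindex c)) (1 * (of_int (rsign c) * of_bool (rindex c = rindex c)))"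
    by (intro value0_mult qint_lead value0_star_L)
  ultimately have "0 ^ Suc k * rat_of_int n = 1 * (of_int (rsign c) * of_bool (rindex c = rindex c))"
    using value0_unique by metis
  then show False using rsign_cases[of c] by auto
qed

text \<open>\<open>Phi c\<close> is the index of a term of lowest order in \<open>f2 * L_h c\<close>, with ties broken so that \<open>Phi\<close> is a
  bijection onto the indices with \<open>depth c \<noteq> 0\<close>. Hence \<open>depth\<close> and \<open>last_exp\<close> have the same sum over each weight, which
  turns the inequality \<open>last_exp (rindex c) \<le> depth c\<close> into an equality.\<close>

fun Phi :: "exponent \<Rightarrow> exponent" where
  "Phi (a, b, c, d) = (if c < a then if d + 2 * c < b + 2 * a then (a - 1, b + 1, c, d) else (a, b, c, d + 1)
    else if d < b then (a, b - 1, c + 1, d) else (a, b, c, d + 1))"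

fun Psi :: "exponent \<Rightarrow> exponent" where
  "Psi (a, b, c, d) = (if c \<le> a then if d + 2 * c \<le> b + 2 * a then (a + 1, b - 1, c, d) else (a, b, c, d - 1)
    else if d \<le> b then (a, b + 1, c - 1, d) else (a, b, c, d - 1))"

lemma depth_eqI:
  assumes "b \<le> n" "b + 2 * c \<le> n + 2 * a" "d + 2 * c \<le> n + 2 * a"
    "n = b \<or> n + 2 * a = b + 2 * c \<or> n + 2 * a = d + 2 * c"
  shows "depth (a, b, c, d) = n"
proof (rule antisym)
  show "depth (a, b, c, d) \<le> n" using assms(1-3) by (simp add: depth_def) linarith
  show "n \<le> depth (a, b, c, d)" unfolding depth_def prod.case le_max_iff_disj using assms(4) by linarith
qed

lemma Psi_Phi: "Psi (Phi c) = c" "depth (Phi c) = Suc (depth c)" "wt (Phi c) = (fst (wt c), Suc (snd (wt c)))"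
proof -
  obtain a b c' d where c: "c = (a, b, c', d)" by (cases c)
  show "Psi (Phi c) = c" unfolding c by (simp; linarith)
  consider (1) "c' < a" "d + 2 * c' < b + 2 * a" | (2) "c' < a" "\<not> d + 2 * c' < b + 2 * a"
    | (3) "\<not> c' < a" "d < b" | (4) "\<not> c' < a" "\<not> d < b" by blast
  then show "depth (Phi c) = Suc (depth c)"
  proof cases
    case 1
    then have "depth (a, b, c', d) = b" "depth (a - 1, b + 1, c', d) = b + 1" by (auto intro!: depth_eqI)
    then show ?thesis using 1 by (simp add: c)
  next
    case 2
    then have "depth (a, b, c', d) = d + 2 * c' - 2 * a" "depth (a, b, c', d + 1) = d + 1 + 2 * c' - 2 * a" by (auto intro!: depth_eqI)
    then show ?thesis using 2 by (simp add: c)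
  next
    case 3
    then have "depth (a, b, c', d) = b + 2 * c' - 2 * a" "depth (a, b - 1, c' + 1, d) = b + 2 * c' + 1 - 2 * a" by (auto intro!: depth_eqI)
    then show ?thesis using 3 by (simp add: c)
  next
    case 4
    then have "depth (a, b, c', d) = d + 2 * c' - 2 * a" "depth (a, b, c', d + 1) = d + 1 + 2 * c' - 2 * a" by (auto intro!: depth_eqI)
    then show ?thesis using 4 by (simp add: c)
  qed
  show "wt (Phi c) = (fst (wt c), Suc (snd (wt c)))" unfolding c wt_def by auto
qed

lemma Phi_Psi: assumes "depth c \<noteq> 0"
  shows "Phi (Psi c) = c" "snd (wt c) = Suc (snd (wt (Psi c)))" "fst (wt (Psi c)) = fst (wt c)"
proof -
  obtain a b c' d where c: "c = (a, b, c', d)" by (cases c)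
  have nz: "b \<noteq> 0 \<or> d + 2 * c' > 2 * a \<or> b + 2 * c' > 2 * a" using assms unfolding c depth_def by auto
  show "Phi (Psi c) = c" using nz unfolding c
    by (cases "c' \<le> a"; cases "d + 2 * c' \<le> b + 2 * a"; cases "d \<le> b") auto
  show "snd (wt c) = Suc (snd (wt (Psi c)))" using nz unfolding c wt_def
    by (cases "c' \<le> a"; cases "d + 2 * c' \<le> b + 2 * a"; cases "d \<le> b") auto
  show "fst (wt (Psi c)) = fst (wt c)" using nz unfolding c wt_def
    by (cases "c' \<le> a"; cases "d + 2 * c' \<le> b + 2 * a"; cases "d \<le> b") auto
qed

lemma sum_depth_last_exp: "(\<Sum>c | wt c = (m, n). depth c) = (\<Sum>c | wt c = (m, n). last_exp c)"
proof (induction n)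
  case 0
  have "depth c = 0 \<and> last_exp c = 0" if "wt c = (m, 0)" for c
    using that by (cases c) (auto simp: wt_def depth_def last_exp_def)
  then show ?case by simp
next
  case (Suc n)
  \<comment> \<open>\<open>h\<close> is either statistic; \<open>i\<close> lowers it by one and maps
    the indices where it is nonzero bijectively onto all indices of the smaller weight.\<close>
  have step: "(\<Sum>c | wt c = (m, Suc n). h c) = (\<Sum>c | wt c = (m, n). h c + 1)"
    if "\<And>c. i (j c) = c" "\<And>c. h (j c) = h c + 1" "\<And>c. wt c = (m, n) \<Longrightarrow> wt (j c) = (m, Suc n)"
      "\<And>c. h c \<noteq> 0 \<Longrightarrow> wt c = (m, Suc n) \<Longrightarrow> j (i c) = c \<and> wt (i c) = (m, n)"
    for h :: "exponent \<Rightarrow> nat" and i j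
  proof -
    have hi: "h (i c) + 1 = h c" if "h c \<noteq> 0" "wt c = (m, Suc n)" for c
      using \<open>\<And>c. h (j c) = h c + 1\<close>[of "i c"] \<open>\<And>c. h c \<noteq> 0 \<Longrightarrow> wt c = (m, Suc n) \<Longrightarrow> j (i c) = c \<and> wt (i c) = (m, n)\<close>[OF that]
      by simp
    have "(\<Sum>c | wt c = (m, Suc n). h c) = (\<Sum>c | wt c = (m, Suc n) \<and> h c \<noteq> 0. h c)"
      by (rule sum.mono_neutral_right) (auto simp: finite_wt)
    also have "\<dots> = (\<Sum>c | wt c = (m, n). h c + 1)"
      by (rule sum.reindex_bij_witness[of _ j i]) (use that hi in auto)
    finally show ?thesis .
  qed
  have "(\<Sum>c | wt c = (m, Suc n). depth c) = (\<Sum>c | wt c = (m, n). depth c + 1)"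
    by (rule step[of Psi Phi]) (use Psi_Phi Phi_Psi in \<open>auto simp: prod_eq_iff\<close>)
  moreover have "(\<Sum>c | wt c = (m, Suc n). last_exp c) = (\<Sum>c | wt c = (m, n). last_exp c + 1)"
    by (rule step[of "\<lambda>(a, b, c, d). (a, b, c, d - 1)" incr_last]) (auto simp: last_exp_def incr_last_def wt_def)
  ultimately show ?case by (simp only: sum.distrib Suc)
qed

lemma depth_eq: "depth c = last_exp (rindex c)"
proof -
  obtain m n where mn: "wt c = (m, n)" by (cases "wt c")
  let ?A = "{c. wt c = (m, n)}"
  have "(\<Sum>c\<in>?A. last_exp (rindex c)) = (\<Sum>c\<in>?A. last_exp c)"
    by (rule sum.reindex_bij_witness[of _ rindex rindex]) (auto simp: wt_rindex)
  then have "(\<Sum>c\<in>?A. last_exp (rindex c)) = (\<Sum>c\<in>?A. depth c)" by (simp add: sum_depth_last_exp)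
  then have "last_exp (rindex c) = depth c"
    by (rule sum_mono_inv) (use mn last_exp_le_depth finite_wt in auto)
  then show ?thesis ..
qed

text \<open>By \<open>depth_eq\<close> the scaling removes the pole exactly. The value at 0 is then
  \<open>rsign c\<close> when computed by right multiplication, and a natural number times
  \<open>rsign (incr_last c)\<close> when computed by positivity; that number must be 1.\<close>

lemma rsign_incr_last: "rsign (incr_last c) = rsign c"
proof -
  define c' where "c' = rindex c"
  let ?y = "q ^ depth c' *\<^sub>q (f2 * L_h c')"
  have zn: "Zq_pos (coord ?y e)" for e using f2_L_lead[of c' e] .
  then have Zy: "in_Zq_lattice ?y" by (auto simp: in_Zq_lattice_def Zq_pos_def)
  have form_scale: "rindex c' = c" by (simp add: c'_def)
  obtain n :: nat where n: "value0 (coord ?y (rindex (incr_last c))) (of_nat n)" using zn unfolding Zq_pos_def by blast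
  have 1: "value0 (coord (star ?y) (incr_last c)) (of_nat n * of_int (rsign (incr_last c)))"
    by (rule value0_star[OF Zy n])
  have "coord (star ?y) (incr_last c) = (q ^ last_exp c * qint q (Suc (last_exp c))) * coord (star (L_h c')) c"
    using star_f2_L[of "depth c'" c'] unfolding form_scale depth_eq by (simp only: )
  moreover have "value0 ((q ^ last_exp c * qint q (Suc (last_exp c))) * coord (star (L_h c')) c) (1 * (of_int (rsign c') * of_bool (c = rindex c')))"
    by (intro value0_mult qint_lead value0_star_L)
  ultimately have "value0 (coord (star ?y) (incr_last c)) (of_int (rsign c))" by (simp add: c'_def)
  then have "rat_of_nat n * of_int (rsign (incr_last c)) = of_int (rsign c)" using 1 value0_unique by blast
  then have "of_int (int n * rsign (incr_last c)) = rat_of_int (rsign c)" by simp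
  then have "int n * rsign (incr_last c) = rsign c" by (simp only: of_int_eq_iff)
  then show ?thesis using rsign_cases[of "incr_last c"] rsign_cases[of c] by auto
qed

lemma value0_gen_monomial_term:
  assumes "2 * s * a \<le> N + k"
  shows "q ^ N * (dp_binom J1 s a * q ^ k) \<in> Zq" "2 * s * a = N + k \<Longrightarrow> value0 (q ^ N * (dp_binom J1 s a * q ^ k)) 1"
proof -
  obtain m where m: "N + k = 2 * s * a + m" using assms le_iff_add by blast
  have "q ^ N * (dp_binom J1 s a * q ^ k) = q ^ (N + k) * gauss_binom (q ^ 4) (s + a) s / q ^ (2 * s * a)"
    by (simp add: dp_binom_def qidx_values power_add mult.assoc flip: power_mult)
  also have "\<dots> = q ^ m * gauss_binom (q ^ 4) (s + a) s" unfolding m by (simp add: power_add)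
  finally have eq: "q ^ N * (dp_binom J1 s a * q ^ k) = q ^ m * gauss_binom (q ^ 4) (s + a) s" .
  show "q ^ N * (dp_binom J1 s a * q ^ k) \<in> Zq" unfolding eq by (intro Zq_mult Zq_power gauss_binom_Zq Zq_q)
  assume "2 * s * a = N + k"
  then have "m = 0" using m by simp
  moreover have "value0 (gauss_binom (q ^ 4) (s + a) s) 1" using value0_power[OF value0_q, of 4] by (intro value0_gauss_binom) auto
  ultimately show "value0 (q ^ N * (dp_binom J1 s a * q ^ k)) 1" unfolding eq by simp
qed

text \<open>The monomial below is chosen so that, among its PBW coefficients, the one at \<open>(a, 0, c, 0)\<close> has
  the lowest order in \<open>q\<close>; the same holds for its reversal.\<close>

lemma rsign_fixed:
  assumes "c \<le> a" "rindex (a, 0, c, 0) = (a, 0, c, 0)" shows "rsign (a, 0, c, 0) = 1"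
proof -
  \<comment> \<open>Halving makes the outer powers \<open>s\<close> and \<open>x\<close>, which
    reversal exchanges, differ by at most one; this balance keeps the quadratic expression below
    nonnegative.\<close>
  define a0 where "a0 = (a - c) div 2"
  define s where "s = a - a0"
  define x where "x = a0 + c"
  have sx: "s = x \<or> s = Suc x" "s + a0 = a" "s \<ge> c" "s + x = a + c"
    using assms(1) unfolding s_def x_def a0_def by linarith+
  \<comment> \<open>The pole order at \<open>(a, 0, c, 0)\<close>, the same for the monomial,
    \<open>2 * s * a0 - 2 * a0 * c\<close>, and for its reversal,
    \<open>2 * x * (s - c) - 2 * (s - c) * c\<close>.\<close>
  define N where "N = 2 * a0 * (s - c)"
  let ?y = "q ^ N *\<^sub>q gen_monomial s (2 * c) x 0"
  have N: "2 * s * a0 = N + 2 * a0 * c" unfolding N_def using sx(3) by (simp add: algebra_simps diff_mult_distrib2)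
  have Zy: "in_Zq_lattice ?y"
    unfolding in_Zq_lattice_def
  proof
    fix e show "coord ?y e \<in> Zq"
    proof -
      obtain a2 b2 c2 d2 where e: "e = (a2, b2, c2, d2)" by (cases e)
      show ?thesis
      proof (cases "s \<le> a2 \<and> (a2 - s) + b2 + c2 = x \<and> b2 + 2 * c2 + d2 = 2 * c")
        case True
        define a1 where "a1 = a2 - s"
        have h: "a1 + b2 + c2 = x" "b2 + 2 * c2 + d2 = 2 * c" using True by (auto simp: a1_def)
        \<comment> \<open>Deviations from the target index. The weight determines the other two
          exponents, and their being nonnegative bounds \<open>i\<close> by \<open>- k\<close> in
          absolute value.\<close>
        define i k :: int where "i = int a1 - int a0" and "k = int c2 - int c"
        have a1: "int a1 = int a0 + i" and c2: "int c2 = int c + k" by (simp_all add: i_def k_def)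
        have "int a1 + int b2 + int c2 = int a0 + int c" "int b2 + 2 * int c2 + int d2 = 2 * int c"
          using h by (simp_all add: x_def)
        then have b2: "int b2 = - i - k" and d2: "int d2 = i - k" using a1 c2 by linarith+
        have S: "int s = int x \<or> int s = int x + 1" using sx(1) by auto
        have ik: "\<bar>i\<bar> \<le> - k" using b2 d2 by linarith
        then have "\<bar>i\<bar> \<le> \<bar>k\<bar>" by linarith
        then have "i * i \<le> k * k" unfolding abs_le_square_iff power2_eq_square .
        moreover have "i \<le> i * i"
        proof (cases "i \<le> 0")
          case True then show ?thesis using zero_le_square[of i] by linarith
        next
          case False then show ?thesis using mult_left_mono[of 1 i i] by simp
        qed
        \<comment> \<open>The order in excess of \<open>- N\<close>. As \<open>x - s\<close> is 0 or
          -1, the linear term is at worst \<open>- 2 * i\<close>, which \<open>i \<le> i * i\<close>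
          and \<open>i * i \<le> k * k\<close> absorb.\<close>
        ultimately have "0 \<le> i * i + k * k + 2 * (int x - int s) * i" using S zero_le_square[of i] by auto
        also have "\<dots> = 2 * int a1 * int d2 + int b2 * int d2 + 2 * int a1 * int c2 + (2 * int s * int a0 - 2 * int a0 * int c) - 2 * int s * int a1"
          unfolding a1 c2 b2 d2 x_def by (simp add: algebra_simps)
        also have "2 * int s * int a0 - 2 * int a0 * int c = int N"
          using arg_cong[OF N, of int] by simp
        finally have "int (2 * s * a1) \<le> int (N + (2 * a1 * d2 + b2 * d2 + 2 * a1 * c2))" by simp
        then have "2 * s * a1 \<le> N + (2 * a1 * d2 + b2 * d2 + 2 * a1 * c2)" by (simp only: of_nat_le_iff)
        from value0_gen_monomial_term(1)[OF this] show ?thesis using True by (simp add: e coord_gen_monomial a1_def)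
      next
        case False
        then show ?thesis by (auto simp: e coord_gen_monomial)
      qed
    qed
  qed
  have "coord ?y (a, 0, c, 0) = q ^ N * (dp_binom J1 s a0 * q ^ (2 * a0 * c))"
  proof -
    have "a - s = a0" "s \<le> a" using sx(2) by linarith+
    then show ?thesis by (simp add: coord_gen_monomial x_def)
  qed
  then have "value0 (coord ?y (a, 0, c, 0)) 1" using value0_gen_monomial_term(2)[of s a0 N "2 * a0 * c"] N by simp
  then have 1: "value0 (coord (star ?y) (a, 0, c, 0)) (1 * of_int (rsign (a, 0, c, 0)))"
    by (intro value0_star Zy) (simp add: assms(2))
  have "star ?y = q ^ N *\<^sub>q gen_monomial x (2 * c) s 0"
    by (simp add: gen_monomial_def star_mult star_divpow mult.assoc)
  then have "coord (star ?y) (a, 0, c, 0) = q ^ N * (dp_binom J1 x (s - c) * q ^ (2 * (s - c) * c))"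
  proof -
    have "a - x = s - c" "x \<le> a" "s - c + c = s" using sx by linarith+
    then show ?thesis using \<open>star ?y = _\<close> by (simp add: coord_gen_monomial)
  qed
  moreover have "2 * x * (s - c) = N + 2 * (s - c) * c" unfolding N_def x_def by (simp add: algebra_simps)
  ultimately have "value0 (coord (star ?y) (a, 0, c, 0)) 1" using value0_gen_monomial_term(2)[of x "s - c" N "2 * (s - c) * c"] by simp
  then have "rat_of_int (rsign (a, 0, c, 0)) = 1" using 1 value0_unique by fastforce
  then show ?thesis by simp
qed

text \<open>If the last exponent of \<open>c\<close> or of \<open>rindex c\<close> is positive, it
  can be lowered, the sign being the same for both. Otherwise \<open>depth_eq\<close> forces both
  indices into the shape \<open>(a, 0, c, 0)\<close> with \<open>c \<le> a\<close>; the weight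
  determines such an index, so \<open>rindex\<close> fixes it.\<close>

lemma rsign_1: "rsign c = 1"
proof (induction "snd (wt c)" arbitrary: c rule: less_induct)
  case less
  have pos: "rsign e = 1" if we: "wt e = wt c" and he: "last_exp e \<noteq> 0" for e
  proof -
    obtain a b c' d where e: "e = (a, b, c', d)" by (cases e)
    obtain d' where d: "d = Suc d'" using he by (auto simp: e last_exp_def gr0_conv_Suc)
    have "snd (wt (a, b, c', d')) < snd (wt c)" unfolding we[symmetric] by (simp add: e d wt_def)
    then have "rsign (a, b, c', d') = 1" by (rule less)
    then show ?thesis using rsign_incr_last[of "(a, b, c', d')"] by (simp add: e d incr_last_def)
  qed
  show ?case
  proof (cases "last_exp c = 0 \<and> last_exp (rindex c) = 0")
    case False
    then show ?thesis using pos[of c] pos[of "rindex c"] by (auto simp: wt_rindex)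
  next
    case True
    then have e: "depth c = 0" "depth (rindex c) = 0" using depth_eq[of c] depth_eq[of "rindex c"] by simp_all
    obtain a b c' d where c: "c = (a, b, c', d)" by (cases c)
    obtain a2 b2 c2 d2 where s: "rindex c = (a2, b2, c2, d2)" by (cases "rindex c")
    have "depth (a2, b2, c2, d2) = 0" "last_exp (a2, b2, c2, d2) = 0" using e(2) True unfolding s by simp_all
    then have h: "b = 0" "d = 0" "c' \<le> a" "b2 = 0" "d2 = 0"
      using True e unfolding c by (auto simp: depth_def last_exp_def)
    have "wt (rindex c) = wt c" by (rule wt_rindex)
    then have "rindex c = c" using h unfolding s by (simp add: c wt_def)
    then show ?thesis using rsign_fixed[of c' a] h by (simp add: c)
  qed
qed

subsection \<open>The two canonical bases\<close>

text \<open>Modulo \<open>q\<close>, \<open>star x\<close> and the canonical element at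
  \<open>rindex c\<close> reduce to the same PBW vector; their difference is bar-invariant, hence
  zero.\<close>

lemma is_can_star: assumes "is_can x c" shows "is_can (star x) (rindex c)"
proof -
  obtain x' where x': "is_can x' (rindex c)" using is_can_ex by blast
  have e: "in_qZq_lattice (x - L_h c)" if "is_can x c" for x c
    using that by (auto simp: in_qZq_lattice_def is_can_def coord_diff delta_def)
  have 1: "in_qZq_lattice (star x - star (L_h c))" using in_qZq_lattice_star[OF e[OF assms]] by (simp add: star_diff)
  have 2: "in_qZq_lattice (star (L_h c) - L_h (rindex c))"
    using star_L_mod[of c] by (simp add: in_qZq_lattice_def coord_diff rsign_1)
  have "coord (star x - x') k \<in> qZq" for k
  proof -
    have "coord (star x - star (L_h c)) k + coord (star (L_h c) - L_h (rindex c)) k - coord (x' - L_h (rindex c)) k \<in> qZq"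
      using 1 2 e[OF x'] by (intro qZq_diff qZq_add) (simp_all add: in_qZq_lattice_def)
    then show ?thesis by (simp add: coord_diff)
  qed
  moreover have "ubar (star x - x') = star x - x'"
    using assms x' by (simp add: is_can_def ubar_diff ubar_star)
  ultimately have "star x - x' = 0" by (intro bar_fixed_small)
  then show ?thesis using x' by simp
qed

text \<open>\<open>R\<close> stands for either order, the one for \<open>L_h'\<close> being read
  through \<open>rev_exp\<close>.\<close>

lemma is_can_expand:
  assumes x: "is_can x c" and "\<And>e. above c e \<Longrightarrow> R e" "\<not> R c"
  shows "finite {e. R e \<and> coord x e \<noteq> 0}" "x = L_h c + (\<Sum>e | R e \<and> coord x e \<noteq> 0. coord x e *\<^sub>q L_h e)"
proof -
  have s: "supp x = insert c {e. R e \<and> coord x e \<noteq> 0}"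
    using assms unfolding supp_def is_can_def by force
  show f: "finite {e. R e \<and> coord x e \<noteq> 0}"
    by (rule finite_subset[OF _ finite_supp[of x]]) (auto simp: supp_def)
  have "x = (\<Sum>e\<in>insert c {e. R e \<and> coord x e \<noteq> 0}. coord x e *\<^sub>q L_h e)"
    using PBW_expansion[of x] unfolding s .
  then show "x = L_h c + (\<Sum>e | R e \<and> coord x e \<noteq> 0. coord x e *\<^sub>q L_h e)"
    using f assms(3) x by (simp add: is_can_def)
qed

text \<open>The involution \<open>T\<close>, later the identity or \<open>star\<close>, carries the
  difference of two candidates to \<open>L_h\<close> coordinates, where
  \<open>bar_fixed_small\<close> applies.\<close>

lemma canonical_eq:
  assumes "is_canonical L c b0" and "\<And>b. is_canonical L c b \<Longrightarrow> in_qZq_lattice (T b - T (L c))"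
    and "\<And>b. ubar (T b) = T (ubar b)" "\<And>x y. T (x - y) = T x - T y" "\<And>x. T (T x) = x"
  shows "canonical L c = b0"
  unfolding canonical_def
proof (rule the_equality)
  show "is_canonical L c b0" by (rule assms(1))
  fix b assume b: "is_canonical L c b"
  have "coord (T (b - b0)) e \<in> qZq" for e
  proof -
    have "coord (T b - T (L c)) e - coord (T b0 - T (L c)) e \<in> qZq"
      using assms(2)[OF b] assms(2)[OF assms(1)] by (intro qZq_diff) (simp_all add: in_qZq_lattice_def)
    then show ?thesis by (simp add: assms(4) coord_diff)
  qed
  moreover have "ubar (T (b - b0)) = T (b - b0)"
    using b assms(1) by (simp add: assms(3) ubar_diff is_canonical_def)
  ultimately have "T (b - b0) = 0" by (intro bar_fixed_small)
  then have "T b = T b0" by (simp add: assms(4))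
  then show "b = b0" by (metis assms(5))
qed

lemma canonical_L_h: assumes "is_can x c" shows "canonical L_h c = x"
proof (rule canonical_eq[where T = id])
  have "above c e \<Longrightarrow> c \<prec> e" for e by (simp add: above_def)
  then have ex: "finite {e. c \<prec> e \<and> coord x e \<noteq> 0}" "x = L_h c + (\<Sum>e | c \<prec> e \<and> coord x e \<noteq> 0. coord x e *\<^sub>q L_h e)"
    using is_can_expand[OF assms, of "\<lambda>e. c \<prec> e"] prec_irrefl by blast+
  show "is_canonical L_h c x"
    unfolding is_canonical_def bar_eq
  proof (intro conjI exI[of _ "coord x"] allI impI)
    show "ubar x = x" using assms by (simp add: is_can_def)
    show "coord x e \<in> qZq" if "c \<prec> e" for e
    proof -
      have "e \<noteq> c" using that prec_irrefl by blast
      then show ?thesis using assms unfolding is_can_def by blast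
    qed
  qed (rule ex)+
  fix b assume "is_canonical L_h c b"
  then obtain p where p: "\<And>e. c \<prec> e \<Longrightarrow> p e \<in> qZq" "b = L_h c + (\<Sum>e | c \<prec> e \<and> p e \<noteq> 0. p e *\<^sub>q L_h e)"
    unfolding is_canonical_def by blast
  then show "in_qZq_lattice (id b - id (L_h c))"
    by (auto simp: in_qZq_lattice_def coord_sum delta_def intro!: qZq_sum)
qed simp_all

lemma L_h'_rv: "L_h' c = star (L_h (rev_exp c))"
  by (cases c) (simp add: L_h'_star rev_exp_def)

lemma canonical_L_h': assumes "is_can x (rev_exp c)" shows "canonical L_h' c = star x"
proof (rule canonical_eq[where T = star])
  have "above (rev_exp c) e \<Longrightarrow> c \<prec> rev_exp e" for e by (simp add: above_def)
  moreover have "\<not> c \<prec> rev_exp (rev_exp c)" by (simp add: prec_irrefl)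
  ultimately have ex: "finite {e. c \<prec> rev_exp e \<and> coord x e \<noteq> 0}"
      "x = L_h (rev_exp c) + (\<Sum>e | c \<prec> rev_exp e \<and> coord x e \<noteq> 0. coord x e *\<^sub>q L_h e)"
    using is_can_expand[OF assms, of "\<lambda>e. c \<prec> rev_exp e"] by blast+
  have im: "{e. c \<prec> e \<and> coord x (rev_exp e) \<noteq> 0} = rev_exp ` {e. c \<prec> rev_exp e \<and> coord x e \<noteq> 0}"
  proof (intro equalityI subsetI)
    fix e assume "e \<in> {e. c \<prec> e \<and> coord x (rev_exp e) \<noteq> 0}"
    then show "e \<in> rev_exp ` {e. c \<prec> rev_exp e \<and> coord x e \<noteq> 0}" by (intro image_eqI[of _ _ "rev_exp e"]) simp_all
  qed auto
  have inj: "inj_on rev_exp A" for A by (metis inj_onI rev_exp_rev_exp)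
  show "is_canonical L_h' c (star x)"
    unfolding is_canonical_def bar_eq
  proof (intro conjI exI[of _ "\<lambda>e. coord x (rev_exp e)"] allI impI)
    show "ubar (star x) = star x" using assms by (simp add: is_can_def ubar_star)
    show "coord x (rev_exp e) \<in> qZq" if "c \<prec> e" for e
    proof -
      have "rev_exp e \<noteq> rev_exp c" using that prec_irrefl by (metis rev_exp_rev_exp)
      then show ?thesis using assms unfolding is_can_def by blast
    qed
    show "finite {e. c \<prec> e \<and> coord x (rev_exp e) \<noteq> 0}" unfolding im using ex(1) by simp
    have "star x = star (L_h (rev_exp c)) + (\<Sum>e | c \<prec> rev_exp e \<and> coord x e \<noteq> 0. coord x e *\<^sub>q star (L_h e))"
      by (subst ex(2)) (simp add: star_add star_sum)
    also have "(\<Sum>e | c \<prec> rev_exp e \<and> coord x e \<noteq> 0. coord x e *\<^sub>q star (L_h e)) = (\<Sum>e | c \<prec> e \<and> coord x (rev_exp e) \<noteq> 0. coord x (rev_exp e) *\<^sub>q L_h' e)"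
      unfolding im by (subst sum.reindex[OF inj]) (simp add: L_h'_rv)
    finally show "star x = L_h' c + (\<Sum>e | c \<prec> e \<and> coord x (rev_exp e) \<noteq> 0. coord x (rev_exp e) *\<^sub>q L_h' e)"
      by (simp add: L_h'_rv)
  qed
  fix b assume "is_canonical L_h' c b"
  then obtain p where p: "\<And>e. c \<prec> e \<Longrightarrow> p e \<in> qZq" "b = L_h' c + (\<Sum>e | c \<prec> e \<and> p e \<noteq> 0. p e *\<^sub>q L_h' e)"
    unfolding is_canonical_def by blast
  then show "in_qZq_lattice (star b - star (L_h' c))"
    by (auto simp: in_qZq_lattice_def coord_sum delta_def star_add star_sum L_h'_rv intro!: qZq_sum)
qed (simp_all add: ubar_star star_diff)

theorem theorem3p17:
  shows "B_h = B_h'"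
proof (intro equalityI subsetI)
  fix b assume "b \<in> B_h"
  then obtain c where c: "b = canonical L_h c" by (auto simp: B_h_def)
  obtain x where x: "is_can x c" using is_can_ex by blast
  \<comment> \<open>\<open>b\<close> is \<open>x\<close>, that is, the reversal of
    \<open>star x\<close>; and \<open>star x\<close> is itself canonical, at the index
    \<open>rindex c\<close>.\<close>
  have "is_can (star x) (rev_exp (rev_exp (rindex c)))" using is_can_star[OF x] by simp
  then have "canonical L_h' (rev_exp (rindex c)) = star (star x)" by (rule canonical_L_h')
  then show "b \<in> B_h'" using canonical_L_h[OF x] unfolding c B_h'_def by auto
next
  fix b assume "b \<in> B_h'"
  then obtain c where c: "b = canonical L_h' c" by (auto simp: B_h'_def)
  obtain x where x: "is_can x (rev_exp c)" using is_can_ex by blast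
  have "canonical L_h (rindex (rev_exp c)) = star x" by (rule canonical_L_h[OF is_can_star[OF x]])
  then have "b = canonical L_h (rindex (rev_exp c))" using canonical_L_h'[OF x] c by simp
  then show "b \<in> B_h" unfolding B_h_def by blast
qed

end
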